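(* Let $\mathcal{H}$ be a hypothesis class on $(\mathcal{X},\Sigma)$ with finite VC dimension $d_{\mathcal{H}}$. Fix any $0<\alpha<\frac12$, $0<\delta_0<\frac12$, and $0<\epsilon_0\le\frac{\alpha}{d_{\mathcal{H}}}$ satisfying $\alpha+2\epsilon_0<\frac12$. Let $\mathcal{U}$ denote all pairs of distributions $(\mu_0,\mu_1)$ over $(\mathcal{X},\Sigma)$ such that the set $\mathcal{H}_\alpha(\mu_0)$ is non-empty. In what follows, $\hat h$ denotes any $(\epsilon_0,\delta_0)$-approximate $\alpha$-learner operating on $S_{\mu_0}\sim\mu_0^{n_0}$ and $S_{\mu_1}\sim\mu_1^{n}$. Let $n_0=n_0(\frac{\epsilon_0}{2},\delta_0)$, and assume $n$ is large enough so that $\frac{d_{\mathcal{H}}}{n}\le\frac12$. (i) Suppose $\mathcal{H}$ separates three points. Then, for some universal constants $c,C>0$, $$c\cdot\sqrt{\frac{d_{\mathcal{H}}}{n}}\ \le\ \inf_{\hat h}\ \sup_{\mathcal{U}}\ \mathbb{E}_{S_{\mu_0},S_{\mu_1}}\Big[\mathcal{E}_\alpha(\hat h)\cdot\mathbf{1}\{\hat h\in\mathcal{H}_{\alpha+\epsilon_0}(\mu_0)\}\Big]\ \lesssim\ C\cdot\sqrt{\frac{d_{\mathcal{H}}}{n}}+\delta_0.$$ (ii) Suppose $\mathcal{H}$ does not separate three points. The minimax rate is then of strictly lower order, either $d_{\mathcal{H}}/n$ or $0$. More specifically, the following holds. (a) Suppose there exists a distribution $\mu_0$ over $(\mathcal{X},\Sigma)$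 with finite support such that $\mathcal{H}_{\alpha+\epsilon_0}(\mu_0)$ does not admit a maximal element. Then, for some universal constants $c,C>0$, $$c\cdot\frac{d_{\mathcal{H}}}{n}\ \le\ \inf_{\hat h}\ \sup_{\mathcal{U}}\ \mathbb{E}_{S_{\mu_0},S_{\mu_1}}\Big[\mathcal{E}_\alpha(\hat h)\cdot\mathbf{1}\{\hat h\in\mathcal{H}_{\alpha+\epsilon_0}(\mu_0)\}\Big]\ \lesssim\ C\cdot\frac{d_{\mathcal{H}}}{n}+\delta_0.$$ (b) If for all distributions $\mu_0$ over $(\mathcal{X},\Sigma)$ with finite support, $\mathcal{H}_{\alpha+\epsilon_0}(\mu_0)$ admits a maximal element, then for all $(\mu_0,\mu_1)\in\mathcal{U}$ we have $$\inf_{\hat h}\ \mathbb{P}\Big(\mathcal{E}_\alpha(\hat h)\cdot\mathbf{1}\{\hat h\in\mathcal{H}_{\alpha+\epsilon_0}(\mu_0)\}=0\Big)\ \ge\ 1-\delta_0 .$$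
   Context: Setting: $(\mathcal{X},\Sigma)$ is a measurable space in which every singleton $\{x\}$ is measurable. A hypothesis class $\mathcal{H}$ is a set of measurable functions $h:\mathcal{X}\to\{0,1\}$; $\{h=1\}=\{x: h(x)=1\}$. The VC dimension $d_{\mathcal{H}}$ is the largest number of points on which $\mathcal{H}$ realizes every $0$-$1$ labeling. For probability distributions $\mu_0,\mu_1$ on $(\mathcal{X},\Sigma)$: $R_{\mu_0}(h)=\mu_0(\{h=1\})$, $R_{\mu_1}(h)=\mu_1(\{h=0\})$, and for a level $a\in(0,1]$, $\mathcal{H}_a(\mu_0)=\{h\in\mathcal{H}: R_{\mu_0}(h)\le a\}$. The $\mu_1$-excess-risk of $\hat h\in\mathcal{H}$ at level $\alpha$ is $$\mathcal{E}_\alpha(\hat h)=\max\Big\{0,\ R_{\mu_1}(\hat h)-\inf_{h\in\mathcal{H}_\alpha(\mu_0)}R_{\mu_1}(h)\Big\}.$$ For an i.i.d. sample $S_{\mu_0}\sim\mu_0^{m}$, $\hat R_{\mu_0}(h)=\frac1m\sum_{X\in S_{\mu_0}}\mathbf{1}\{h(X)\neq 0\}$. $(\epsilon_0,\delta_0)$-approximate $\alpha$-learner (for $0<\epsilon_0,\delta_0<1$): $\hat h$ is called so if it maps any two independent i.i.d. samples $S_{\mu_0}\sim\mu_0^{n_0}$ and $S_{\mu_1}\sim\mu_1^{n}$, with $\mu_0,\mu_1$ unknown, to a function in $\mathcal{H}_{\alpha+\epsilon_0}(\mu_0)$ with probability $1-\delta_0$ with respect to $S_{\mu_0},S_{\mu_1}$.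 The symbol $\hat h$ denotes both the learner and the function in $\mathcal{H}$ it returns. Sample size: for $0<\epsilon,\delta<1$, $n_0(\epsilon,\delta)$ (depending on $\mathcal{H}$) is the minimum sample size $m$ such that, with $S_{\mu_0}\sim\mu_0^m$, $\sup_{\mu_0}\mathbb{P}_{S_{\mu_0}}\big(\sup_{h\in\mathcal{H}}|\hat R_{\mu_0}(h)-R_{\mu_0}(h)|>\epsilon\big)\le\delta$, the outer supremum being over all probability distributions $\mu_0$ on $(\mathcal{X},\Sigma)$. Maximal element: a subset $\tilde{\mathcal{H}}\subset\mathcal{H}$ admits a maximal element if there is $h\in\tilde{\mathcal{H}}$ such that $\{h=1\}\supset\{h'=1\}$ for all $h'\in\tilde{\mathcal{H}}$. Three-points-separation: $\mathcal{H}$ separates three points if there exist $h_1,h_2\in\mathcal{H}$ and $x_0,x_1,x_2\in\mathcal{X}$ with (1) $h_1(x_0)=h_2(x_0)=0$, and (2) $h_1(x_1)=h_2(x_2)=1$ and $h_1(x_2)=h_2(x_1)=0$. The notation $\lesssim$ means inequality up to constants and $\log n$ terms.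
   Formalization: The upper bounds and (b) assume the Vapnik–Chervonenkis measurability condition (else n_0 may not exist); learners must succeed only on U; in (a) the class H_{α+ε0}(μ0) is nonempty; (b) says one learner works for all pairs in U; constants are uniform over spaces within each carrier set. *)

theory Defs
  imports "HOL-Probability.Probability"
begin

text \<open>
  A measure \<open>M\<close> is only used through its underlying measurable space.  A classifier is a
  predicate \<open>h\<close>, where \<open>True\<close> plays the role of the label 1 and \<open>False\<close> that of the label 0.
\<close>

definition hypothesis_class :: "'a measure \<Rightarrow> ('a \<Rightarrow> bool) set \<Rightarrow> bool" where
  "hypothesis_class M H \<longleftrightarrow> (\<forall>h\<in>H. h \<in> measurable M (count_space UNIV))"

definition singletons_measurable :: "'a measure \<Rightarrow> bool" where
  "singletons_measurable M \<longleftrightarrow> (\<forall>x\<in>space M. {x} \<in> sets M)"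

definition distributions :: "'a measure \<Rightarrow> 'a measure set" where
  "distributions M = {\<mu>. prob_space \<mu> \<and> sets \<mu> = sets M}"

definition finite_support :: "'a measure \<Rightarrow> bool" where
  "finite_support \<mu> \<longleftrightarrow> (\<exists>F\<in>sets \<mu>. finite F \<and> measure \<mu> F = 1)"


definition shatters :: "('a \<Rightarrow> bool) set \<Rightarrow> 'a set \<Rightarrow> bool" where
  "shatters H A \<longleftrightarrow> (\<forall>l :: 'a \<Rightarrow> bool. \<exists>h\<in>H. \<forall>x\<in>A. h x = l x)"

text \<open>
  \<open>has_vc_dim M H d\<close>: the VC dimension of \<open>H\<close> is finite and equal to \<open>d\<close>.  It forces \<open>H\<close> to be
  nonempty, since the empty class does not shatter even the empty set.
\<close>

definition has_vc_dim :: "'a measure \<Rightarrow> ('a \<Rightarrow> bool) set \<Rightarrow> nat \<Rightarrow> bool" where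
  "has_vc_dim M H d \<longleftrightarrow>
     (\<exists>A\<subseteq>space M. finite A \<and> card A = d \<and> shatters H A) \<and>
     (\<forall>A\<subseteq>space M. finite A \<and> shatters H A \<longrightarrow> card A \<le> d)"


definition risk0 :: "'a measure \<Rightarrow> ('a \<Rightarrow> bool) \<Rightarrow> real" where
  "risk0 \<mu>0 h = measure \<mu>0 {x \<in> space \<mu>0. h x}"

definition risk1 :: "'a measure \<Rightarrow> ('a \<Rightarrow> bool) \<Rightarrow> real" where
  "risk1 \<mu>1 h = measure \<mu>1 {x \<in> space \<mu>1. \<not> h x}"

definition level_class :: "('a \<Rightarrow> bool) set \<Rightarrow> real \<Rightarrow> 'a measure \<Rightarrow> ('a \<Rightarrow> bool) set" where
  "level_class H a \<mu>0 = {h \<in> H. risk0 \<mu>0 h \<le> a}"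

definition excess_risk ::
  "('a \<Rightarrow> bool) set \<Rightarrow> real \<Rightarrow> 'a measure \<Rightarrow> 'a measure \<Rightarrow> ('a \<Rightarrow> bool) \<Rightarrow> real" where
  "excess_risk H \<alpha> \<mu>0 \<mu>1 h =
     max 0 (risk1 \<mu>1 h - (INF h'\<in>level_class H \<alpha> \<mu>0. risk1 \<mu>1 h'))"

definition admissible_pairs ::
  "'a measure \<Rightarrow> ('a \<Rightarrow> bool) set \<Rightarrow> real \<Rightarrow> ('a measure \<times> 'a measure) set" where
  "admissible_pairs M H \<alpha> =
     {(\<mu>0, \<mu>1). \<mu>0 \<in> distributions M \<and> \<mu>1 \<in> distributions M \<and> level_class H \<alpha> \<mu>0 \<noteq> {}}"


definition has_maximal_element :: "'a measure \<Rightarrow> ('a \<Rightarrow> bool) set \<Rightarrow> bool" where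
  "has_maximal_element M K \<longleftrightarrow>
     (\<exists>h\<in>K. \<forall>h'\<in>K. {x \<in> space M. h' x} \<subseteq> {x \<in> space M. h x})"

definition separates_three_points :: "'a measure \<Rightarrow> ('a \<Rightarrow> bool) set \<Rightarrow> bool" where
  "separates_three_points M H \<longleftrightarrow>
     (\<exists>h1\<in>H. \<exists>h2\<in>H. \<exists>x0\<in>space M. \<exists>x1\<in>space M. \<exists>x2\<in>space M.
        \<not> h1 x0 \<and> \<not> h2 x0 \<and> h1 x1 \<and> h2 x2 \<and> \<not> h1 x2 \<and> \<not> h2 x1)"


text \<open>
  An i.i.d. sample of size \<open>m\<close> is a point of the \<open>m\<close>-fold product space.  For a general class
  \<open>H\<close> the events and random variables below need not be measurable.  Probabilities to be bounded
  from above are therefore outer probabilities, those to be bounded from below are inner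
  probabilities, and expectations are outer expectations; on measurable events and functions
  these are the ordinary ones.
\<close>

abbreviation iid :: "nat \<Rightarrow> 'a measure \<Rightarrow> (nat \<Rightarrow> 'a) measure" where
  "iid m \<mu> \<equiv> PiM {..<m} (\<lambda>_. \<mu>)"

definition inner_prob :: "'a measure \<Rightarrow> ('a \<Rightarrow> bool) \<Rightarrow> ennreal" where
  "inner_prob P Q = (SUP A\<in>{A \<in> sets P. \<forall>x\<in>A. Q x}. emeasure P A)"

definition outer_expectation :: "'a measure \<Rightarrow> ('a \<Rightarrow> real) \<Rightarrow> ennreal" where
  "outer_expectation P f =
     (INF g\<in>{g \<in> borel_measurable P. \<forall>x\<in>space P. ennreal (f x) \<le> g x}. \<integral>\<^sup>+ x. g x \<partial>P)"

definition emp_risk0 :: "nat \<Rightarrow> (nat \<Rightarrow> 'a) \<Rightarrow> ('a \<Rightarrow> bool) \<Rightarrow> real" where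
  "emp_risk0 m S h = (\<Sum>i<m. of_bool (h (S i))) / real m"

definition uniform_deviation ::
  "('a \<Rightarrow> bool) set \<Rightarrow> 'a measure \<Rightarrow> nat \<Rightarrow> (nat \<Rightarrow> 'a) \<Rightarrow> real" where
  "uniform_deviation H \<mu> m S = (SUP h\<in>H. \<bar>emp_risk0 m S h - risk0 \<mu> h\<bar>)"

definition sample_size :: "'a measure \<Rightarrow> ('a \<Rightarrow> bool) set \<Rightarrow> real \<Rightarrow> real \<Rightarrow> nat" where
  "sample_size M H \<epsilon> \<delta> = (LEAST m. 1 \<le> m \<and>
     (SUP \<mu>\<in>distributions M.
        outer_measure_of (iid m \<mu>) {S \<in> space (iid m \<mu>). uniform_deviation H \<mu> m S > \<epsilon>})
     \<le> ennreal \<delta>)"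

text \<open>
  The classical measurability condition of Vapnik and Chervonenkis: the uniform deviation, and its
  symmetrized version for a sample and an independent ghost sample of the same size, are random
  variables (up to null sets).  It holds for countable and, more generally, for image admissible
  Suslin classes.  Without it, finite VC dimension does not imply uniform convergence, so
  \<open>sample_size\<close> may be undefined.
\<close>

definition vc_measurable :: "'a measure \<Rightarrow> ('a \<Rightarrow> bool) set \<Rightarrow> bool" where
  "vc_measurable M H \<longleftrightarrow> (\<forall>\<mu>\<in>distributions M. \<forall>m.
     uniform_deviation H \<mu> m \<in> borel_measurable (completion (iid m \<mu>)) \<and>
     (\<lambda>S. SUP h\<in>H. \<bar>emp_risk0 m S h - emp_risk0 m (\<lambda>i. S (m + i)) h\<bar>)
       \<in> borel_measurable (completion (iid (2 * m) \<mu>)))"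


text \<open>
  A learner maps the pair of samples to a member of the class.  The requirement that it lands in
  the class of level \<open>\<alpha> + \<epsilon>0\<close> is imposed for the admissible pairs only: if this class is empty
  for some \<open>\<mu>0\<close>, then no learner whatsoever could meet the requirement for that \<open>\<mu>0\<close>.
\<close>

type_synonym 'a learner = "(nat \<Rightarrow> 'a) \<times> (nat \<Rightarrow> 'a) \<Rightarrow> ('a \<Rightarrow> bool)"

abbreviation sample_pair :: "nat \<Rightarrow> nat \<Rightarrow> 'a measure \<Rightarrow> 'a measure
    \<Rightarrow> ((nat \<Rightarrow> 'a) \<times> (nat \<Rightarrow> 'a)) measure" where
  "sample_pair n0 n \<mu>0 \<mu>1 \<equiv> iid n0 \<mu>0 \<Otimes>\<^sub>M iid n \<mu>1"

definition approx_learners ::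
  "'a measure \<Rightarrow> ('a \<Rightarrow> bool) set \<Rightarrow> real \<Rightarrow> real \<Rightarrow> real \<Rightarrow> nat \<Rightarrow> nat \<Rightarrow> 'a learner set" where
  "approx_learners M H \<alpha> \<epsilon>0 \<delta>0 n0 n =
     {L. (\<forall>S\<in>space (sample_pair n0 n M M). L S \<in> H) \<and>
         (\<forall>(\<mu>0, \<mu>1)\<in>admissible_pairs M H \<alpha>.
            inner_prob (sample_pair n0 n \<mu>0 \<mu>1) (\<lambda>S. L S \<in> level_class H (\<alpha> + \<epsilon>0) \<mu>0)
              \<ge> ennreal (1 - \<delta>0))}"

definition truncated_excess ::
  "('a \<Rightarrow> bool) set \<Rightarrow> real \<Rightarrow> real \<Rightarrow> 'a measure \<Rightarrow> 'a measure \<Rightarrow> ('a \<Rightarrow> bool) \<Rightarrow> real" where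
  "truncated_excess H \<alpha> \<epsilon>0 \<mu>0 \<mu>1 h =
     excess_risk H \<alpha> \<mu>0 \<mu>1 h * of_bool (h \<in> level_class H (\<alpha> + \<epsilon>0) \<mu>0)"

definition minimax_risk ::
  "'a measure \<Rightarrow> ('a \<Rightarrow> bool) set \<Rightarrow> real \<Rightarrow> real \<Rightarrow> real \<Rightarrow> nat \<Rightarrow> nat \<Rightarrow> ennreal" where
  "minimax_risk M H \<alpha> \<epsilon>0 \<delta>0 n0 n =
     (INF L\<in>approx_learners M H \<alpha> \<epsilon>0 \<delta>0 n0 n. SUP (\<mu>0, \<mu>1)\<in>admissible_pairs M H \<alpha>.
        outer_expectation (sample_pair n0 n \<mu>0 \<mu>1) (\<lambda>S. truncated_excess H \<alpha> \<epsilon>0 \<mu>0 \<mu>1 (L S)))"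

end

theory Submission
  imports Defs
begin

text \<open>
  All learners select from the hypotheses of empirical \<open>\<mu>0\<close>-risk at most \<open>\<alpha> + \<epsilon>0 / 2\<close>, which with
  probability \<open>1 - \<delta>0\<close> lie between the classes of levels \<open>\<alpha>\<close> and \<open>\<alpha> + \<epsilon>0\<close>.  Minimizing the empirical
  \<open>\<mu>1\<close>-risk among them gives the rate \<open>sqrt (d / n)\<close> by Vapnik--Chervonenkis symmetrization, and
  Assouad's method on pairs of points between which \<open>\<mu>0\<close> leaves a forced choice gives the matching
  lower bound.

  If three points are not separated, two hypotheses with a common zero are nested, so every level
  class below \<open>1/2\<close> is a chain.  The same learner then only misses the top of a chain, and it misses
  mass \<open>t\<close> with probability at most \<open>(1 - t) ^ n\<close>.  If maximal elements exist, choosing the maximal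
  element has no excess risk at all.  If not, some distribution on two points \<open>c1\<close>, \<open>c2\<close> has a level
  class without maximal element, and an atom of \<open>\<mu>1\<close> of mass \<open>1 / (4 * n)\<close> placed beyond all finitely
  many hypotheses that the learner may return stays undetected with constant probability.
\<close>

section \<open>The Sauer--Shelah lemma and Massart's inequality\<close>

text \<open>Learners are arbitrary functions and suprema over an uncountable class need not be
  measurable; this shapes both halves. Upper bounds exhibit a measurable majorant
  \<open>G S1 + indicator A S0\<close>, where \<open>A\<close> is the exceptional event of the first
  sample and the source of the additive \<delta>0. Lower bounds use finitely supported
  distributions, where finite sums over index sequences bound inner probabilities from above and
  outer expectations from below, for any learner. In the slow lower bound every point of k pairs has
  \<mu>0-mass \<alpha> / k, so one point too many costs more than \<epsilon>0 \<le> \<alpha> / d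
  once k < d. Taking k about d / 2 yields this strict inequality together with a reserve point that
  carries the rest of \<mu>0.\<close>

definition set_shatters :: "'b set set \<Rightarrow> 'b set \<Rightarrow> bool" where
  "set_shatters F I \<longleftrightarrow> (\<forall>J\<subseteq>I. \<exists>U\<in>F. U \<inter> I = J)"

text \<open>Pajor's strengthening: counting the shattered sets instead of bounding their size makes
  the induction on the ground set go through. Deleting \<open>x\<close> merges exactly the pairs U,
  \<open>insert x U\<close> recorded in \<open>F1\<close>. Sets shattered by \<open>F0\<close> are
  shattered by F, and those shattered by \<open>F1\<close> remain so after adding
  \<open>x\<close>.\<close>

lemma pajor:
  assumes "finite X" "F \<subseteq> Pow X"
  shows "card F \<le> card {I. I \<subseteq> X \<and> set_shatters F I}"
  using assms
proof (induction X arbitrary: F rule: finite_induct)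
  case empty
  then have "F = {} \<or> F = {{}}" by (simp add: subset_singleton_iff)
  then show ?case
  proof
    assume "F = {{}}"
    moreover from this have "{I. I \<subseteq> {} \<and> set_shatters F I} = {{}}" by (auto simp: set_shatters_def)
    ultimately show ?thesis by simp
  qed simp
next
  case (insert x X)
  let ?S = "\<lambda>F. {I. I \<subseteq> X \<and> set_shatters F I}"
  define F0 where "F0 = (\<lambda>U. U - {x}) ` F"
  define F1 where "F1 = {U \<in> F. x \<notin> U \<and> insert x U \<in> F}"
  have finF: "finite F" using insert.prems insert.hyps by (meson finite.insertI finite_Pow_iff finite_subset)
  have "card F = card F0 + card F1"
  proof -
    define A where "A = {U\<in>F. x \<notin> U}"
    define B where "B = (\<lambda>U. U - {x}) ` {U\<in>F. x \<in> U}"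
    have "card F = card A + card {U\<in>F. x \<in> U}"
      unfolding A_def using finF by (subst card_Un_disjoint[symmetric]) (auto intro!: arg_cong[where f=card])
    moreover have "card B = card {U\<in>F. x \<in> U}"
      unfolding B_def by (rule card_image) (auto simp: inj_on_def)
    moreover have "F0 = A \<union> B"
    proof -
      have "F = A \<union> {U\<in>F. x \<in> U}" unfolding A_def by auto
      then have "F0 = (\<lambda>U. U - {x}) ` A \<union> B" unfolding F0_def B_def by (metis image_Un)
      moreover have "(\<lambda>U. U - {x}) ` A = A" unfolding A_def by (force simp: image_def)
      ultimately show ?thesis by simp
    qed
    moreover have "F1 = A \<inter> B"
    proof -
      have "U \<in> B \<longleftrightarrow> insert x U \<in> F" if "x \<notin> U" for U
      proof
        assume "U \<in> B"
        then obtain V where "V \<in> F" "x \<in> V" "U = V - {x}" unfolding B_def by auto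
        then show "insert x U \<in> F" by (simp add: insert_absorb)
      next
        assume "insert x U \<in> F"
        moreover have "U = insert x U - {x}" using that by simp
        ultimately show "U \<in> B" unfolding B_def by blast
      qed
      then show ?thesis unfolding F1_def A_def by auto
    qed
    moreover have "finite A" "finite B" using finF by (auto simp: A_def B_def)
    ultimately show ?thesis using card_Un_Int[of A B] by simp
  qed
  also have "\<dots> \<le> card (?S F0) + card (?S F1)"
    using insert.prems by (intro add_mono insert.IH) (auto simp: F0_def F1_def)
  also have "\<dots> = card (?S F0) + card (insert x ` ?S F1)"
    using insert.hyps by (subst card_image) (auto simp: inj_on_def)
  \<comment> \<open>Sets of the first kind avoid \<open>x\<close> and those of the second contain
    it, so nothing is counted twice.\<close>
  also have "\<dots> = card (?S F0 \<union> insert x ` ?S F1)"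
    using insert.hyps by (intro card_Un_disjoint[symmetric]) auto
  also have "\<dots> \<le> card {I. I \<subseteq> insert x X \<and> set_shatters F I}"
  proof (rule card_mono)
    show "finite {I. I \<subseteq> insert x X \<and> set_shatters F I}" using insert.hyps by simp
    have "set_shatters F I" if I: "I \<subseteq> X" "set_shatters F0 I" for I
      unfolding set_shatters_def
    proof (intro allI impI)
      fix J assume "J \<subseteq> I"
      then obtain U where "U \<in> F0" "U \<inter> I = J" using I(2) unfolding set_shatters_def by blast
      then obtain V where "V \<in> F" "U = V - {x}" unfolding F0_def by auto
      then have "V \<inter> I = J" using \<open>U \<inter> I = J\<close> I(1) insert.hyps by auto
      then show "\<exists>U\<in>F. U \<inter> I = J" using \<open>V \<in> F\<close> by blast
    qed
    moreover have "set_shatters F (insert x I)" if I: "I \<subseteq> X" "set_shatters F1 I" for I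
      unfolding set_shatters_def
    proof (intro allI impI)
      fix J assume J: "J \<subseteq> insert x I"
      then have "J - {x} \<subseteq> I" by auto
      then obtain U where U: "U \<in> F1" "U \<inter> I = J - {x}" using I(2) unfolding set_shatters_def by metis
      show "\<exists>U\<in>F. U \<inter> insert x I = J"
      proof (cases "x \<in> J")
        case True
        then have "insert x U \<inter> insert x I = J" using U(2) by blast
        moreover have "insert x U \<in> F" using U(1) by (simp add: F1_def)
        ultimately show ?thesis by (rule bexI)
      next
        case False
        moreover have "U \<in> F" "x \<notin> U" using U(1) by (simp_all add: F1_def)
        ultimately have "U \<inter> insert x I = J" using U(2) by blast
        then show ?thesis using \<open>U \<in> F\<close> by (rule bexI)
      qed
    qed
    ultimately show "?S F0 \<union> insert x ` ?S F1
        \<subseteq> {I. I \<subseteq> insert x X \<and> set_shatters F I}" by auto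
  qed
  finally show ?case .
qed

text \<open>The crude bound is enough because only its logarithm enters the rate.\<close>

lemma card_subsets_le:
  assumes "finite X"
  shows "card {I. I \<subseteq> X \<and> card I \<le> d} \<le> (card X + 1) ^ d"
proof -
  have "{I. I \<subseteq> X \<and> card I \<le> d} = (\<Union>i\<in>{..d}. {I. I \<subseteq> X \<and> card I = i})" by auto
  then have "card {I. I \<subseteq> X \<and> card I \<le> d} \<le> (\<Sum>i\<in>{..d}. card {I. I \<subseteq> X \<and> card I = i})"
    by (simp only: card_UN_le finite_atMost)
  also have "\<dots> = (\<Sum>i\<in>{..d}. card X choose i)" using assms by (simp add: n_subsets)
  \<comment> \<open>For i \<le> d the factor \<open>d choose i\<close> is at least 1; inserting it
    produces the binomial expansion of (N + 1)^d.\<close>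
  also have "\<dots> \<le> (\<Sum>i\<in>{..d}. (d choose i) * card X ^ i)"
  proof (rule sum_mono)
    fix i assume i: "i \<in> {..d}"
    have "card X choose i \<le> card X ^ i"
      by (cases "i \<le> card X") (auto simp: binomial_le_pow binomial_eq_0)
    also have "\<dots> \<le> (d choose i) * card X ^ i" using i by (simp add: Suc_leI)
    finally show "card X choose i \<le> (d choose i) * card X ^ i" .
  qed
  also have "\<dots> = (card X + 1) ^ d"
  proof -
    have "(card X + 1) ^ d = (\<Sum>i\<le>d. of_nat (d choose i) * card X ^ i * 1 ^ (d - i))" by (rule binomial)
    also have "\<dots> = (\<Sum>i\<in>{..d}. (d choose i) * card X ^ i)"
      by (intro sum.cong refl) (simp only: power_one of_nat_id mult_1_right)
    finally show ?thesis by (rule sym)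
  qed
  finally show ?thesis .
qed

lemma sauer_shelah:
  assumes "finite X" "F \<subseteq> Pow X" "\<And>I. I \<subseteq> X \<Longrightarrow> set_shatters F I \<Longrightarrow> card I \<le> d"
  shows "card F \<le> (card X + 1) ^ d"
proof -
  have "card F \<le> card {I. I \<subseteq> X \<and> set_shatters F I}" by (rule pajor) fact+
  also have "\<dots> \<le> card {I. I \<subseteq> X \<and> card I \<le> d}" using assms by (intro card_mono) auto
  also have "\<dots> \<le> (card X + 1) ^ d" by (rule card_subsets_le) fact
  finally show ?thesis .
qed

section \<open>Exponential moments of random signs and the maximal inequality\<close>

lemma exp_plus_exp_minus_le:
  fixes x :: real
  shows "exp x + exp (- x) \<le> 2 * exp (x\<^sup>2)"
proof (cases "\<bar>x\<bar> \<le> 1")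
  case True
  \<comment> \<open>Adding this bound at x and at -x cancels the linear terms. For y < 0 it follows
    after multiplication with 1 - y > 0.\<close>
  have 1: "exp y \<le> 1 + y + y\<^sup>2" if "\<bar>y\<bar> \<le> 1" for y :: real
  proof (cases "y \<ge> 0")
    case True then show ?thesis using that exp_bound[of y] by simp
  next
    case False
    have "exp y * (1 - y) \<le> exp y * exp (- y)"
      using exp_ge_add_one_self[of "- y"] by (intro mult_left_mono) auto
    also have "\<dots> = 1" by (simp add: exp_minus)
    also have "1 \<le> 1 - y ^ 3" using False by (simp add: power_le_zero_eq)
    also have "\<dots> = (1 + y + y\<^sup>2) * (1 - y)" by (simp add: power2_eq_square power3_eq_cube algebra_simps)
    finally show ?thesis by (rule mult_right_le_imp_le) (use False in simp)
  qed
  have "exp x + exp (- x) \<le> 2 * (1 + x\<^sup>2)" using 1[of x] 1[of "-x"] True by simp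
  also have "1 + x\<^sup>2 \<le> exp (x\<^sup>2)" by (rule exp_ge_add_one_self)
  finally show ?thesis by simp
next
  case False
  then have "\<bar>x\<bar> \<le> x\<^sup>2"
    using mult_right_mono[of 1 "\<bar>x\<bar>" "\<bar>x\<bar>"] by (simp add: power2_eq_square)
  then have "exp x \<le> exp (x\<^sup>2)" "exp (-x) \<le> exp (x\<^sup>2)" by auto
  then show ?thesis by linarith
qed

text \<open>A subset s encodes the sign vector that is -1 on s, so the sum over \<open>Pow\<close>
  is 2^m times a Rademacher expectation. Independence of the signs is the expansion of a product of
  two-term sums over subsets.\<close>

lemma sum_Pow_exp_signs_le:
  fixes a :: "nat \<Rightarrow> real"
  assumes "\<And>i. i < m \<Longrightarrow> \<bar>a i\<bar> \<le> 1"
  shows "(\<Sum>s\<in>Pow {..<m}. exp (l * (\<Sum>i<m. (if i \<in> s then - 1 else 1) * a i))) \<le> 2 ^ m * exp (real m * l\<^sup>2)"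
proof -
  have "(\<Sum>s\<in>Pow {..<m}. exp (l * (\<Sum>i<m. (if i \<in> s then - 1 else 1) * a i)))
      = (\<Sum>s\<in>Pow {..<m}. (\<Prod>i\<in>s. exp (- (l * a i))) * (\<Prod>i\<in>{..<m} - s. exp (l * a i)))"
  proof (rule sum.cong)
    fix s assume s: "s \<in> Pow {..<m}"
    have "exp (l * (\<Sum>i<m. (if i \<in> s then - 1 else 1) * a i))
        = (\<Prod>i<m. if i \<in> s then exp (- (l * a i)) else exp (l * a i))"
      by (auto simp: sum_distrib_left exp_sum intro!: prod.cong)
    also have "\<dots> = (\<Prod>i\<in>s. exp (- (l * a i))) * (\<Prod>i\<in>{..<m} - s. exp (l * a i))"
      using s by (simp add: prod.If_cases Int_absorb1 Diff_eq)
    finally show "exp (l * (\<Sum>i<m. (if i \<in> s then - 1 else 1) * a i)) = \<dots>" .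
  qed simp
  also have "\<dots> = (\<Prod>i<m. exp (- (l * a i)) + exp (l * a i))"
    by (subst prod_add) auto
  also have "\<dots> \<le> (\<Prod>i<m. 2 * exp (l\<^sup>2))"
  proof (rule prod_mono)
    fix i assume "i \<in> {..<m}"
    then have "(a i)\<^sup>2 \<le> 1" using assms by (simp add: abs_square_le_1)
    then have "(l * a i)\<^sup>2 \<le> l\<^sup>2" by (simp add: power_mult_distrib mult_left_le)
    then have "exp ((l * a i)\<^sup>2) \<le> exp (l\<^sup>2)" by simp
    then show "0 \<le> exp (- (l * a i)) + exp (l * a i) \<and> exp (- (l * a i)) + exp (l * a i) \<le> 2 * exp (l\<^sup>2)"
      using exp_plus_exp_minus_le[of "l * a i"] by (intro conjI add_nonneg_nonneg exp_ge_zero) linarith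
  qed
  also have "\<dots> = 2 ^ m * exp (real m * l\<^sup>2)"
    by (simp add: power_mult_distrib exp_of_nat_mult)
  finally show ?thesis .
qed

text \<open>The maximum is controlled through \<open>z \<le> ln b + exp z / b - 1\<close>, which replaces Jensen's inequality
  in the usual argument.\<close>

lemma massart:
  fixes a :: "'b \<Rightarrow> nat \<Rightarrow> real"
  assumes fin: "finite U" and "card U \<le> N" and N: "1 \<le> N" and m: "0 < m"
    and a: "\<And>u i. u \<in> U \<Longrightarrow> i < m \<Longrightarrow> \<bar>a u i\<bar> \<le> 1"
    and f: "\<And>s. s \<subseteq> {..<m} \<Longrightarrow> (\<And>b. (\<And>u. u \<in> U \<Longrightarrow> \<bar>\<Sum>i<m. (if i \<in> s then - 1 else 1) * a u i\<bar> \<le> b) \<Longrightarrow> f s \<le> b)"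
  shows "(\<Sum>s\<in>Pow {..<m}. f s) \<le> 2 ^ m * (2 * sqrt (real m * ln (2 * real N)))"
proof -
  define z where "z s u = (\<Sum>i<m. (if i \<in> s then - 1 else 1) * a u i)" for s u
  define L where "L = ln (2 * real N)"
  have L: "L > 0" unfolding L_def using N by (intro ln_gt_zero) auto
  define l where "l = sqrt (L / m)"
  have l: "l > 0" "l\<^sup>2 = L / m" using L m by (auto simp: l_def)
  \<comment> \<open>\<open>b\<close> bounds the average over s of the sum of all exponentials, so
    the quotient by \<open>b\<close> contributes at most 1 on average and cancels the -1. The choice
    of \<open>l\<close> makes real m * l^2 equal to L, hence ln b = 2 L.\<close>
  define b where "b = 2 * real N * exp (real m * l\<^sup>2)"
  have b: "b > 0" using N by (simp add: b_def)
  have lnb: "ln b = 2 * L" using N l m by (simp add: b_def ln_mult L_def)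
  have key: "l * f s \<le> ln b - 1 + (\<Sum>u\<in>U. exp (l * z s u) + exp (- l * z s u)) / b" if s: "s \<subseteq> {..<m}" for s
  proof -
    have "\<bar>z s u\<bar> \<le> (ln b - 1 + (\<Sum>u\<in>U. exp (l * z s u) + exp (- l * z s u)) / b) / l" if u: "u \<in> U" for u
    proof -
      have "ln (exp (l * \<bar>z s u\<bar>) / b) \<le> exp (l * \<bar>z s u\<bar>) / b - 1"
        using b by (intro ln_le_minus_one) simp
      then have "l * \<bar>z s u\<bar> \<le> ln b - 1 + exp (l * \<bar>z s u\<bar>) / b" using b by (simp add: ln_div)
      also have "exp (l * \<bar>z s u\<bar>) \<le> exp (l * z s u) + exp (- l * z s u)"
        by (cases "z s u \<ge> 0") (auto simp: add_increasing add_increasing2)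
      also have "\<dots> \<le> (\<Sum>u\<in>U. exp (l * z s u) + exp (- l * z s u))"
        using u fin by (intro member_le_sum) (auto simp: add_nonneg_nonneg)
      finally show ?thesis using l b by (simp add: field_simps divide_right_mono)
    qed
    then have "f s \<le> (ln b - 1 + (\<Sum>u\<in>U. exp (l * z s u) + exp (- l * z s u)) / b) / l"
      by (intro f[OF s]) (auto simp: z_def)
    then show ?thesis using l by (simp add: field_simps)
  qed
  have "l * (\<Sum>s\<in>Pow {..<m}. f s) \<le> (\<Sum>s\<in>Pow {..<m}. ln b - 1 + (\<Sum>u\<in>U. exp (l * z s u) + exp (- l * z s u)) / b)"
    unfolding sum_distrib_left by (intro sum_mono key) auto
  also have "\<dots> = 2 ^ m * (ln b - 1) + (\<Sum>s\<in>Pow {..<m}. \<Sum>u\<in>U. exp (l * z s u) + exp (- l * z s u)) / b"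
    unfolding sum.distrib[of "\<lambda>_. ln b - 1"] sum_divide_distrib[symmetric] by (simp add: card_Pow)
  also have "(\<Sum>s\<in>Pow {..<m}. \<Sum>u\<in>U. exp (l * z s u) + exp (- l * z s u))
      = (\<Sum>u\<in>U. (\<Sum>s\<in>Pow {..<m}. exp (l * z s u)) + (\<Sum>s\<in>Pow {..<m}. exp (- l * z s u)))"
    by (subst sum.swap) (simp add: sum.distrib)
  also have "\<dots> \<le> (\<Sum>u\<in>U. 2 ^ m * exp (real m * l\<^sup>2) + 2 ^ m * exp (real m * (- l)\<^sup>2))"
    unfolding z_def using a by (intro sum_mono add_mono sum_Pow_exp_signs_le) auto
  also have "\<dots> = 2 ^ m * (2 * real (card U) * exp (real m * l\<^sup>2))" by simp
  also have "\<dots> \<le> 2 ^ m * b"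
    unfolding b_def using assms(2) by (intro mult_left_mono mult_right_mono) auto
  finally have "l * (\<Sum>s\<in>Pow {..<m}. f s) \<le> 2 ^ m * (ln b - 1) + 2 ^ m * b / b"
    using b by (simp add: divide_right_mono)
  then have "l * (\<Sum>s\<in>Pow {..<m}. f s) \<le> 2 ^ m * (2 * L)" using b lnb by (simp add: algebra_simps)
  also have "L = l * sqrt (real m * L)"
    using L m by (simp add: l_def real_sqrt_mult[symmetric])
  finally have "l * (\<Sum>s\<in>Pow {..<m}. f s) \<le> l * (2 ^ m * (2 * sqrt (real m * L)))" by (simp add: mult_ac)
  then show ?thesis using l(1) unfolding L_def by simp
qed

section \<open>Finitely supported distributions\<close>

text \<open>The weights sit on indices and not on points, so the points \<open>y i\<close> may
  coincide, as they can for the empirical distribution of a sample.\<close>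

definition discrete_dist :: "'a measure \<Rightarrow> 'i set \<Rightarrow> ('i \<Rightarrow> real) \<Rightarrow> ('i \<Rightarrow> 'a) \<Rightarrow> 'a measure" where
  "discrete_dist M I w y = distr (point_measure I (\<lambda>i. ennreal (w i))) M y"

definition weights :: "'i set \<Rightarrow> ('i \<Rightarrow> real) \<Rightarrow> bool" where
  "weights I w \<longleftrightarrow> finite I \<and> (\<forall>i\<in>I. 0 \<le> w i) \<and> (\<Sum>i\<in>I. w i) = 1"

lemma sets_discrete_dist [simp]: "sets (discrete_dist M I w y) = sets M"
  and space_discrete_dist [simp]: "space (discrete_dist M I w y) = space M"
  by (simp_all add: discrete_dist_def)

lemma nn_integral_discrete_dist:
  assumes "finite I" "y \<in> I \<rightarrow> space M" "f \<in> borel_measurable M"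
  shows "(\<integral>\<^sup>+x. f x \<partial>discrete_dist M I w y) = (\<Sum>i\<in>I. ennreal (w i) * f (y i))"
  unfolding discrete_dist_def using assms
  by (subst nn_integral_distr) (auto simp: nn_integral_point_measure_finite)

lemma emeasure_discrete_dist:
  assumes "finite I" "\<And>i. i \<in> I \<Longrightarrow> 0 \<le> w i" "y \<in> I \<rightarrow> space M" "A \<in> sets M"
  shows "emeasure (discrete_dist M I w y) A = ennreal (\<Sum>i\<in>I. w i * of_bool (y i \<in> A))"
proof -
  have "emeasure (discrete_dist M I w y) A = (\<integral>\<^sup>+x. indicator A x \<partial>discrete_dist M I w y)"
    using assms by simp
  also have "\<dots> = (\<Sum>i\<in>I. ennreal (w i) * indicator A (y i))"
    using assms by (intro nn_integral_discrete_dist) auto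
  also have "\<dots> = (\<Sum>i\<in>I. ennreal (w i * of_bool (y i \<in> A)))"
    by (intro sum.cong) (auto simp: indicator_def)
  finally show ?thesis using assms by (simp add: sum_ennreal)
qed

lemma measure_discrete_dist:
  assumes "finite I" "\<And>i. i \<in> I \<Longrightarrow> 0 \<le> w i" "y \<in> I \<rightarrow> space M" "A \<in> sets M"
  shows "measure (discrete_dist M I w y) A = (\<Sum>i\<in>I. w i * of_bool (y i \<in> A))"
  using emeasure_discrete_dist[OF assms] assms(2) by (simp add: measure_def sum_nonneg)

lemma discrete_dist_in_distributions:
  assumes "weights I w" "y \<in> I \<rightarrow> space M"
  shows "discrete_dist M I w y \<in> distributions M"
proof -
  have "(\<Sum>i\<in>I. w i * of_bool (y i \<in> space M)) = (\<Sum>i\<in>I. w i)"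
    using assms by (intro sum.cong) auto
  then have "emeasure (discrete_dist M I w y) (space M) = 1"
    using assms by (subst emeasure_discrete_dist) (auto simp: weights_def)
  then show ?thesis by (auto simp: distributions_def intro!: prob_spaceI)
qed

abbreviation seqs :: "nat \<Rightarrow> 'i set \<Rightarrow> (nat \<Rightarrow> 'i) set" where
  "seqs n I \<equiv> PiE {..<n} (\<lambda>_. I)"

abbreviation prod_weight :: "nat \<Rightarrow> ('i \<Rightarrow> real) \<Rightarrow> (nat \<Rightarrow> 'i) \<Rightarrow> real" where
  "prod_weight n w s \<equiv> \<Prod>j<n. w (s j)"

abbreviation points :: "nat \<Rightarrow> ('i \<Rightarrow> 'a) \<Rightarrow> (nat \<Rightarrow> 'i) \<Rightarrow> nat \<Rightarrow> 'a" where
  "points n y s \<equiv> \<lambda>j\<in>{..<n}. y (s j)"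

lemma weights_PiE:
  assumes "weights I w" "finite J"
  shows "weights (PiE J (\<lambda>_. I)) (\<lambda>s. \<Prod>j\<in>J. w (s j))"
  unfolding weights_def
proof (intro conjI ballI)
  show "finite (PiE J (\<lambda>_. I))" using assms by (auto simp: weights_def intro: finite_PiE)
  show "0 \<le> (\<Prod>j\<in>J. w (s j))" if "s \<in> PiE J (\<lambda>_. I)" for s
    using that assms by (intro prod_nonneg) (auto simp: weights_def)
  show "(\<Sum>s\<in>PiE J (\<lambda>_. I). \<Prod>j\<in>J. w (s j)) = 1"
    using assms prod_sum_PiE[of J "\<lambda>_. I" "\<lambda>_. w"] by (simp add: weights_def)
qed

text \<open>A product measure is determined by its values on boxes; there the claim is the
  distributive law that turns a product of sums into a sum over sequences.\<close>

lemma PiM_discrete_dist: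
  assumes w: "weights I w" and y: "y \<in> I \<rightarrow> space M" and J: "finite J"
  shows "PiM J (\<lambda>_. discrete_dist M I w y)
     = discrete_dist (PiM J (\<lambda>_. M)) (PiE J (\<lambda>_. I)) (\<lambda>s. \<Prod>j\<in>J. w (s j)) (\<lambda>s. \<lambda>j\<in>J. y (s j))"
proof -
  let ?D = "discrete_dist M I w y"
  let ?E = "discrete_dist (PiM J (\<lambda>_. M)) (PiE J (\<lambda>_. I)) (\<lambda>s. \<Prod>j\<in>J. w (s j)) (\<lambda>s. \<lambda>j\<in>J. y (s j))"
  interpret P: prob_space ?D
    using discrete_dist_in_distributions[OF w y] by (simp add: distributions_def)
  interpret product_sigma_finite "\<lambda>_. ?D" by unfold_locales
  have W: "weights (PiE J (\<lambda>_. I)) (\<lambda>s. \<Prod>j\<in>J. w (s j))" by (rule weights_PiE[OF w J])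
  have Y: "(\<lambda>s. \<lambda>j\<in>J. y (s j)) \<in> PiE J (\<lambda>_. I) \<rightarrow> space (PiM J (\<lambda>_. M))"
    using y by (auto simp: space_PiM PiE_iff Pi_iff)
  show ?thesis
  proof (rule PiM_eqI[symmetric])
    show "sets ?E
        = sets (PiM J (\<lambda>_. ?D))"
      unfolding sets_discrete_dist by (intro sets_PiM_cong) auto
  next
    fix A assume A: "\<And>i. i \<in> J \<Longrightarrow> A i \<in> sets ?D"
    have "emeasure ?E (PiE J A)
        = ennreal (\<Sum>s\<in>PiE J (\<lambda>_. I). (\<Prod>j\<in>J. w (s j)) * of_bool ((\<lambda>j\<in>J. y (s j)) \<in> PiE J A))"
      using A J W Y by (intro emeasure_discrete_dist) (auto simp: weights_def intro!: sets_PiM_I_finite)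
    also have "(\<Sum>s\<in>PiE J (\<lambda>_. I). (\<Prod>j\<in>J. w (s j)) * of_bool ((\<lambda>j\<in>J. y (s j)) \<in> PiE J A))
        = (\<Sum>s\<in>PiE J (\<lambda>_. I). \<Prod>j\<in>J. w (s j) * of_bool (y (s j) \<in> A j))"
    proof (intro sum.cong refl)
      fix s
      have "of_bool ((\<lambda>j\<in>J. y (s j)) \<in> PiE J A) = (\<Prod>j\<in>J. of_bool (y (s j) \<in> A j) :: real)"
        unfolding restrict_PiE_iff using J by (induction J rule: finite_induct) auto
      then show "(\<Prod>j\<in>J. w (s j)) * of_bool ((\<lambda>j\<in>J. y (s j)) \<in> PiE J A) = (\<Prod>j\<in>J. w (s j) * of_bool (y (s j) \<in> A j))"
        by (simp add: prod.distrib)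
    qed
    also have "\<dots> = (\<Prod>j\<in>J. \<Sum>i\<in>I. w i * of_bool (y i \<in> A j))"
      using w J by (intro prod_sum_PiE[symmetric]) (auto simp: weights_def)
    also have "ennreal \<dots> = (\<Prod>j\<in>J. ennreal (\<Sum>i\<in>I. w i * of_bool (y i \<in> A j)))"
      using w by (intro prod_ennreal[symmetric] sum_nonneg) (auto simp: weights_def)
    also have "\<dots> = (\<Prod>j\<in>J. emeasure ?D (A j))"
      using w y A by (intro prod.cong refl emeasure_discrete_dist[symmetric]) (auto simp: weights_def)
    finally show "emeasure ?E (PiE J A)
        = (\<Prod>j\<in>J. emeasure ?D (A j))" .
  qed fact
qed

section \<open>Pairs of independent samples from finitely supported distributions\<close>

definition pair_index :: "nat \<Rightarrow> nat \<Rightarrow> 'i set \<Rightarrow> 'j set \<Rightarrow> ((nat \<Rightarrow> 'i) \<times> (nat \<Rightarrow> 'j)) set" where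
  "pair_index n0 n I0 I1 = seqs n0 I0 \<times> seqs n I1"

definition pair_weight :: "nat \<Rightarrow> nat \<Rightarrow> ('i \<Rightarrow> real) \<Rightarrow> ('j \<Rightarrow> real) \<Rightarrow> (nat \<Rightarrow> 'i) \<times> (nat \<Rightarrow> 'j) \<Rightarrow> real" where
  "pair_weight n0 n w0 w1 s = (\<Prod>j<n0. w0 (fst s j)) * (\<Prod>j<n. w1 (snd s j))"

definition pair_point :: "nat \<Rightarrow> nat \<Rightarrow> ('i \<Rightarrow> 'a) \<Rightarrow> ('j \<Rightarrow> 'a)
    \<Rightarrow> (nat \<Rightarrow> 'i) \<times> (nat \<Rightarrow> 'j) \<Rightarrow> (nat \<Rightarrow> 'a) \<times> (nat \<Rightarrow> 'a)" where
  "pair_point n0 n y0 y1 s = ((\<lambda>j\<in>{..<n0}. y0 (fst s j)), (\<lambda>j\<in>{..<n}. y1 (snd s j)))"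

lemma sum_pair_weight:
  assumes "finite I0" "finite I1"
  shows "(\<Sum>s\<in>pair_index n0 n I0 I1. pair_weight n0 n a b s) = (\<Sum>i\<in>I0. a i) ^ n0 * (\<Sum>i\<in>I1. b i) ^ n"
proof -
  have "(\<Sum>s\<in>seqs n0 I0. \<Prod>j<n0. a (s j)) = (\<Sum>i\<in>I0. a i) ^ n0"
    "(\<Sum>s\<in>seqs n I1. \<Prod>j<n. b (s j)) = (\<Sum>i\<in>I1. b i) ^ n"
    using assms prod_sum_PiE[of "{..<n0}" "\<lambda>_. I0" "\<lambda>_. a"] prod_sum_PiE[of "{..<n}" "\<lambda>_. I1" "\<lambda>_. b"]
    by simp_all
  then show ?thesis
    unfolding pair_index_def pair_weight_def
    by (simp add: sum.cartesian_product' sum_product[symmetric])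
qed

lemma weights_pair_index:
  assumes "weights I0 w0" "weights I1 w1"
  shows "weights (pair_index n0 n I0 I1) (pair_weight n0 n w0 w1)"
proof -
  have "finite (pair_index n0 n I0 I1)"
    using assms by (auto simp: weights_def pair_index_def intro!: finite_PiE)
  moreover have "0 \<le> pair_weight n0 n w0 w1 s" if "s \<in> pair_index n0 n I0 I1" for s
    using that assms by (auto simp: weights_def pair_index_def pair_weight_def PiE_iff intro!: mult_nonneg_nonneg prod_nonneg)
  ultimately show ?thesis using assms by (simp add: weights_def sum_pair_weight)
qed

lemma nn_integral_sample_pair_discrete:
  assumes "weights I0 w0" "y0 \<in> I0 \<rightarrow> space M" "weights I1 w1" "y1 \<in> I1 \<rightarrow> space M"
    and g: "g \<in> borel_measurable (sample_pair n0 n M M)"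
  shows "(\<integral>\<^sup>+x. g x \<partial>sample_pair n0 n (discrete_dist M I0 w0 y0) (discrete_dist M I1 w1 y1))
     = (\<Sum>s\<in>pair_index n0 n I0 I1. ennreal (pair_weight n0 n w0 w1 s) * g (pair_point n0 n y0 y1 s))"
proof -
  let ?D0 = "discrete_dist M I0 w0 y0" and ?D1 = "discrete_dist M I1 w1 y1"
  let ?X = "points n0 y0" and ?Y = "points n y1"
  have W: "weights (seqs n0 I0) (prod_weight n0 w0)"
    "weights (seqs n I1) (prod_weight n w1)"
    using assms by (auto intro: weights_PiE)
  interpret P1: prob_space ?D1
    using discrete_dist_in_distributions[OF assms(3,4)] by (simp add: distributions_def)
  interpret P0: prob_space ?D0
    using discrete_dist_in_distributions[OF assms(1,2)] by (simp add: distributions_def)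
  interpret Q1: prob_space "iid n ?D1" by (intro prob_space_PiM P1.prob_space_axioms)
  have X: "?X \<in> seqs n0 I0 \<rightarrow> space (iid n0 M)"
    "?Y \<in> seqs n I1 \<rightarrow> space (iid n M)"
    using assms by (auto simp: space_PiM PiE_iff Pi_iff)
  have s0: "sets (iid n0 ?D0) = sets (iid n0 M)" and s1: "sets (iid n ?D1) = sets (iid n M)"
    by (rule sets_PiM_cong; simp)+
  have g': "g \<in> borel_measurable (iid n0 ?D0 \<Otimes>\<^sub>M iid n ?D1)"
    using g measurable_cong_sets[OF sets_pair_measure_cong[OF s0 s1] refl] by blast
  have m: "(\<lambda>x. \<integral>\<^sup>+y. g (x, y) \<partial>iid n ?D1) \<in> borel_measurable (iid n0 ?D0)"
    using g' by (rule Q1.borel_measurable_nn_integral_fst)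
  have m': "(\<lambda>x. \<integral>\<^sup>+y. g (x, y) \<partial>iid n ?D1) \<in> borel_measurable (iid n0 M)"
    using m measurable_cong_sets[OF s0 refl] by blast
  have "(\<integral>\<^sup>+x. g x \<partial>sample_pair n0 n ?D0 ?D1) = (\<integral>\<^sup>+x. \<integral>\<^sup>+y. g (x, y) \<partial>iid n ?D1 \<partial>iid n0 ?D0)"
    using g' by (rule Q1.nn_integral_fst[symmetric])
  also have "\<dots> = (\<Sum>s\<in>seqs n0 I0. ennreal (prod_weight n0 w0 s) * (\<integral>\<^sup>+y. g (?X s, y) \<partial>iid n ?D1))"
    using W X m' assms by (subst PiM_discrete_dist) (auto simp: weights_def intro!: nn_integral_discrete_dist)
  also have "\<dots> = (\<Sum>s\<in>seqs n0 I0. ennreal (prod_weight n0 w0 s) *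
      (\<Sum>t\<in>seqs n I1. ennreal (prod_weight n w1 t) * g (?X s, ?Y t)))"
  proof (intro sum.cong refl arg_cong2[where f="(*)"])
    fix s assume "s \<in> seqs n0 I0"
    then have "?X s \<in> space (iid n0 M)" using X by auto
    then have "(\<lambda>y. g (?X s, y)) \<in> borel_measurable (iid n M)"
      using g by (rule measurable_Pair2[rotated])
    then show "(\<integral>\<^sup>+y. g (?X s, y) \<partial>iid n ?D1) = (\<Sum>t\<in>seqs n I1. ennreal (prod_weight n w1 t) * g (?X s, ?Y t))"
      using W X assms by (subst PiM_discrete_dist) (auto simp: weights_def intro!: nn_integral_discrete_dist)
  qed
  also have "\<dots> = (\<Sum>s\<in>seqs n0 I0. \<Sum>t\<in>seqs n I1.
       ennreal (pair_weight n0 n w0 w1 (s, t)) * g (pair_point n0 n y0 y1 (s, t)))"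
  proof -
    have "ennreal (pair_weight n0 n w0 w1 (s, t)) = ennreal (prod_weight n0 w0 s) * ennreal (prod_weight n w1 t)"
      if "s \<in> seqs n0 I0" "t \<in> seqs n I1" for s t
      using that W by (auto simp: pair_weight_def weights_def ennreal_mult)
    then show ?thesis
      by (auto simp: sum_distrib_left pair_point_def mult.assoc intro!: sum.cong)
  qed
  also have "\<dots> = (\<Sum>s\<in>pair_index n0 n I0 I1. ennreal (pair_weight n0 n w0 w1 s) * g (pair_point n0 n y0 y1 s))"
    unfolding pair_index_def by (simp add: sum.cartesian_product')
  finally show ?thesis .
qed

text \<open>Every measurable majorant of f lies above f at the points of the finite sum, and its own
  weighted values there are its integral. Beyond nonnegativity nothing is asked of f, so arbitrary
  learners are covered.\<close>

lemma outer_expectation_discrete_ge: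
  assumes "weights I0 w0" "y0 \<in> I0 \<rightarrow> space M" "weights I1 w1" "y1 \<in> I1 \<rightarrow> space M"
    and f: "\<And>s. 0 \<le> f s"
  shows "ennreal (\<Sum>s\<in>pair_index n0 n I0 I1. pair_weight n0 n w0 w1 s * f (pair_point n0 n y0 y1 s))
    \<le> outer_expectation (sample_pair n0 n (discrete_dist M I0 w0 y0) (discrete_dist M I1 w1 y1)) f"
  unfolding outer_expectation_def
proof (rule INF_greatest)
  let ?P = "sample_pair n0 n (discrete_dist M I0 w0 y0) (discrete_dist M I1 w1 y1)"
  let ?w = "pair_weight n0 n w0 w1"
    and ?p = "pair_point n0 n y0 y1"
    and ?I = "pair_index n0 n I0 I1"
  fix g assume "g \<in> {g \<in> borel_measurable ?P. \<forall>x\<in>space ?P. ennreal (f x) \<le> g x}"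
  then have g: "g \<in> borel_measurable ?P" "\<And>x. x \<in> space ?P \<Longrightarrow> ennreal (f x) \<le> g x" by auto
  have "sets ?P = sets (sample_pair n0 n M M)" by (intro sets_pair_measure_cong sets_PiM_cong) auto
  then have g': "g \<in> borel_measurable (sample_pair n0 n M M)"
    using g(1) measurable_cong_sets by blast
  have W: "weights (?I) (?w)"
    by (rule weights_pair_index) fact+
  have "ennreal (\<Sum>s\<in>?I. ?w s * f (?p s))
      = (\<Sum>s\<in>?I. ennreal (?w s * f (?p s)))"
    using W f by (intro sum_ennreal[symmetric]) (auto simp: weights_def)
  also have "\<dots> \<le> (\<Sum>s\<in>?I. ennreal (?w s) * g (?p s))"
  proof (rule sum_mono)
    fix s assume s: "s \<in> ?I"
    then have "?p s \<in> space ?P" using assms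
      by (auto simp: pair_index_def pair_point_def space_pair_measure space_PiM PiE_iff Pi_iff)
    then have "ennreal (f (?p s)) \<le> g (?p s)" by (rule g)
    then show "ennreal (?w s * f (?p s))
        \<le> ennreal (?w s) * g (?p s)"
      using W s f by (auto simp: weights_def ennreal_mult intro!: mult_left_mono)
  qed
  also have "\<dots> = (\<integral>\<^sup>+x. g x \<partial>?P)"
    by (rule nn_integral_sample_pair_discrete[symmetric]) fact+
  finally show "ennreal (\<Sum>s\<in>?I. ?w s * f (?p s)) \<le> (\<integral>\<^sup>+x. g x \<partial>?P)" .
qed

text \<open>The dual estimate: it converts the guarantee of a learner, an inner probability, into a
  lower bound for a finite sum.\<close>

lemma inner_prob_discrete_le:
  assumes "weights I0 w0" "y0 \<in> I0 \<rightarrow> space M" "weights I1 w1" "y1 \<in> I1 \<rightarrow> space M"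
  shows "inner_prob (sample_pair n0 n (discrete_dist M I0 w0 y0) (discrete_dist M I1 w1 y1)) Q
    \<le> ennreal (\<Sum>s\<in>pair_index n0 n I0 I1. pair_weight n0 n w0 w1 s * of_bool (Q (pair_point n0 n y0 y1 s)))"
  unfolding inner_prob_def
proof (rule SUP_least)
  let ?P = "sample_pair n0 n (discrete_dist M I0 w0 y0) (discrete_dist M I1 w1 y1)"
  let ?w = "pair_weight n0 n w0 w1"
    and ?p = "pair_point n0 n y0 y1"
    and ?I = "pair_index n0 n I0 I1"
  fix A assume "A \<in> {A \<in> sets ?P. \<forall>x\<in>A. Q x}"
  then have A: "A \<in> sets ?P" "\<And>x. x \<in> A \<Longrightarrow> Q x" by auto
  have "sets ?P = sets (sample_pair n0 n M M)" by (intro sets_pair_measure_cong sets_PiM_cong) auto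
  then have A': "indicator A \<in> borel_measurable (sample_pair n0 n M M)" using A by auto
  have W: "weights (?I) (?w)"
    by (rule weights_pair_index) fact+
  have "emeasure ?P A = (\<integral>\<^sup>+x. indicator A x \<partial>?P)" using A by simp
  also have "\<dots> = (\<Sum>s\<in>?I. ennreal (?w s) * indicator A (?p s))"
    using A' by (rule nn_integral_sample_pair_discrete[rotated 4]) fact+
  also have "\<dots> \<le> (\<Sum>s\<in>?I. ennreal (?w s * of_bool (Q (?p s))))"
    using A(2) W by (intro sum_mono) (auto simp: indicator_def weights_def)
  also have "\<dots> = ennreal (\<Sum>s\<in>?I. ?w s * of_bool (Q (?p s)))"
    using W by (intro sum_ennreal) (auto simp: weights_def)
  finally show "emeasure ?P A \<le> \<dots>" .
qed

section \<open>Symmetrization\<close>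

lemma distributionsD:
  assumes "\<mu> \<in> distributions M"
  shows "prob_space \<mu>" "sets \<mu> = sets M" "space \<mu> = space M"
  using assms sets_eq_imp_space_eq by (auto simp: distributions_def)

lemma hypothesis_measurable:
  assumes "hypothesis_class M H" "h \<in> H" "\<mu> \<in> distributions M"
  shows "h \<in> measurable \<mu> (count_space UNIV)"
  using assms distributionsD[OF assms(3)] measurable_cong_sets[of \<mu> M] by (auto simp: hypothesis_class_def)

lemma hypothesis_sets:
  assumes "hypothesis_class M H" "h \<in> H" "\<mu> \<in> distributions M"
  shows "{x \<in> space \<mu>. h x} \<in> sets \<mu>"
  using hypothesis_measurable[OF assms] by (auto simp: pred_def)

lemma emp_risk0_bounds: "0 \<le> emp_risk0 m S h" "emp_risk0 m S h \<le> 1"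
proof -
  have "(\<Sum>i<m. of_bool (h (S i)) :: real) \<le> (\<Sum>i<m. 1)" by (intro sum_mono) auto
  then show "emp_risk0 m S h \<le> 1" by (auto simp: emp_risk0_def divide_le_eq_1)
qed (auto simp: emp_risk0_def intro!: divide_nonneg_nonneg sum_nonneg)

lemma risk0_bounds:
  assumes "\<mu> \<in> distributions M" shows "0 \<le> risk0 \<mu> h" "risk0 \<mu> h \<le> 1"
proof -
  interpret prob_space \<mu> using distributionsD[OF assms] by simp
  show "0 \<le> risk0 \<mu> h" "risk0 \<mu> h \<le> 1" by (auto simp: risk0_def)
qed

lemma prob_space_iid: "\<mu> \<in> distributions M \<Longrightarrow> prob_space (iid m \<mu>)"
  by (intro prob_space_PiM) (simp add: distributions_def)

text \<open>The reindexing f lets the empirical risk read the ghost half of a double sample, at the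
  indices m + i.\<close>

lemma emp_risk0_measurable:
  assumes "hypothesis_class M H" "h \<in> H" "\<mu> \<in> distributions M" and f: "\<And>i. i < m \<Longrightarrow> f i \<in> J"
  shows "(\<lambda>S. emp_risk0 m (\<lambda>i. S (f i)) h) \<in> borel_measurable (PiM J (\<lambda>_. \<mu>))"
proof -
  note [measurable] = hypothesis_measurable[OF assms(1-3)]
  have "(\<lambda>S. of_bool (h (S (f i))) :: real) \<in> borel_measurable (PiM J (\<lambda>_. \<mu>))" if "i < m" for i
  proof -
    have [measurable]: "(\<lambda>S. S (f i)) \<in> measurable (PiM J (\<lambda>_. \<mu>)) \<mu>"
      by (rule measurable_component_singleton[OF f[OF that]])
    show ?thesis by measurable
  qed
  then show ?thesis unfolding emp_risk0_def by (intro borel_measurable_divide borel_measurable_sum) auto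
qed

lemma expectation_emp_risk0:
  assumes "hypothesis_class M H" "h \<in> H" "\<mu> \<in> distributions M" "1 \<le> m" and f: "\<And>i. i < m \<Longrightarrow> f i \<in> J"
  shows "(\<integral>S. emp_risk0 m (\<lambda>i. S (f i)) h \<partial>PiM J (\<lambda>_. \<mu>)) = risk0 \<mu> h"
proof -
  let ?P = "PiM J (\<lambda>_. \<mu>)"
  interpret prob_space \<mu> using distributionsD[OF assms(3)] by simp
  interpret P: prob_space ?P by (intro prob_space_PiM prob_space_axioms)
  note [measurable] = hypothesis_measurable[OF assms(1-3)]
  have c: "(\<lambda>S. S (f i)) \<in> measurable ?P \<mu>" if "i < m" for i
    by (rule measurable_component_singleton[OF f[OF that]])
  have *: "(\<integral>S. of_bool (h (S (f i))) \<partial>?P) = risk0 \<mu> h" if i: "i < m" for i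
  proof -
    have "(\<integral>S. of_bool (h (S (f i))) \<partial>?P) = (\<integral>x. of_bool (h x) \<partial>distr ?P \<mu> (\<lambda>S. S (f i)) :: real)"
      using c[OF i] by (subst integral_distr) auto
    also have "distr ?P \<mu> (\<lambda>S. S (f i)) = \<mu>"
      using distr_PiM_component[of J "\<lambda>_. \<mu>" "f i"] f[OF i] prob_space_axioms by simp
    also have "(\<integral>x. of_bool (h x) \<partial>\<mu>) = (\<integral>x. indicator {x\<in>space \<mu>. h x} x \<partial>\<mu> :: real)"
      by (intro Bochner_Integration.integral_cong) (auto simp: indicator_def)
    also have "\<dots> = risk0 \<mu> h" by (simp add: risk0_def)
    finally show ?thesis .
  qed
  have "integrable ?P (\<lambda>S. of_bool (h (S (f i))) :: real)" if "i < m" for i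
  proof (rule P.integrable_const_bound[of _ 1])
    note [measurable] = c[OF that]
    show "(\<lambda>S. of_bool (h (S (f i))) :: real) \<in> borel_measurable ?P" by measurable
  qed auto
  then have "(\<integral>S. emp_risk0 m (\<lambda>i. S (f i)) h \<partial>?P) = (\<Sum>i<m. \<integral>S. of_bool (h (S (f i))) \<partial>?P) / m"
    unfolding emp_risk0_def by (subst integral_divide_zero, subst Bochner_Integration.integral_sum) auto
  also have "\<dots> = risk0 \<mu> h" using assms(4) by (simp add: *)
  finally show ?thesis .
qed

lemma has_vc_dim_nonempty: "has_vc_dim M H d \<Longrightarrow> H \<noteq> {}"
  by (auto simp: has_vc_dim_def shatters_def)

text \<open>Sample points may repeat, but positions with equal points get equal labels, so positions
  shattered by the patterns carry distinct points. They yield a shattered set of points of the same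
  size, and Sauer--Shelah applies.\<close>

lemma shatters_patterns:
  assumes vc: "has_vc_dim M H d" and S: "\<And>i. i < N \<Longrightarrow> S i \<in> space M"
  shows "card ((\<lambda>h. {i\<in>{..<N}. h (S i)}) ` H) \<le> (N + 1) ^ d"
proof -
  let ?F = "(\<lambda>h. {i\<in>{..<N}. h (S i)}) ` H"
  have "card ?F \<le> (card {..<N} + 1) ^ d"
  proof (rule sauer_shelah)
    fix I assume I: "I \<subseteq> {..<N}" "set_shatters ?F I"
    have inj: "inj_on S I"
    proof (rule inj_onI, rule ccontr)
      fix i j assume ij: "i \<in> I" "j \<in> I" "S i = S j" "i \<noteq> j"
      then have "{i} \<subseteq> I" by simp
      then obtain U where "U \<in> ?F" "U \<inter> I = {i}"
        using I(2) unfolding set_shatters_def by meson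
      then obtain h where h: "{i\<in>{..<N}. h (S i)} \<inter> I = {i}" by blast
      have "i \<in> {i\<in>{..<N}. h (S i)} \<inter> I" unfolding h by simp
      moreover have "j \<notin> {i\<in>{..<N}. h (S i)} \<inter> I" unfolding h using ij by simp
      ultimately have "h (S i)" "\<not> h (S j)" using ij I(1) by auto
      then show False using ij by simp
    qed
    have "shatters H (S ` I)"
      unfolding shatters_def
    proof
      fix l :: "'a \<Rightarrow> bool"
      have "{i\<in>I. l (S i)} \<subseteq> I" by auto
      then obtain U where "U \<in> ?F" "U \<inter> I = {i\<in>I. l (S i)}"
        using I(2) unfolding set_shatters_def by meson
      then obtain h where h: "h \<in> H" "{i\<in>{..<N}. h (S i)} \<inter> I = {i\<in>I. l (S i)}" by blast
      have "h (S i) = l (S i)" if "i \<in> I" for i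
      proof -
        have "i \<in> {i\<in>{..<N}. h (S i)} \<inter> I \<longleftrightarrow> l (S i)" unfolding h(2) using that by simp
        then show ?thesis using that I(1) by auto
      qed
      then show "\<exists>h\<in>H. \<forall>x\<in>S ` I. h x = l x" using h(1) by auto
    qed
    moreover have "S ` I \<subseteq> space M" "finite (S ` I)" using I S by (auto intro: finite_subset)
    ultimately have "card (S ` I) \<le> d" using vc by (auto simp: has_vc_dim_def)
    then show "card I \<le> d" using inj by (simp add: card_image)
  qed auto
  then show ?thesis by simp
qed

text \<open>Massart's inequality for the at most (2 m + 1)^d label patterns on a double sample,
  divided by m.\<close>

abbreviation vc_rate :: "nat \<Rightarrow> nat \<Rightarrow> real" where
  "vc_rate d m \<equiv> 2 * sqrt (ln (2 * (2 * real m + 1) ^ d) / real m)"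

text \<open>Exchanging a sample point with its ghost flips the sign of one term in the difference of
  the two empirical risks; this is how random signs enter.\<close>

definition swap_index :: "nat \<Rightarrow> nat set \<Rightarrow> nat \<Rightarrow> nat" where
  "swap_index m s i = (if i < m then (if i \<in> s then m + i else i) else (if i - m \<in> s then i - m else i))"

lemma bij_swap_index:
  "bij_betw (swap_index m s) {..<2 * m} {..<2 * m}"
proof (rule bij_betw_byWitness[where f' = "swap_index m s"])
  have *: "swap_index m s (swap_index m s i) = i \<and> swap_index m s i < 2 * m" if "i < 2 * m" for i
  proof (cases "i < m")
    case True then show ?thesis by (cases "i \<in> s") (simp_all add: swap_index_def)
  next
    case False
    then have "i - m < m" "m + (i - m) = i" using that by auto
    then show ?thesis using that False by (cases "i - m \<in> s") (simp_all add: swap_index_def)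
  qed
  then show "\<forall>i\<in>{..<2 * m}. swap_index m s (swap_index m s i) = i"
    "\<forall>i\<in>{..<2 * m}. swap_index m s (swap_index m s i) = i"
    "swap_index m s ` {..<2 * m} \<subseteq> {..<2 * m}" "swap_index m s ` {..<2 * m} \<subseteq> {..<2 * m}"
    by auto
qed

abbreviation sym_deviation :: "('a \<Rightarrow> bool) set \<Rightarrow> nat \<Rightarrow> (nat \<Rightarrow> 'a) \<Rightarrow> real" where
  "sym_deviation H m S \<equiv> (SUP h\<in>H. \<bar>emp_risk0 m S h - emp_risk0 m (\<lambda>i. S (m + i)) h\<bar>)"

text \<open>With the double sample frozen, the supremum over H depends only on the finitely many
  label patterns on its points, so the maximal inequality for random signs applies.\<close>

lemma sum_sym_deviation_le:
  assumes vc: "has_vc_dim M H d" and S: "\<And>i. i < 2 * m \<Longrightarrow> S i \<in> space M" and m: "1 \<le> m"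
  shows "(\<Sum>s\<in>Pow {..<m}. sym_deviation H m (\<lambda>i\<in>{..<2 * m}. S (swap_index m s i)))
    \<le> 2 ^ m * (vc_rate d m)"
proof -
  define U where "U = (\<lambda>h. {i\<in>{..<2*m}. h (S i)}) ` H"
  define a where "a u i = (of_bool (i \<in> u) - of_bool (m + i \<in> u) :: real)" for u i
  note H = has_vc_dim_nonempty[OF vc]
  have "(\<Sum>s\<in>Pow {..<m}. real m * sym_deviation H m (\<lambda>i\<in>{..<2 * m}. S (swap_index m s i)))
    \<le> 2 ^ m * (2 * sqrt (real m * ln (2 * real ((2 * m + 1) ^ d))))"
  proof (rule massart[where U = U and a = a])
    show "finite U" by (rule finite_subset[of _ "Pow {..<2*m}"]) (auto simp: U_def)
    show "card U \<le> (2 * m + 1) ^ d" unfolding U_def using S by (intro shatters_patterns[OF vc])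
    fix s b assume s: "s \<subseteq> {..<m}"
      and b: "\<And>u. u \<in> U \<Longrightarrow> \<bar>\<Sum>i<m. (if i \<in> s then - 1 else 1) * a u i\<bar> \<le> b"
    have "sym_deviation H m (\<lambda>i\<in>{..<2 * m}. S (swap_index m s i)) \<le> b / m"
    proof (rule cSUP_least[OF H])
      fix h assume h: "h \<in> H"
      let ?T = "\<lambda>i\<in>{..<2 * m}. S (swap_index m s i)"
      let ?u = "{i\<in>{..<2*m}. h (S i)}"
      have "emp_risk0 m ?T h - emp_risk0 m (\<lambda>i. ?T (m + i)) h
          = (\<Sum>i<m. of_bool (h (?T i)) - of_bool (h (?T (m + i)))) / m"
        by (simp add: emp_risk0_def sum_subtractf diff_divide_distrib)
      also have "(\<Sum>i<m. of_bool (h (?T i)) - of_bool (h (?T (m + i))) :: real)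
          = (\<Sum>i<m. (if i \<in> s then - 1 else 1) * a ?u i)"
        by (intro sum.cong) (auto simp: a_def swap_index_def)
      finally have eq: "emp_risk0 m ?T h - emp_risk0 m (\<lambda>i. ?T (m + i)) h
          = (\<Sum>i<m. (if i \<in> s then - 1 else 1) * a ?u i) / m" .
      have "\<bar>\<Sum>i<m. (if i \<in> s then - 1 else 1) * a ?u i\<bar> \<le> b"
        using h by (intro b) (auto simp: U_def)
      then show "\<bar>emp_risk0 m ?T h - emp_risk0 m (\<lambda>i. ?T (m + i)) h\<bar> \<le> b / m"
        unfolding eq abs_divide by (simp add: divide_right_mono)
    qed
    then show "real m * sym_deviation H m (\<lambda>i\<in>{..<2 * m}. S (swap_index m s i)) \<le> b"
      using m by (simp add: field_simps)
  qed (use m in \<open>auto simp: a_def\<close>)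
  also have "2 ^ m * (2 * sqrt (real m * ln (2 * real ((2 * m + 1) ^ d))))
      = real m * (2 ^ m * (vc_rate d m))"
  proof -
    have "real m * sqrt (x / real m) = sqrt (real m * x)" for x
    proof -
      have "real m * sqrt (x / real m) = sqrt ((real m)\<^sup>2) * sqrt (x / real m)" by simp
      also have "\<dots> = sqrt ((real m)\<^sup>2 * (x / real m))" by (simp only: real_sqrt_mult)
      also have "(real m)\<^sup>2 * (x / real m) = real m * x" using m by (simp add: power2_eq_square)
      finally show ?thesis .
    qed
    from this[of "ln (2 * (2 * real m + 1) ^ d)"] show ?thesis by (simp add: add.commute)
  qed
  finally show ?thesis using m by (simp add: sum_distrib_left[symmetric])
qed

lemma sym_deviation_bounds:
  assumes "H \<noteq> {}"
  shows "0 \<le> sym_deviation H m S" "h \<in> H \<Longrightarrow> \<bar>emp_risk0 m S h - emp_risk0 m (\<lambda>i. S (m + i)) h\<bar> \<le> sym_deviation H m S"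
proof -
  have "\<bar>emp_risk0 m S h - emp_risk0 m (\<lambda>i. S (m + i)) h\<bar> \<le> 1" for h
    using emp_risk0_bounds[of m S h] emp_risk0_bounds[of m "\<lambda>i. S (m + i)" h] by linarith
  then have bdd: "bdd_above ((\<lambda>h. \<bar>emp_risk0 m S h - emp_risk0 m (\<lambda>i. S (m + i)) h\<bar>) ` H)"
    by (auto intro!: bdd_aboveI)
  then show *: "h \<in> H \<Longrightarrow> \<bar>emp_risk0 m S h - emp_risk0 m (\<lambda>i. S (m + i)) h\<bar> \<le> sym_deviation H m S" for h
    by (rule cSUP_upper[rotated])
  obtain h where "h \<in> H" using assms by auto
  from *[OF this] show "0 \<le> sym_deviation H m S" by linarith
qed

text \<open>The product measure is invariant under each of the 2^m swaps, so the expectation is an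
  average over swaps, which \<open>sum_sym_deviation_le\<close> bounds for every fixed sample. The
  supremum is measurable only up to null sets, hence a Borel majorant.\<close>

lemma expected_sym_deviation_le:
  assumes vc: "has_vc_dim M H d" and \<mu>: "\<mu> \<in> distributions M" and m: "1 \<le> m"
    and meas: "sym_deviation H m \<in> borel_measurable (completion (iid (2 * m) \<mu>))"
  obtains G where "G \<in> borel_measurable (iid (2 * m) \<mu>)"
    "\<And>S. S \<in> space (iid (2 * m) \<mu>) \<Longrightarrow> ennreal (sym_deviation H m S) \<le> G S"
    "(\<integral>\<^sup>+S. G S \<partial>iid (2 * m) \<mu>) \<le> ennreal (vc_rate d m)"
proof -
  let ?P = "iid (2 * m) \<mu>" and ?c = "vc_rate d m"
  note H = has_vc_dim_nonempty[OF vc]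
  interpret prob_space \<mu> using distributionsD[OF \<mu>] by simp
  interpret P: prob_space ?P by (intro prob_space_PiM prob_space_axioms)
  obtain g where g: "g \<in> borel_measurable ?P" "AE S in ?P. sym_deviation H m S = g S"
    using completion_ex_borel_measurable_real[OF meas] by auto
  from g(2) obtain N where N: "N \<in> null_sets ?P" "{S\<in>space ?P. sym_deviation H m S \<noteq> g S} \<subseteq> N"
    by (auto elim!: AE_E)
  \<comment> \<open>The value infinity on the null set makes G a majorant everywhere without
    changing its integral.\<close>
  define G where "G S = (if S \<in> N then \<infinity> else ennreal (g S))" for S
  have [measurable]: "N \<in> sets ?P" using N by auto
  have Gm [measurable]: "G \<in> borel_measurable ?P" unfolding G_def using g(1) by measurable
  have ge: "ennreal (sym_deviation H m S) \<le> G S" if "S \<in> space ?P" for S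
    using N(2) that by (auto simp: G_def)
  define T where "T s S = (\<lambda>i\<in>{..<2 * m}. S (swap_index m s i))" for s and S :: "nat \<Rightarrow> 'a"
  have T: "T s \<in> measurable ?P ?P" "distr ?P ?P (T s) = ?P" if s: "s \<subseteq> {..<m}" for s
  proof -
    have b: "swap_index m s i < 2 * m" if "i < 2 * m" for i
      using bij_swap_index[of m s] that by (auto simp: bij_betw_def)
    then show "T s \<in> measurable ?P ?P" unfolding T_def by (intro measurable_restrict) auto
    show "distr ?P ?P (T s) = ?P" unfolding T_def
      using distr_PiM_reindex[of "{..<2*m}" "\<lambda>_. \<mu>" "swap_index m s" "{..<2*m}"] bij_swap_index[of m s] prob_space_axioms
      by (auto simp: bij_betw_def)
  qed
  \<comment> \<open>Swaps preserve the measure, so the exceptional set stays null after each of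
    them, and there are only finitely many.\<close>
  have AE: "AE S in ?P. \<forall>s\<in>Pow {..<m}. G (T s S) = ennreal (sym_deviation H m (T s S))"
  proof (rule AE_finite_allI)
    fix s assume s: "s \<in> Pow {..<m}"
    have "AE S in ?P. G S = ennreal (sym_deviation H m S)"
      using AE_not_in[OF N(1)] by (rule AE_mp) (use N(2) in \<open>auto simp: G_def intro!: AE_I2\<close>)
    moreover have "distr ?P ?P (T s) = ?P" using T(2) s by simp
    ultimately have "AE S in distr ?P ?P (T s). G S = ennreal (sym_deviation H m S)" by (simp only:)
    then show "AE S in ?P. G (T s S) = ennreal (sym_deviation H m (T s S))"
      by (rule AE_distrD[rotated]) (use T(1) s in auto)
  qed auto
  have "ennreal (2 ^ m) * (\<integral>\<^sup>+S. G S \<partial>?P) = (\<Sum>s\<in>Pow {..<m}. \<integral>\<^sup>+S. G S \<partial>?P)"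
    by (simp add: card_Pow ennreal_power[symmetric])
  also have "\<dots> = (\<Sum>s\<in>Pow {..<m}. \<integral>\<^sup>+S. G (T s S) \<partial>?P)"
  proof (rule sum.cong)
    fix s assume s: "s \<in> Pow {..<m}"
    then have "(\<integral>\<^sup>+S. G S \<partial>?P) = (\<integral>\<^sup>+S. G S \<partial>distr ?P ?P (T s))" using T(2) by simp
    also have "\<dots> = (\<integral>\<^sup>+S. G (T s S) \<partial>?P)" using T(1) s by (intro nn_integral_distr) auto
    finally show "(\<integral>\<^sup>+S. G S \<partial>?P) = (\<integral>\<^sup>+S. G (T s S) \<partial>?P)" .
  qed simp
  also have "\<dots> = (\<integral>\<^sup>+S. (\<Sum>s\<in>Pow {..<m}. G (T s S)) \<partial>?P)"
    using T(1) by (intro nn_integral_sum[symmetric]) (auto intro: measurable_compose[OF _ Gm])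
  also have "\<dots> \<le> (\<integral>\<^sup>+S. ennreal (2 ^ m * ?c) \<partial>?P)"
  proof (rule nn_integral_mono_AE)
    show "AE S in ?P. (\<Sum>s\<in>Pow {..<m}. G (T s S)) \<le> ennreal (2 ^ m * ?c)"
      using AE
    proof (rule AE_mp, intro AE_I2 impI)
      fix S assume S: "S \<in> space ?P" "\<forall>s\<in>Pow {..<m}. G (T s S) = ennreal (sym_deviation H m (T s S))"
      then have "(\<Sum>s\<in>Pow {..<m}. G (T s S)) = (\<Sum>s\<in>Pow {..<m}. ennreal (sym_deviation H m (T s S)))"
        by (intro sum.cong) auto
      also have "\<dots> = ennreal (\<Sum>s\<in>Pow {..<m}. sym_deviation H m (T s S))"
        using sym_deviation_bounds(1)[OF H] by (intro sum_ennreal)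
      also have "\<dots> \<le> ennreal (2 ^ m * ?c)"
        unfolding T_def using S(1) distributionsD(3)[OF \<mu>] m
        by (intro ennreal_leI sum_sym_deviation_le[OF vc]) (auto simp: space_PiM PiE_iff)
      finally show "(\<Sum>s\<in>Pow {..<m}. G (T s S)) \<le> ennreal (2 ^ m * ?c)" .
    qed
  qed
  also have "\<dots> = ennreal (2 ^ m) * ennreal ?c"
  proof -
    have "1 \<le> (2 * real m + 1) ^ d" by (rule one_le_power) simp
    then have "1 \<le> 2 * (2 * real m + 1) ^ d" by linarith
    then show ?thesis by (simp add: P.emeasure_space_1 ennreal_mult)
  qed
  finally have "(\<integral>\<^sup>+S. G S \<partial>?P) \<le> ennreal ?c"
    by (subst (asm) ennreal_mult_le_mult_iff) auto
  then show ?thesis using that Gm ge by blast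
qed

abbreviation risk_deviation :: "nat \<Rightarrow> 'a measure \<Rightarrow> (nat \<Rightarrow> 'a) \<Rightarrow> ('a \<Rightarrow> bool) \<Rightarrow> real" where
  "risk_deviation m \<mu> S h \<equiv> \<bar>emp_risk0 m S h - risk0 \<mu> h\<bar>"

text \<open>The risk of h is its expected empirical risk on an independent ghost sample, so moving
  the absolute value inside the integral bounds the deviation by an expected symmetrized deviation.
  Integrating the majorant of the double sample over the ghost half gives a single G for all
  h.\<close>

lemma vc_expectation:
  assumes hc: "hypothesis_class M H" and vc: "has_vc_dim M H d" and \<mu>: "\<mu> \<in> distributions M" and m: "1 \<le> m"
    and meas: "vc_measurable M H"
  obtains G where "G \<in> borel_measurable (iid m \<mu>)"
    "\<And>S h. S \<in> space (iid m \<mu>) \<Longrightarrow> h \<in> H \<Longrightarrow> ennreal (risk_deviation m \<mu> S h) \<le> G S"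
    "(\<integral>\<^sup>+S. G S \<partial>iid m \<mu>) \<le> ennreal (vc_rate d m)"
proof -
  let ?P = "iid m \<mu>" and ?c = "vc_rate d m"
  note H = has_vc_dim_nonempty[OF vc]
  interpret prob_space \<mu> using distributionsD[OF \<mu>] by simp
  interpret P: prob_space ?P by (intro prob_space_PiM prob_space_axioms)
  have sm: "sym_deviation H m \<in> borel_measurable (completion (iid (2 * m) \<mu>))"
    using meas \<mu> by (auto simp: vc_measurable_def)
  obtain G2 where G2 [measurable]: "G2 \<in> borel_measurable (iid (2 * m) \<mu>)"
    and ge: "\<And>S. S \<in> space (iid (2 * m) \<mu>) \<Longrightarrow> ennreal (sym_deviation H m S) \<le> G2 S"
    and int: "(\<integral>\<^sup>+S. G2 S \<partial>iid (2 * m) \<mu>) \<le> ennreal ?c"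
    by (rule expected_sym_deviation_le[OF vc \<mu> m sm]) blast
  let ?J = "{m..<2 * m}"
  let ?Q = "PiM ?J (\<lambda>_. \<mu>)"
  interpret product_sigma_finite "\<lambda>_. \<mu>" by unfold_locales
  interpret Q: prob_space ?Q by (intro prob_space_PiM prob_space_axioms)
  have un: "{..<2 * m} = {..<m} \<union> ?J" by auto
  have mg: "merge {..<m} ?J \<in> measurable (?P \<Otimes>\<^sub>M ?Q) (iid (2 * m) \<mu>)"
    unfolding un by (rule measurable_merge)
  define G where "G S = (\<integral>\<^sup>+S'. G2 (merge {..<m} ?J (S, S')) \<partial>?Q)" for S
  have Gm: "G \<in> borel_measurable ?P"
    unfolding G_def using measurable_compose[OF mg G2] by (rule Q.borel_measurable_nn_integral_fst)
  have "(\<integral>\<^sup>+S. G2 S \<partial>iid (2 * m) \<mu>) = (\<integral>\<^sup>+S. G S \<partial>?P)"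
    unfolding G_def un by (rule product_nn_integral_fold) (auto simp: G2[unfolded un])
  then have int': "(\<integral>\<^sup>+S. G S \<partial>?P) \<le> ennreal ?c" using int by (simp only:)
  have J: "m + i \<in> ?J" if "i < m" for i using that by simp
  have "ennreal (risk_deviation m \<mu> S h) \<le> G S" if S: "S \<in> space ?P" and h: "h \<in> H" for S h
  proof -
    let ?e = "\<lambda>S'. emp_risk0 m (\<lambda>i. S' (m + i)) h"
    have em: "?e \<in> borel_measurable ?Q"
      by (rule emp_risk0_measurable[OF hc h \<mu> J])
    have i1: "integrable ?Q ?e"
      by (rule Q.integrable_const_bound[of _ 1]) (use em emp_risk0_bounds[of m _ h] in auto)
    have "risk_deviation m \<mu> S h = \<bar>\<integral>S'. emp_risk0 m S h - ?e S' \<partial>?Q\<bar>"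
      using i1 by (simp add: expectation_emp_risk0[OF hc h \<mu> m J] Q.prob_space)
    also have "\<dots> \<le> (\<integral>S'. \<bar>emp_risk0 m S h - ?e S'\<bar> \<partial>?Q)"
      by (rule integral_abs_bound)
    finally have "ennreal (risk_deviation m \<mu> S h) \<le> ennreal (\<integral>S'. \<bar>emp_risk0 m S h - ?e S'\<bar> \<partial>?Q)"
      by (rule ennreal_leI)
    also have "\<dots> = (\<integral>\<^sup>+S'. ennreal \<bar>emp_risk0 m S h - ?e S'\<bar> \<partial>?Q)"
      using i1 by (intro nn_integral_eq_integral[symmetric]) auto
    also have "\<dots> \<le> G S" unfolding G_def
    proof (rule nn_integral_mono)
      fix S' assume S': "S' \<in> space ?Q"
      let ?T = "merge {..<m} ?J (S, S')"
      have "emp_risk0 m ?T h = emp_risk0 m S h" "emp_risk0 m (\<lambda>i. ?T (m + i)) h = ?e S'"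
        by (auto simp: emp_risk0_def merge_def intro!: arg_cong2[where f="(/)"] sum.cong)
      then have "ennreal \<bar>emp_risk0 m S h - ?e S'\<bar> \<le> ennreal (sym_deviation H m ?T)"
        using sym_deviation_bounds(2)[OF H h, of m ?T] by (simp add: ennreal_leI)
      also have "\<dots> \<le> G2 ?T"
        using S S' by (intro ge measurable_space[OF mg]) (simp add: space_pair_measure)
      finally show "ennreal \<bar>emp_risk0 m S h - ?e S'\<bar> \<le> G2 ?T" .
    qed
    finally show ?thesis .
  qed
  then show ?thesis using that Gm int' by blast
qed

section \<open>Uniform convergence and empirical risk minimization\<close>

lemma risk1_eq:
  assumes "hypothesis_class M H" "h \<in> H" "\<mu> \<in> distributions M"
  shows "risk1 \<mu> h = 1 - risk0 \<mu> h"
proof -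
  interpret prob_space \<mu> using distributionsD[OF assms(3)] by simp
  have "{x \<in> space \<mu>. \<not> h x} = space \<mu> - {x \<in> space \<mu>. h x}" by auto
  then show ?thesis using hypothesis_sets[OF assms] by (simp add: risk1_def risk0_def prob_compl)
qed

lemma risk1_bounds:
  assumes "\<mu> \<in> distributions M" shows "0 \<le> risk1 \<mu> h" "risk1 \<mu> h \<le> 1"
proof -
  interpret prob_space \<mu> using distributionsD[OF assms] by simp
  show "0 \<le> risk1 \<mu> h" "risk1 \<mu> h \<le> 1" by (auto simp: risk1_def)
qed

lemma INF_risk1_le:
  assumes "\<mu>1 \<in> distributions M" "h \<in> K"
  shows "(INF h'\<in>K. risk1 \<mu>1 h') \<le> risk1 \<mu>1 h"
  using assms risk1_bounds(1)[OF assms(1)] by (intro cINF_lower) (auto intro!: bdd_belowI2[where m=0])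

lemma excess_risk_nonneg: "0 \<le> excess_risk H \<alpha> \<mu>0 \<mu>1 h"
  by (simp add: excess_risk_def)

lemma excess_risk_le:
  assumes "level_class H \<alpha> \<mu>0 \<noteq> {}" "0 \<le> c"
    and "\<And>h'. h' \<in> level_class H \<alpha> \<mu>0 \<Longrightarrow> risk1 \<mu>1 h \<le> risk1 \<mu>1 h' + c"
  shows "excess_risk H \<alpha> \<mu>0 \<mu>1 h \<le> c"
proof -
  have "risk1 \<mu>1 h - c \<le> (INF h'\<in>level_class H \<alpha> \<mu>0. risk1 \<mu>1 h')"
    using assms(1) by (rule cINF_greatest) (use assms(3) in force)
  then show ?thesis using assms(2) by (simp add: excess_risk_def)
qed

lemma truncated_excess_bounds:
  assumes "(\<mu>0, \<mu>1) \<in> admissible_pairs M H \<alpha>"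
  shows "0 \<le> truncated_excess H \<alpha> \<epsilon> \<mu>0 \<mu>1 h"
    "truncated_excess H \<alpha> \<epsilon> \<mu>0 \<mu>1 h \<le> excess_risk H \<alpha> \<mu>0 \<mu>1 h"
    "truncated_excess H \<alpha> \<epsilon> \<mu>0 \<mu>1 h \<le> 1"
proof -
  have \<mu>: "\<mu>1 \<in> distributions M" "level_class H \<alpha> \<mu>0 \<noteq> {}"
    using assms by (auto simp: admissible_pairs_def)
  have e: "excess_risk H \<alpha> \<mu>0 \<mu>1 h \<le> 1"
    using \<mu>(2) by (rule excess_risk_le) (use risk1_bounds[OF \<mu>(1)] in \<open>auto intro: add_increasing\<close>)
  show "0 \<le> truncated_excess H \<alpha> \<epsilon> \<mu>0 \<mu>1 h"
    "truncated_excess H \<alpha> \<epsilon> \<mu>0 \<mu>1 h \<le> excess_risk H \<alpha> \<mu>0 \<mu>1 h"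
    "truncated_excess H \<alpha> \<epsilon> \<mu>0 \<mu>1 h \<le> 1"
    using e excess_risk_nonneg[of H \<alpha> \<mu>0 \<mu>1 h] by (auto simp: truncated_excess_def)
qed

lemma admissible_pairsD:
  assumes "(\<mu>0, \<mu>1) \<in> admissible_pairs M H \<alpha>"
  shows "\<mu>0 \<in> distributions M" "\<mu>1 \<in> distributions M" "level_class H \<alpha> \<mu>0 \<noteq> {}"
  using assms by (auto simp: admissible_pairs_def)

lemma vc_rate_tendsto_0: "(\<lambda>m. vc_rate d m) \<longlonglongrightarrow> 0"
proof -
  have "(\<lambda>m. (ln 2 + real d * ln 3) / real m + real d * (ln (real m) / real m)) \<longlonglongrightarrow> 0 + real d * 0"
    by (intro tendsto_intros lim_const_over_n lim_ln_over_n)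
  then have "(\<lambda>m. (ln 2 + real d * ln 3) / real m + real d * (ln (real m) / real m)) \<longlonglongrightarrow> 0" by simp
  note t = this
  have e1: "\<forall>\<^sub>F m in sequentially. 0 \<le> ln (2 * (2 * real m + 1) ^ d) / real m"
  proof (rule always_eventually, rule allI)
    fix m
    have "1 \<le> (2 * real m + 1) ^ d" by (rule one_le_power) simp
    then show "0 \<le> ln (2 * (2 * real m + 1) ^ d) / real m" by (intro divide_nonneg_nonneg ln_ge_zero) linarith+
  qed
  have e2: "\<forall>\<^sub>F m in sequentially. ln (2 * (2 * real m + 1) ^ d) / real m
      \<le> (ln 2 + real d * ln 3) / real m + real d * (ln (real m) / real m)"
    using eventually_gt_at_top[of 0]
  proof eventually_elim
    case (elim m)
    have "ln (2 * (2 * real m + 1) ^ d) = ln 2 + real d * ln (2 * real m + 1)"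
      by (simp add: ln_mult ln_realpow)
    also have "\<dots> \<le> ln 2 + real d * ln (3 * real m)"
      using elim by (intro add_left_mono mult_left_mono) auto
    also have "\<dots> = (ln 2 + real d * ln 3) + real d * ln (real m)"
      using elim by (simp add: ln_mult algebra_simps)
    finally show ?case using elim by (simp add: field_simps)
  qed
  have "(\<lambda>m. ln (2 * (2 * real m + 1) ^ d) / real m) \<longlonglongrightarrow> 0"
    by (rule tendsto_sandwich[OF e1 e2 tendsto_const t])
  then have "(\<lambda>m. vc_rate d m) \<longlonglongrightarrow> 2 * sqrt 0"
    by (intro tendsto_intros)
  then show ?thesis by simp
qed

lemma abs_deviation_le_1:
  assumes "\<mu> \<in> distributions M" shows "risk_deviation m \<mu> S h \<le> 1"
  using emp_risk0_bounds[of m S h] risk0_bounds[OF assms, of h] by linarith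

lemma uniform_deviation_gt_iff:
  assumes "\<mu> \<in> distributions M" "H \<noteq> {}"
  shows "uniform_deviation H \<mu> m S > \<epsilon> \<longleftrightarrow> (\<exists>h\<in>H. risk_deviation m \<mu> S h > \<epsilon>)"
  unfolding uniform_deviation_def
  using assms(2) by (intro less_cSUP_iff bdd_aboveI2[where M=1] abs_deviation_le_1[OF assms(1)])

text \<open>The form in which \<open>sample_size\<close> is used: an outer probability is attained
  by a measurable cover, and off this cover all hypotheses are close at once.\<close>

definition uniformly_close where
  "uniformly_close M H \<epsilon> \<delta> m \<longleftrightarrow> 1 \<le> m \<and> (\<forall>\<mu>\<in>distributions M. \<exists>A\<in>sets (iid m \<mu>).
     emeasure (iid m \<mu>) A \<le> ennreal \<delta> \<and> (\<forall>S\<in>space (iid m \<mu>) - A. \<forall>h\<in>H. risk_deviation m \<mu> S h \<le> \<epsilon>))"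

text \<open>\<open>sample_size\<close> is a \<open>LEAST\<close>, so it has its defining property as
  soon as some m does. Markov's inequality for the majorant of \<open>vc_expectation\<close>
  provides one, since \<open>vc_rate\<close> tends to 0.\<close>

lemma uniformly_close_sample_size:
  assumes hc: "hypothesis_class M H" and vc: "has_vc_dim M H d" and meas: "vc_measurable M H"
    and \<epsilon>: "0 < \<epsilon>" and \<delta>: "0 < \<delta>"
  shows "uniformly_close M H \<epsilon> \<delta> (sample_size M H \<epsilon> \<delta>)"
proof -
  note H = has_vc_dim_nonempty[OF vc]
  let ?B = "\<lambda>m \<mu>. {S \<in> space (iid m \<mu>). uniform_deviation H \<mu> m S > \<epsilon>}"
  let ?Q = "\<lambda>m. 1 \<le> m \<and> (SUP \<mu>\<in>distributions M. outer_measure_of (iid m \<mu>) (?B m \<mu>)) \<le> ennreal \<delta>"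
  have "\<forall>\<^sub>F m in sequentially. vc_rate d m < \<epsilon> * \<delta>"
    using order_tendstoD(2)[OF vc_rate_tendsto_0[of d], of "\<epsilon> * \<delta>"] \<epsilon> \<delta> by simp
  then have "\<forall>\<^sub>F m in sequentially. 1 \<le> m \<and> vc_rate d m < \<epsilon> * \<delta>"
    using eventually_ge_at_top[of 1] by eventually_elim auto
  then obtain m where m: "1 \<le> m" "vc_rate d m < \<epsilon> * \<delta>"
    by (auto simp: eventually_sequentially)
  have "outer_measure_of (iid m \<mu>) (?B m \<mu>) \<le> ennreal \<delta>" if \<mu>: "\<mu> \<in> distributions M" for \<mu>
  proof -
    let ?P = "iid m \<mu>"
    obtain G where G [measurable]: "G \<in> borel_measurable ?P"
      and ge: "\<And>S h. S \<in> space ?P \<Longrightarrow> h \<in> H \<Longrightarrow> ennreal (risk_deviation m \<mu> S h) \<le> G S"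
      and int: "(\<integral>\<^sup>+S. G S \<partial>?P) \<le> ennreal (vc_rate d m)"
      by (rule vc_expectation[OF hc vc \<mu> m(1) meas]) blast
    let ?A = "{S\<in>space ?P. 1 \<le> ennreal (1 / \<epsilon>) * G S}"
    have "?B m \<mu> \<subseteq> ?A"
    proof safe
      fix S assume S: "S \<in> space ?P" "uniform_deviation H \<mu> m S > \<epsilon>"
      then obtain h where h: "h \<in> H" "risk_deviation m \<mu> S h > \<epsilon>"
        using uniform_deviation_gt_iff[OF \<mu> H] by blast
      have "1 = ennreal (1 / \<epsilon>) * ennreal \<epsilon>" using \<epsilon> by (simp add: ennreal_mult[symmetric])
      also have "ennreal \<epsilon> \<le> ennreal (risk_deviation m \<mu> S h)" using h(2) by (intro ennreal_leI) simp
      also have "\<dots> \<le> G S" by (rule ge[OF S(1) h(1)])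
      finally show "1 \<le> ennreal (1 / \<epsilon>) * G S" by (simp add: mult_left_mono)
    qed
    then have "outer_measure_of ?P (?B m \<mu>) \<le> outer_measure_of ?P ?A" by (rule outer_measure_of_mono)
    also have "\<dots> = emeasure ?P ?A" by (rule outer_measure_of_eq) measurable
    also have "\<dots> \<le> ennreal (1 / \<epsilon>) * (\<integral>\<^sup>+S. G S \<partial>?P)"
    proof -
      have "emeasure ?P ?A \<le> ennreal (1 / \<epsilon>) * (\<integral>\<^sup>+S. G S * indicator (space ?P) S \<partial>?P)"
        by (rule nn_integral_Markov_inequality) auto
      also have "(\<integral>\<^sup>+S. G S * indicator (space ?P) S \<partial>?P) = (\<integral>\<^sup>+S. G S \<partial>?P)"
        by (rule nn_integral_cong) simp
      finally show ?thesis .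
    qed
    also have "\<dots> \<le> ennreal (1 / \<epsilon>) * ennreal (\<epsilon> * \<delta>)"
      by (intro mult_left_mono order_trans[OF int] ennreal_leI) (use m in auto)
    also have "\<dots> = ennreal \<delta>" using \<epsilon> \<delta> by (simp add: ennreal_mult[symmetric])
    finally show ?thesis .
  qed
  then have "?Q m" using m(1) by (auto intro: SUP_least)
  then have Q: "?Q (sample_size M H \<epsilon> \<delta>)" unfolding sample_size_def by (rule LeastI)
  show ?thesis unfolding uniformly_close_def
  proof (intro conjI ballI)
    show "1 \<le> sample_size M H \<epsilon> \<delta>" using Q by simp
    fix \<mu> assume \<mu>: "\<mu> \<in> distributions M"
    let ?m = "sample_size M H \<epsilon> \<delta>"
    obtain A where A: "A \<in> sets (iid ?m \<mu>)" "?B ?m \<mu> \<subseteq> A" "outer_measure_of (iid ?m \<mu>) (?B ?m \<mu>) = emeasure (iid ?m \<mu>) A"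
      using outer_measure_of_attain[of "?B ?m \<mu>" "iid ?m \<mu>"] by auto
    have "emeasure (iid ?m \<mu>) A \<le> ennreal \<delta>"
      unfolding A(3)[symmetric] by (rule order_trans[OF SUP_upper[OF \<mu>] conjunct2[OF Q]])
    moreover have "\<forall>S\<in>space (iid ?m \<mu>) - A. \<forall>h\<in>H. risk_deviation ?m \<mu> S h \<le> \<epsilon>"
    proof (intro ballI)
      fix S h assume "S \<in> space (iid ?m \<mu>) - A" "h \<in> H"
      then have "\<not> uniform_deviation H \<mu> ?m S > \<epsilon>" using A(2) by blast
      then show "risk_deviation ?m \<mu> S h \<le> \<epsilon>"
        using \<open>h \<in> H\<close> unfolding uniform_deviation_gt_iff[OF \<mu> H] not_less[symmetric] by blast
    qed
    ultimately show "\<exists>A\<in>sets (iid ?m \<mu>). emeasure (iid ?m \<mu>) A \<le> ennreal \<delta>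
        \<and> (\<forall>S\<in>space (iid ?m \<mu>) - A. \<forall>h\<in>H. risk_deviation ?m \<mu> S h \<le> \<epsilon>)" using A(1) by blast
  qed
qed

section \<open>Learners that select from the empirical level class\<close>

definition emp_class :: "('a \<Rightarrow> bool) set \<Rightarrow> real \<Rightarrow> nat \<Rightarrow> (nat \<Rightarrow> 'a) \<Rightarrow> ('a \<Rightarrow> bool) set" where
  "emp_class H a m S = {h \<in> H. emp_risk0 m S h \<le> a}"

text \<open>The accuracy \<epsilon> / 2 is spent once from the true level to the empirical one and
  once on the way back. The first inclusion keeps every competitor available to the learner, the
  second makes its choice admissible.\<close>

lemma emp_class_sandwich:
  assumes "\<forall>h\<in>H. risk_deviation m \<mu> S h \<le> \<epsilon> / 2"
  shows "level_class H \<alpha> \<mu> \<subseteq> emp_class H (\<alpha> + \<epsilon> / 2) m S"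
    "emp_class H (\<alpha> + \<epsilon> / 2) m S \<subseteq> level_class H (\<alpha> + \<epsilon>) \<mu>"
proof -
  show "level_class H \<alpha> \<mu> \<subseteq> emp_class H (\<alpha> + \<epsilon> / 2) m S"
  proof
    fix h assume "h \<in> level_class H \<alpha> \<mu>"
    then have "h \<in> H" "risk0 \<mu> h \<le> \<alpha>" by (auto simp: level_class_def)
    moreover from this have "risk_deviation m \<mu> S h \<le> \<epsilon> / 2" using assms by simp
    ultimately have "emp_risk0 m S h \<le> \<alpha> + \<epsilon> / 2" by linarith
    then show "h \<in> emp_class H (\<alpha> + \<epsilon> / 2) m S" using \<open>h \<in> H\<close> by (simp add: emp_class_def)
  qed
  show "emp_class H (\<alpha> + \<epsilon> / 2) m S \<subseteq> level_class H (\<alpha> + \<epsilon>) \<mu>"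
  proof
    fix h assume "h \<in> emp_class H (\<alpha> + \<epsilon> / 2) m S"
    then have "h \<in> H" "emp_risk0 m S h \<le> \<alpha> + \<epsilon> / 2" by (auto simp: emp_class_def)
    moreover from this have "risk_deviation m \<mu> S h \<le> \<epsilon> / 2" using assms by simp
    ultimately have "risk0 \<mu> h \<le> \<alpha> + \<epsilon>" by linarith
    then show "h \<in> level_class H (\<alpha> + \<epsilon>) \<mu>" using \<open>h \<in> H\<close> by (simp add: level_class_def)
  qed
qed

text \<open>The samples range over the product spaces of \<open>M\<close>, so a selector is fixed
  before any distribution. For admissible pairs the empirical class is empty only on the exceptional
  event of the first sample, where any member of H will do.\<close>

definition emp_selector where
  "emp_selector M H a n0 n L \<longleftrightarrow> (\<forall>S0\<in>space (iid n0 M). \<forall>S1\<in>space (iid n M). L (S0, S1) \<in> H \<and>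
     (emp_class H a n0 S0 \<noteq> {} \<longrightarrow> L (S0, S1) \<in> emp_class H a n0 S0))"

text \<open>The rectangle formed by the complement of A and the whole second sample space is
  measurable, whatever Q is.\<close>

lemma inner_prob_fst_ge:
  assumes \<mu>: "\<mu>0 \<in> distributions M" "\<mu>1 \<in> distributions M" and \<delta>: "0 \<le> \<delta>"
    and A: "A \<in> sets (iid n0 \<mu>0)" "emeasure (iid n0 \<mu>0) A \<le> ennreal \<delta>"
    and Q: "\<And>S0 S1. S0 \<in> space (iid n0 \<mu>0) - A \<Longrightarrow> S1 \<in> space (iid n \<mu>1) \<Longrightarrow> Q (S0, S1)"
  shows "inner_prob (sample_pair n0 n \<mu>0 \<mu>1) Q \<ge> ennreal (1 - \<delta>)"
proof -
  interpret P0: prob_space "iid n0 \<mu>0" by (rule prob_space_iid[OF \<mu>(1)])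
  interpret P1: prob_space "iid n \<mu>1" by (rule prob_space_iid[OF \<mu>(2)])
  let ?E = "(space (iid n0 \<mu>0) - A) \<times> space (iid n \<mu>1)"
  have "P0.prob A \<le> \<delta>" using A(2) \<delta> by (simp add: P0.emeasure_eq_measure)
  then have "ennreal (1 - \<delta>) \<le> emeasure (iid n0 \<mu>0) (space (iid n0 \<mu>0) - A)"
    using A(1) by (simp add: P0.emeasure_eq_measure P0.prob_compl ennreal_leI)
  also have "\<dots> = emeasure (sample_pair n0 n \<mu>0 \<mu>1) ?E"
    using A(1) by (subst P1.emeasure_pair_measure_Times) (auto simp: P1.emeasure_space_1)
  also have "\<dots> \<le> inner_prob (sample_pair n0 n \<mu>0 \<mu>1) Q"
    unfolding inner_prob_def using A(1) Q by (intro SUP_upper) auto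
  finally show ?thesis .
qed

lemma space_iid_distributions:
  assumes "\<mu> \<in> distributions M" shows "space (iid n \<mu>) = space (iid n M)"
  using distributionsD(3)[OF assms] by (simp add: space_PiM)

lemma emp_selector_approx_learner:
  assumes uc: "uniformly_close M H (\<epsilon> / 2) \<delta> n0" and \<delta>: "0 \<le> \<delta>"
    and L: "emp_selector M H (\<alpha> + \<epsilon> / 2) n0 n L"
  shows "L \<in> approx_learners M H \<alpha> \<epsilon> \<delta> n0 n"
  unfolding approx_learners_def mem_Collect_eq
proof (intro conjI ballI)
  fix S assume "S \<in> space (sample_pair n0 n M M)"
  then show "L S \<in> H" using L by (auto simp: emp_selector_def space_pair_measure)
next
  fix p assume p: "p \<in> admissible_pairs M H \<alpha>"
  obtain \<mu>0 \<mu>1 where p': "p = (\<mu>0, \<mu>1)" by (cases p)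
  have \<mu>: "\<mu>0 \<in> distributions M" "\<mu>1 \<in> distributions M" "level_class H \<alpha> \<mu>0 \<noteq> {}"
    using p p' by (auto simp: admissible_pairs_def)
  obtain A where A: "A\<in>sets (iid n0 \<mu>0)" "emeasure (iid n0 \<mu>0) A \<le> ennreal \<delta>"
    "\<And>S. S\<in>space (iid n0 \<mu>0) - A \<Longrightarrow> \<forall>h\<in>H. risk_deviation n0 \<mu>0 S h \<le> \<epsilon> / 2"
    using uc \<mu>(1) unfolding uniformly_close_def by blast
  have "ennreal (1 - \<delta>) \<le> inner_prob (sample_pair n0 n \<mu>0 \<mu>1) (\<lambda>S. L S \<in> level_class H (\<alpha> + \<epsilon>) \<mu>0)"
  proof (rule inner_prob_fst_ge[OF \<mu>(1,2) \<delta> A(1,2)])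
    fix S0 S1 assume S: "S0 \<in> space (iid n0 \<mu>0) - A" "S1 \<in> space (iid n \<mu>1)"
    note s = emp_class_sandwich[OF A(3)[OF S(1)], of \<alpha>]
    have "emp_class H (\<alpha> + \<epsilon> / 2) n0 S0 \<noteq> {}" using s(1) \<mu>(3) by blast
    then have "L (S0, S1) \<in> emp_class H (\<alpha> + \<epsilon> / 2) n0 S0"
      using L S space_iid_distributions[OF \<mu>(1)] space_iid_distributions[OF \<mu>(2)]
      by (auto simp: emp_selector_def)
    then show "L (S0, S1) \<in> level_class H (\<alpha> + \<epsilon>) \<mu>0" using s(2) by blast
  qed
  then show "case p of (\<mu>0, \<mu>1) \<Rightarrow> ennreal (1 - \<delta>) \<le> inner_prob (sample_pair n0 n \<mu>0 \<mu>1) (\<lambda>S. L S \<in> level_class H (\<alpha> + \<epsilon>) \<mu>0)"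
    by (simp add: p')
qed

text \<open>The excess never exceeds 1, so \<open>indicator A\<close> of the first sample dominates
  it on the bad event while G of the second one does so elsewhere. The sum is a measurable majorant
  and integrates to at most B + \<delta>.\<close>

lemma outer_expectation_truncated_le:
  assumes adm: "(\<mu>0, \<mu>1) \<in> admissible_pairs M H \<alpha>"
    and A: "A \<in> sets (iid n0 \<mu>0)" "emeasure (iid n0 \<mu>0) A \<le> ennreal \<delta>" and \<delta>: "0 \<le> \<delta>"
    and G [measurable]: "G \<in> borel_measurable (iid n \<mu>1)"
    and int: "(\<integral>\<^sup>+S. G S \<partial>iid n \<mu>1) \<le> ennreal B" and B: "0 \<le> B"
    and le: "\<And>S0 S1. S0 \<in> space (iid n0 \<mu>0) - A \<Longrightarrow> S1 \<in> space (iid n \<mu>1) \<Longrightarrow>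
       ennreal (truncated_excess H \<alpha> \<epsilon> \<mu>0 \<mu>1 (L (S0, S1))) \<le> G S1"
  shows "outer_expectation (sample_pair n0 n \<mu>0 \<mu>1) (\<lambda>S. truncated_excess H \<alpha> \<epsilon> \<mu>0 \<mu>1 (L S)) \<le> ennreal (B + \<delta>)"
proof -
  note \<mu> = admissible_pairsD[OF adm]
  let ?t = "truncated_excess H \<alpha> \<epsilon> \<mu>0 \<mu>1"
  interpret P0: prob_space "iid n0 \<mu>0" by (rule prob_space_iid[OF \<mu>(1)])
  interpret P1: prob_space "iid n \<mu>1" by (rule prob_space_iid[OF \<mu>(2)])
  have [measurable]: "A \<in> sets (iid n0 \<mu>0)" by fact
  let ?g = "\<lambda>S. G (snd S) + indicator A (fst S)"
  have "outer_expectation (sample_pair n0 n \<mu>0 \<mu>1) (\<lambda>S. ?t (L S))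
      \<le> (\<integral>\<^sup>+S. ?g S \<partial>sample_pair n0 n \<mu>0 \<mu>1)"
    unfolding outer_expectation_def
  proof (rule INF_lower, intro CollectI conjI ballI)
    show "?g \<in> borel_measurable (sample_pair n0 n \<mu>0 \<mu>1)" by measurable
    fix S assume "S \<in> space (sample_pair n0 n \<mu>0 \<mu>1)"
    then obtain S0 S1 where S: "S = (S0, S1)" "S0 \<in> space (iid n0 \<mu>0)" "S1 \<in> space (iid n \<mu>1)"
      by (auto simp: space_pair_measure)
    show "ennreal (?t (L S)) \<le> ?g S"
    proof (cases "S0 \<in> A")
      case True
      have "ennreal (?t (L S)) \<le> 1"
        using truncated_excess_bounds(3)[OF adm] by (simp add: ennreal_le_1)
      then show ?thesis using True S(1) by (simp add: add_increasing)
    next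
      case False
      then show ?thesis using le[of S0 S1] S by simp
    qed
  qed
  also have "\<dots> = (\<integral>\<^sup>+S0. (\<integral>\<^sup>+S1. G S1 + indicator A S0 \<partial>iid n \<mu>1) \<partial>iid n0 \<mu>0)"
    by (subst P1.nn_integral_fst[symmetric]) auto
  also have "\<dots> = (\<integral>\<^sup>+S0. (\<integral>\<^sup>+S1. G S1 \<partial>iid n \<mu>1) + indicator A S0 \<partial>iid n0 \<mu>0)"
    by (subst nn_integral_add) (auto simp: P1.emeasure_space_1)
  also have "\<dots> = (\<integral>\<^sup>+S1. G S1 \<partial>iid n \<mu>1) + emeasure (iid n0 \<mu>0) A"
    by (subst nn_integral_add) (auto simp: P0.emeasure_space_1)
  also have "\<dots> \<le> ennreal B + ennreal \<delta>" using int A(2) by (rule add_mono)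
  finally show ?thesis using B \<delta> by simp
qed

lemma minimax_risk_le:
  assumes "L \<in> approx_learners M H \<alpha> \<epsilon> \<delta> n0 n"
    and "\<And>\<mu>0 \<mu>1. (\<mu>0, \<mu>1) \<in> admissible_pairs M H \<alpha> \<Longrightarrow>
      outer_expectation (sample_pair n0 n \<mu>0 \<mu>1) (\<lambda>S. truncated_excess H \<alpha> \<epsilon> \<mu>0 \<mu>1 (L S)) \<le> B"
  shows "minimax_risk M H \<alpha> \<epsilon> \<delta> n0 n \<le> B"
  unfolding minimax_risk_def using assms(2) by (intro INF_lower2[OF assms(1)] SUP_least) auto

text \<open>The second sample should be labelled 1, so maximizing \<open>emp_risk0\<close> on it,
  the fraction of ones, is minimizing the empirical \<mu>1-risk.\<close>

definition erm :: "('a \<Rightarrow> bool) set \<Rightarrow> real \<Rightarrow> nat \<Rightarrow> nat \<Rightarrow> 'a learner" where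
  "erm H a n0 n = (\<lambda>(S0, S1). let K = (if emp_class H a n0 S0 = {} then H else emp_class H a n0 S0)
     in SOME h. h \<in> K \<and> (\<forall>h'\<in>K. emp_risk0 n S1 h' \<le> emp_risk0 n S1 h))"

text \<open>Empirical risks take finitely many values, so the maximum is attained even over an
  infinite class.\<close>

lemma ex_max_emp_risk0:
  assumes "K \<noteq> {}" shows "\<exists>h. h \<in> K \<and> (\<forall>h'\<in>K. emp_risk0 n S h' \<le> emp_risk0 n S h)"
proof -
  define f where "f h = (\<Sum>i<n. of_bool (h (S i)) :: nat)" for h :: "'a \<Rightarrow> bool"
  have eq: "emp_risk0 n S h = real (f h) / real n" for h
    by (simp add: emp_risk0_def f_def)
  obtain h0 where h0: "h0 \<in> K" using assms by auto
  have fn: "f h \<le> n" for h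
  proof -
    have "f h \<le> (\<Sum>i<n. 1)" unfolding f_def by (intro sum_mono) auto
    then show ?thesis by simp
  qed
  have "\<exists>h. h \<in> K \<and> (\<forall>h'. h' \<in> K \<longrightarrow> f h' \<le> f h)"
  proof (rule ex_has_greatest_nat)
    show "\<forall>h. h \<in> K \<longrightarrow> f h < Suc n" using fn by (simp add: less_Suc_eq_le)
  qed (rule h0)
  then obtain h where h: "h \<in> K" "\<forall>h'. h' \<in> K \<longrightarrow> f h' \<le> f h" by (elim exE conjE)
  then have "\<forall>h'\<in>K. real (f h') / real n \<le> real (f h) / real n"
    by (simp add: divide_right_mono)
  then show ?thesis unfolding eq using h(1) by blast
qed

lemma erm_props:
  assumes "H \<noteq> {}"
  shows "emp_selector M H a n0 n (erm H a n0 n)"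
    and "h' \<in> emp_class H a n0 S0 \<Longrightarrow> emp_risk0 n S1 h' \<le> emp_risk0 n S1 (erm H a n0 n (S0, S1))"
proof -
  define K where "K S0 = (if emp_class H a n0 S0 = {} then H else emp_class H a n0 S0)" for S0 :: "nat \<Rightarrow> 'a"
  have K: "K S0 \<noteq> {}" for S0 using assms by (simp add: K_def)
  have *: "erm H a n0 n (S0, S1) \<in> K S0 \<and> (\<forall>h'\<in>K S0. emp_risk0 n S1 h' \<le> emp_risk0 n S1 (erm H a n0 n (S0, S1)))" for S0 S1
    unfolding erm_def prod.case Let_def K_def[symmetric] by (rule someI_ex[OF ex_max_emp_risk0[OF K]])
  have "K S0 \<subseteq> H" for S0 by (auto simp: K_def emp_class_def)
  then have "erm H a n0 n (S0, S1) \<in> H" for S0 S1 using * by blast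
  moreover have "emp_class H a n0 S0 \<noteq> {} \<Longrightarrow> erm H a n0 n (S0, S1) \<in> emp_class H a n0 S0" for S0 S1
    using *[of S0 S1] by (simp add: K_def)
  ultimately show "emp_selector M H a n0 n (erm H a n0 n)" unfolding emp_selector_def by blast
  show "h' \<in> emp_class H a n0 S0 \<Longrightarrow> emp_risk0 n S1 h' \<le> emp_risk0 n S1 (erm H a n0 n (S0, S1))"
    using *[of S0 S1] by (auto simp: K_def split: if_splits)
qed

lemma ln_nat_ge_half:
  assumes "2 \<le> n" shows "1/2 \<le> ln (real n)"
proof -
  have "ln (1/2) \<le> 1/2 - (1::real)" by (rule ln_le_minus_one) simp
  then have "1/2 \<le> ln (2::real)" by (simp add: ln_div)
  also have "\<dots> \<le> ln (real n)" using assms by simp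
  finally show ?thesis .
qed

lemma sqrt_rate_le:
  assumes "1 \<le> d" "2 \<le> n"
  shows "vc_rate d n \<le> 8 * ln (real n) * sqrt (real d / real n)"
proof -
  have l2: "ln 2 \<le> ln (real n)" using assms by simp
  have l: "ln (real n) \<ge> 1/2" by (rule ln_nat_ge_half[OF assms(2)])
  have "2 * real n + 1 \<le> real n ^ 3"
  proof -
    have "4 * real n \<le> real n ^ 3"
      using assms mult_mono[of 2 "real n" 2 "real n"] by (simp add: power3_eq_cube mult_right_mono)
    then show ?thesis using assms by linarith
  qed
  then have "ln (2 * real n + 1) \<le> ln (real n ^ 3)" by (subst ln_le_cancel_iff) (use assms in auto)
  then have 3: "ln (2 * real n + 1) \<le> 3 * ln (real n)" using assms by (simp add: ln_realpow)
  have "ln (2 * (2 * real n + 1) ^ d) = ln 2 + real d * ln (2 * real n + 1)"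
    by (simp add: ln_mult ln_realpow)
  also have "\<dots> \<le> real d * ln (real n) + real d * (3 * ln (real n))"
  proof (intro add_mono mult_left_mono 3)
    show "ln 2 \<le> real d * ln (real n)"
    proof (rule order_trans[OF l2])
      show "ln (real n) \<le> real d * ln (real n)"
        using l assms mult_right_mono[of 1 "real d" "ln (real n)"] by simp
    qed
  qed auto
  also have "\<dots> = 4 * ln (real n) * real d" by simp
  \<comment> \<open>As ln n \<ge> 1/2, a factor ln n may be enlarged to 2 (ln n)^2; after the square
    root this leaves a full power of ln n.\<close>
  also have "\<dots> \<le> 4 * (2 * (ln (real n))\<^sup>2) * real d"
  proof (intro mult_right_mono mult_left_mono)
    show "ln (real n) \<le> 2 * (ln (real n))\<^sup>2"
      using l mult_right_mono[of "1/2" "ln (real n)" "ln (real n)"] by (simp add: power2_eq_square)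
  qed auto
  also have "\<dots> \<le> 16 * (ln (real n))\<^sup>2 * real d" by (simp add: mult_right_mono)
  finally have "sqrt (ln (2 * (2 * real n + 1) ^ d) / real n) \<le> sqrt ((4 * ln (real n))\<^sup>2 * (real d / real n))"
    using assms by (intro real_sqrt_le_mono) (simp add: power_mult_distrib divide_right_mono)
  also have "\<dots> = 4 * ln (real n) * sqrt (real d / real n)"
  proof -
    have "sqrt ((4 * ln (real n))\<^sup>2) = 4 * ln (real n)" using l by (subst real_sqrt_abs) simp
    then show ?thesis by (simp only: real_sqrt_mult)
  qed
  finally show ?thesis by simp
qed

text \<open>On the good event all of \<open>level_class H \<alpha> \<mu>0\<close> competes, so the
  excess is at most two deviations on the second sample: that of the returned hypothesis and that of
  its competitor.\<close>

lemma minimax_risk_le_sqrt_rate: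
  assumes hc: "hypothesis_class M H" and vc: "has_vc_dim M H d" and meas: "vc_measurable M H"
    and uc: "uniformly_close M H (\<epsilon> / 2) \<delta> n0" and \<delta>: "0 \<le> \<delta>" and d: "1 \<le> d" and n: "2 \<le> n"
  shows "minimax_risk M H \<alpha> \<epsilon> \<delta> n0 n \<le> ennreal (16 * ln (real n) * sqrt (real d / real n) + \<delta>)"
proof -
  let ?L = "erm H (\<alpha> + \<epsilon> / 2) n0 n"
  note H = has_vc_dim_nonempty[OF vc]
  note sel = erm_props(1)[OF H, of M "\<alpha> + \<epsilon> / 2" n0 n]
  show ?thesis
  proof (rule minimax_risk_le[OF emp_selector_approx_learner[OF uc \<delta> sel]])
    fix \<mu>0 \<mu>1 assume adm: "(\<mu>0, \<mu>1) \<in> admissible_pairs M H \<alpha>"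
    note \<mu> = admissible_pairsD[OF adm]
    let ?t = "truncated_excess H \<alpha> \<epsilon> \<mu>0 \<mu>1"
    obtain A where A: "A\<in>sets (iid n0 \<mu>0)" "emeasure (iid n0 \<mu>0) A \<le> ennreal \<delta>"
      "\<And>S. S\<in>space (iid n0 \<mu>0) - A \<Longrightarrow> \<forall>h\<in>H. risk_deviation n0 \<mu>0 S h \<le> \<epsilon> / 2"
      using uc \<mu>(1) unfolding uniformly_close_def by blast
    have n1: "1 \<le> n" using n by simp
    obtain G where G [measurable]: "G \<in> borel_measurable (iid n \<mu>1)"
      and ge: "\<And>S h. S \<in> space (iid n \<mu>1) \<Longrightarrow> h \<in> H \<Longrightarrow> ennreal (risk_deviation n \<mu>1 S h) \<le> G S"
      and int: "(\<integral>\<^sup>+S. G S \<partial>iid n \<mu>1) \<le> ennreal (vc_rate d n)"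
      by (rule vc_expectation[OF hc vc \<mu>(2) n1 meas]) blast
    have ln0: "0 \<le> ln (real n)" using n by simp
    have int2: "(\<integral>\<^sup>+S. 2 * G S \<partial>iid n \<mu>1) \<le> ennreal (16 * ln (real n) * sqrt (real d / real n))"
    proof -
      have "(\<integral>\<^sup>+S. 2 * G S \<partial>iid n \<mu>1) = 2 * (\<integral>\<^sup>+S. G S \<partial>iid n \<mu>1)" by (rule nn_integral_cmult) measurable
      also have "\<dots> \<le> ennreal 2 * ennreal (8 * ln (real n) * sqrt (real d / real n))"
        using order_trans[OF int ennreal_leI[OF sqrt_rate_le[OF d n]]] by (simp add: mult_left_mono)
      also have "\<dots> = ennreal (16 * ln (real n) * sqrt (real d / real n))"
        using ln0 by (subst ennreal_mult[symmetric]) auto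
      finally show ?thesis .
    qed
    show "outer_expectation (sample_pair n0 n \<mu>0 \<mu>1) (\<lambda>S. ?t (?L S))
        \<le> ennreal (16 * ln (real n) * sqrt (real d / real n) + \<delta>)"
    proof (rule outer_expectation_truncated_le[OF adm A(1,2) \<delta> _ int2])
      fix S0 S1 assume S: "S0 \<in> space (iid n0 \<mu>0) - A" "S1 \<in> space (iid n \<mu>1)"
      let ?h = "?L (S0, S1)"
      have hH: "?h \<in> H"
        using sel S space_iid_distributions[OF \<mu>(1)] space_iid_distributions[OF \<mu>(2)] by (auto simp: emp_selector_def)
      show "ennreal (?t ?h) \<le> 2 * G S1"
      proof (cases "G S1 = \<infinity>")
        case False
        define c where "c = enn2real (G S1)"
        have c: "G S1 = ennreal c" "0 \<le> c" using False by (auto simp: c_def less_top)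
        have dev: "risk_deviation n \<mu>1 S1 h \<le> c" if "h \<in> H" for h
          using ge[OF S(2) that] c by simp
        have "excess_risk H \<alpha> \<mu>0 \<mu>1 ?h \<le> 2 * c"
        proof (rule excess_risk_le[OF \<mu>(3)])
          fix h' assume h': "h' \<in> level_class H \<alpha> \<mu>0"
          then have h'H: "h' \<in> H" by (simp add: level_class_def)
          have "h' \<in> emp_class H (\<alpha> + \<epsilon> / 2) n0 S0" using emp_class_sandwich(1)[OF A(3)[OF S(1)]] h' by blast
          then have "emp_risk0 n S1 h' \<le> emp_risk0 n S1 ?h" by (rule erm_props(2)[OF H])
          then show "risk1 \<mu>1 ?h \<le> risk1 \<mu>1 h' + 2 * c"
            using dev[OF hH] dev[OF h'H] by (simp add: risk1_eq[OF hc _ \<mu>(2)] hH h'H abs_le_iff)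
        qed (use c in simp)
        then have "?t ?h \<le> 2 * c"
          using truncated_excess_bounds(2)[OF adm] by (rule order_trans[rotated])
        then have "ennreal (?t ?h) \<le> ennreal (2 * c)" by (rule ennreal_leI)
        also have "\<dots> = 2 * G S1" using c by (simp add: ennreal_mult)
        finally show ?thesis .
      qed (simp add: ennreal_mult_top)
    qed (use ln0 in auto)
  qed
qed

section \<open>Classes that do not separate three points\<close>

text \<open>Label one of three shattered points by 1, in two ways, and keep the third as common
  zero. Classes that do not separate thus have d \<le> 2, so that 1 / n and d / n are comparable
  once d \<ge> 1.\<close>

lemma shatters_three_separates:
  assumes "shatters H A" "3 \<le> card A" "A \<subseteq> space M"
  shows "separates_three_points M H"
proof -
  obtain B where B: "B \<subseteq> A" "card B = 3" using obtain_subset_with_card_n[OF assms(2)] by blast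
  from B(2) obtain x0 x1 x2 where x: "B = {x0, x1, x2}" "x0 \<noteq> x1" "x0 \<noteq> x2" "x1 \<noteq> x2"
    unfolding card_3_iff by blast
  obtain h1 where h1: "h1 \<in> H" "\<forall>x\<in>A. h1 x = (x = x1)"
    using assms(1)[unfolded shatters_def, rule_format, of "\<lambda>x. x = x1"] by blast
  obtain h2 where h2: "h2 \<in> H" "\<forall>x\<in>A. h2 x = (x = x2)"
    using assms(1)[unfolded shatters_def, rule_format, of "\<lambda>x. x = x2"] by blast
  have A: "x0 \<in> A" "x1 \<in> A" "x2 \<in> A" using B x by auto
  have AM: "x0 \<in> space M" "x1 \<in> space M" "x2 \<in> space M" using A assms(3) by auto
  have "\<not> h1 x0 \<and> \<not> h2 x0 \<and> h1 x1 \<and> h2 x2 \<and> \<not> h1 x2 \<and> \<not> h2 x1"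
    using bspec[OF h1(2) A(1)] bspec[OF h1(2) A(2)] bspec[OF h1(2) A(3)]
      bspec[OF h2(2) A(1)] bspec[OF h2(2) A(2)] bspec[OF h2(2) A(3)] x by simp
  with h1(1) h2(1) AM show ?thesis unfolding separates_three_points_def by (intro bexI)
qed

text \<open>Inclusion is tested on the space only, where the data live; hypotheses that differ off
  the space are identified, so this is a preorder.\<close>

definition sub_on :: "'a measure \<Rightarrow> ('a \<Rightarrow> bool) \<Rightarrow> ('a \<Rightarrow> bool) \<Rightarrow> bool" where
  "sub_on M h h' \<longleftrightarrow> (\<forall>x\<in>space M. h x \<longrightarrow> h' x)"

lemma has_maximal_element_iff:
  "has_maximal_element M K \<longleftrightarrow> (\<exists>h\<in>K. \<forall>h'\<in>K. sub_on M h' h)"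
proof -
  have "{x \<in> space M. h' x} \<subseteq> {x \<in> space M. h x} \<longleftrightarrow> sub_on M h' h" for h h'
    by (auto simp: sub_on_def)
  then show ?thesis by (simp add: has_maximal_element_def)
qed

lemma sub_on_trans: "sub_on M h1 h2 \<Longrightarrow> sub_on M h2 h3 \<Longrightarrow> sub_on M h1 h3"
  by (auto simp: sub_on_def)

lemma nested_if_common_zero:
  assumes "\<not> separates_three_points M H" "h \<in> H" "h' \<in> H" "x0 \<in> space M" "\<not> h x0" "\<not> h' x0"
  shows "sub_on M h h' \<or> sub_on M h' h"
proof (rule ccontr)
  assume "\<not> ?thesis"
  then obtain x1 x2 where "x1 \<in> space M" "h x1" "\<not> h' x1" "x2 \<in> space M" "h' x2" "\<not> h x2"
    by (auto simp: sub_on_def)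
  then have "separates_three_points M H"
    unfolding separates_three_points_def using assms(2-6) by blast
  then show False using assms(1) by contradiction
qed

text \<open>Two sets of mass below 1/2 cannot cover the space, so the two hypotheses have a common
  zero. This is where levels below 1/2 are used.\<close>

lemma level_class_nested:
  assumes ns: "\<not> separates_three_points M H" and hc: "hypothesis_class M H" and \<mu>: "\<mu> \<in> distributions M"
    and a: "a < 1/2" and h: "h \<in> level_class H a \<mu>" "h' \<in> level_class H a \<mu>"
  shows "sub_on M h h' \<or> sub_on M h' h"
proof -
  interpret prob_space \<mu> using distributionsD[OF \<mu>] by simp
  have H: "h \<in> H" "h' \<in> H" "risk0 \<mu> h \<le> a" "risk0 \<mu> h' \<le> a" using h by (auto simp: level_class_def)
  have "\<exists>x0\<in>space M. \<not> h x0 \<and> \<not> h' x0"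
  proof (rule ccontr)
    assume "\<not> ?thesis"
    then have "space \<mu> = {x\<in>space \<mu>. h x} \<union> {x\<in>space \<mu>. h' x}" using distributionsD(3)[OF \<mu>] by auto
    then have "1 = prob ({x\<in>space \<mu>. h x} \<union> {x\<in>space \<mu>. h' x})" using prob_space by simp
    also have "\<dots> \<le> risk0 \<mu> h + risk0 \<mu> h'"
      unfolding risk0_def using hypothesis_sets[OF hc _ \<mu>] H by (intro measure_Un_le) auto
    finally show False using H a by linarith
  qed
  then show ?thesis using nested_if_common_zero[OF ns H(1,2)] by blast
qed

section \<open>Reduction to two-point distributions\<close>

definition avoiding :: "('a \<Rightarrow> bool) set \<Rightarrow> 'a \<Rightarrow> 'a \<Rightarrow> ('a \<Rightarrow> bool) set" where
  "avoiding H c1 c2 = {h \<in> H. \<not> h c1 \<and> \<not> h c2}"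

definition two_point_dist :: "'a measure \<Rightarrow> 'a \<Rightarrow> 'a \<Rightarrow> 'a measure" where
  "two_point_dist M c1 c2 = discrete_dist M UNIV (\<lambda>b::bool. 1 / 2) (\<lambda>b. if b then c1 else c2)"

lemma weights_half: "weights UNIV (\<lambda>b::bool. 1 / 2)"
  by (auto simp: weights_def UNIV_bool)

lemma two_point_dist_in_distributions:
  "c1 \<in> space M \<Longrightarrow> c2 \<in> space M \<Longrightarrow> two_point_dist M c1 c2 \<in> distributions M"
  unfolding two_point_dist_def by (intro discrete_dist_in_distributions weights_half) auto

text \<open>Each of the two points has mass at least 1/2, so any level below 1/2 forbids both. The
  level class is therefore the same at \<alpha>, \<alpha> + \<epsilon> / 2 and \<alpha> +
  \<epsilon>, which lets statements about maximal elements pass between levels.\<close>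

lemma level_class_two_point_dist:
  assumes hc: "hypothesis_class M H" and c: "c1 \<in> space M" "c2 \<in> space M" and a: "0 \<le> a" "a < 1/2"
  shows "level_class H a (two_point_dist M c1 c2) = avoiding H c1 c2"
proof -
  have r: "risk0 (two_point_dist M c1 c2) h = (of_bool (h c1) + of_bool (h c2)) / 2" if h: "h \<in> H" for h
  proof -
    have "{x\<in>space M. h x} \<in> sets M"
      using hypothesis_sets[OF hc h two_point_dist_in_distributions[OF c]] by (simp add: two_point_dist_def)
    then show ?thesis unfolding risk0_def two_point_dist_def space_discrete_dist
      using c by (subst measure_discrete_dist) (auto simp: UNIV_bool)
  qed
  have "risk0 (two_point_dist M c1 c2) h \<le> a \<longleftrightarrow> \<not> h c1 \<and> \<not> h c2" if "h \<in> H" for h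
    unfolding r[OF that] using a by (cases "h c1"; cases "h c2") auto
  then show ?thesis unfolding level_class_def avoiding_def by blast
qed

lemma risk0_finite_support:
  assumes hc: "hypothesis_class M H" and h: "h \<in> H" and \<nu>: "\<nu> \<in> distributions M"
    and F: "F \<in> sets \<nu>" "measure \<nu> F = 1"
  shows "risk0 \<nu> h = measure \<nu> {x\<in>F. h x}"
proof -
  interpret prob_space \<nu> using distributionsD[OF \<nu>] by simp
  have s: "{x\<in>space \<nu>. h x} \<in> sets \<nu>" by (rule hypothesis_sets[OF hc h \<nu>])
  have "{x\<in>F. h x} = F \<inter> {x\<in>space \<nu>. h x}" using sets.sets_into_space[OF F(1)] by auto
  then have s': "{x\<in>F. h x} \<in> sets \<nu>" using F s by auto
  have "AE x in \<nu>. x \<in> F" by (rule AE_prob_1[OF F(2)])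
  then have "AE x in \<nu>. x \<in> {x\<in>space \<nu>. h x} \<longleftrightarrow> x \<in> {x\<in>F. h x}"
    by (rule eventually_mono) (use sets.sets_into_space[OF F(1)] in auto)
  then show ?thesis unfolding risk0_def by (rule measure_eq_AE[OF _ s s'])
qed

text \<open>On a finite support the chain has a member of largest trace \<open>T\<close>.  Two points \<open>c1\<close>, \<open>c2\<close> of the
  support outside \<open>T\<close> detect every hypothesis above it with a larger trace: the hypotheses above it
  that avoid \<open>c1\<close> are nested, and \<open>c2\<close> is taken from the smallest of their traces.\<close>

lemma no_maximal_element_avoiding:
  assumes ns: "\<not> separates_three_points M H" and hc: "hypothesis_class M H" and \<nu>: "\<nu> \<in> distributions M"
    and fs: "finite_support \<nu>" and a: "a < 1/2"
    and ne: "level_class H a \<nu> \<noteq> {}" and nomax: "\<not> has_maximal_element M (level_class H a \<nu>)"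
  obtains c1 c2 where "c1 \<in> space M" "c2 \<in> space M" "avoiding H c1 c2 \<noteq> {}"
    "\<not> has_maximal_element M (avoiding H c1 c2)"
proof -
  let ?K = "level_class H a \<nu>"
  obtain F where F: "F \<in> sets \<nu>" "finite F" "measure \<nu> F = 1" using fs by (auto simp: finite_support_def)
  have FM: "F \<subseteq> space M" using sets.sets_into_space[OF F(1)] distributionsD(3)[OF \<nu>] by simp
  define tr where "tr h = {x\<in>F. h x}" for h
  have trF: "tr h \<subseteq> F" "finite (tr h)" for h using F(2) by (auto simp: tr_def)
  have risk: "risk0 \<nu> h = measure \<nu> (tr h)" if "h \<in> H" for h
    unfolding tr_def by (rule risk0_finite_support[OF hc that \<nu> F(1,3)])
  obtain h1 where h1: "h1 \<in> ?K" "\<forall>h. h \<in> ?K \<longrightarrow> card (tr h) \<le> card (tr h1)"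
  proof -
    obtain h0 where h0: "h0 \<in> ?K" using ne by auto
    have "\<exists>h. h \<in> ?K \<and> (\<forall>h'. h' \<in> ?K \<longrightarrow> card (tr h') \<le> card (tr h))"
    proof (rule ex_has_greatest_nat)
      show "\<forall>h. h \<in> ?K \<longrightarrow> card (tr h) < Suc (card F)"
        using card_mono[OF F(2) trF(1)] by (simp add: less_Suc_eq_le)
    qed (rule h0)
    then show ?thesis using that by blast
  qed
  have h1H: "h1 \<in> H" using h1(1) by (simp add: level_class_def)
  \<comment> \<open>By the choice of \<open>h1\<close>, a member of the level class above it cannot
    be told apart from it on the support.\<close>
  have same_trace: "tr g = tr h1" if "g \<in> ?K" "sub_on M h1 g" for g
  proof -
    have "tr h1 \<subseteq> tr g" using that(2) FM by (auto simp: tr_def sub_on_def)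
    moreover have "card (tr g) \<le> card (tr h1)" using h1(2) that(1) by blast
    ultimately show ?thesis using card_seteq[OF trF(2)] by metis
  qed
  have "tr h1 \<noteq> F"
  proof
    assume "tr h1 = F"
    then have "risk0 \<nu> h1 = 1" using risk[OF h1H] F(3) by simp
    then show False using h1(1) a by (simp add: level_class_def)
  qed
  then obtain c1 where c1: "c1 \<in> F" "\<not> h1 c1" using trF(1)[of h1] by (auto simp: tr_def)
  \<comment> \<open>The range is H and not only the level class, because \<open>avoiding\<close> is
    taken in H as well.\<close>
  define above where "above = {h\<in>H. sub_on M h1 h \<and> tr h \<noteq> tr h1}"
  obtain c2 where c2: "c2 \<in> F" "\<not> h1 c2" "\<forall>h\<in>above. h c1 \<or> h c2"
  proof (cases "\<forall>h\<in>above. h c1")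
    case True
    then show ?thesis using that c1 by blast
  next
    case False
    then obtain h' where h': "h' \<in> above" "\<not> h' c1" by blast
    have "\<exists>h. (h \<in> above \<and> \<not> h c1) \<and> (\<forall>h'. h' \<in> above \<and> \<not> h' c1 \<longrightarrow> card (tr h) \<le> card (tr h'))"
      by (rule ex_has_least_nat[of "\<lambda>h. h \<in> above \<and> \<not> h c1" h']) (use h' in blast)
    then obtain h2 where h2: "h2 \<in> above" "\<not> h2 c1"
      "\<And>h'. h' \<in> above \<Longrightarrow> \<not> h' c1 \<Longrightarrow> card (tr h2) \<le> card (tr h')" by blast
    have "tr h1 \<subseteq> tr h2" using h2(1) FM by (auto simp: above_def sub_on_def tr_def)
    then obtain c2 where c2: "c2 \<in> tr h2" "c2 \<notin> tr h1" using h2(1) by (auto simp: above_def)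
    have "h c1 \<or> h c2" if h: "h \<in> above" for h
    proof (rule ccontr)
      assume n: "\<not> (h c1 \<or> h c2)"
      have c1M: "c1 \<in> space M" using c1 FM by auto
      have "sub_on M h h2 \<or> sub_on M h2 h"
        using h h2(1,2) n by (intro nested_if_common_zero[OF ns _ _ c1M]) (auto simp: above_def)
      then show False
      proof
        assume "sub_on M h h2"
        then have "tr h \<subseteq> tr h2" using FM by (auto simp: sub_on_def tr_def)
        moreover have "card (tr h2) \<le> card (tr h)" using h2(3) h n by blast
        ultimately have "tr h = tr h2" using card_seteq[OF trF(2)] by metis
        then show False using c2 n by (auto simp: tr_def)
      next
        assume "sub_on M h2 h"
        then show False using c2 n FM by (auto simp: sub_on_def tr_def)
      qed
    qed
    then show ?thesis using that[of c2] c2 by (auto simp: tr_def)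
  qed
  have h1A: "h1 \<in> avoiding H c1 c2" using h1H c1 c2 by (simp add: avoiding_def)
  \<comment> \<open>A maximal element of \<open>avoiding\<close> lies above \<open>h1\<close> and,
    containing neither \<open>c1\<close> nor \<open>c2\<close>, has the same trace, so it belongs to
    the level class. There it dominates everything: each member lies below \<open>h1\<close> or
    shares its trace and hence avoids \<open>c1\<close> and \<open>c2\<close>.\<close>
  have "\<not> has_maximal_element M (avoiding H c1 c2)"
  proof
    assume "has_maximal_element M (avoiding H c1 c2)"
    then obtain h where h: "h \<in> avoiding H c1 c2" "\<And>g. g \<in> avoiding H c1 c2 \<Longrightarrow> sub_on M g h"
      by (auto simp: has_maximal_element_iff)
    have hH: "h \<in> H" using h(1) by (simp add: avoiding_def)
    have h1h: "sub_on M h1 h" by (rule h(2)[OF h1A])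
    then have "h \<notin> above" using h(1) c2(3) by (auto simp: avoiding_def)
    then have "tr h = tr h1" using hH h1h by (auto simp: above_def)
    then have "h \<in> ?K" using h1(1) risk[OF hH] risk[OF h1H] hH by (simp add: level_class_def)
    moreover have "sub_on M g h" if g: "g \<in> ?K" for g
    proof -
      consider "sub_on M g h1" | "sub_on M h1 g" using level_class_nested[OF ns hc \<nu> a g h1(1)] by blast
      then show ?thesis
      proof cases
        case 1 then show ?thesis using h1h by (rule sub_on_trans)
      next
        case 2
        then have "tr g = tr h1" by (rule same_trace[OF g])
        then have "\<not> g c1" "\<not> g c2" using c1 c2 by (auto simp: tr_def)
        then show ?thesis using g by (intro h(2)) (simp add: avoiding_def level_class_def)
      qed
    qed
    ultimately have "has_maximal_element M ?K" by (auto simp: has_maximal_element_iff)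
    then show False using nomax by contradiction
  qed
  then show ?thesis using that[of c1 c2] c1 c2 FM h1A by blast
qed

text \<open>The empirical distribution of the first sample is finitely supported and its level class
  is the empirical class, which therefore has a maximal element to return. On the good event it
  contains every competitor, so no \<mu>1 can prefer another one.\<close>

lemma maximal_element_learner:
  assumes ns: "\<not> separates_three_points M H" and hc: "hypothesis_class M H" and sm: "singletons_measurable M"
    and H: "H \<noteq> {}" and uc: "uniformly_close M H (\<epsilon> / 2) \<delta> n0" and \<delta>: "0 \<le> \<delta>"
    and \<alpha>: "0 \<le> \<alpha>" "0 \<le> \<epsilon>" "\<alpha> + \<epsilon> < 1/2"
    and max: "\<forall>\<mu>0\<in>distributions M. finite_support \<mu>0 \<longrightarrow> level_class H (\<alpha> + \<epsilon>) \<mu>0 \<noteq> {} \<longrightarrow>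
              has_maximal_element M (level_class H (\<alpha> + \<epsilon>) \<mu>0)"
  shows "\<exists>L\<in>approx_learners M H \<alpha> \<epsilon> \<delta> n0 n. \<forall>(\<mu>0, \<mu>1)\<in>admissible_pairs M H \<alpha>.
               inner_prob (sample_pair n0 n \<mu>0 \<mu>1)
                 (\<lambda>S. truncated_excess H \<alpha> \<epsilon> \<mu>0 \<mu>1 (L S) = 0) \<ge> ennreal (1 - \<delta>)"
proof -
  define a where "a = \<alpha> + \<epsilon> / 2"
  have a: "0 \<le> a" "a < 1/2" using \<alpha> by (auto simp: a_def)
  have n0: "1 \<le> n0" using uc by (simp add: uniformly_close_def)
  have fs: "finite_support \<mu>" if "\<mu> \<in> distributions M" "finite F" "F \<subseteq> space M" "measure \<mu> F = 1" for \<mu> F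
  proof -
    have "F = (\<Union>x\<in>F. {x})" by auto
    also have "\<dots> \<in> sets M" using that sm by (intro sets.finite_UN) (auto simp: singletons_measurable_def)
    finally show ?thesis using that distributionsD(2)[OF that(1)] by (auto simp: finite_support_def)
  qed
  have meas1: "measure (discrete_dist M I w y) (y ` I) = 1"
    if "weights I w" "y \<in> I \<rightarrow> space M" for I :: "'i set" and w y
  proof -
    have "y ` I = (\<Union>i\<in>I. {y i})" by auto
    also have "\<dots> \<in> sets M" using that sm by (intro sets.finite_UN) (auto simp: singletons_measurable_def weights_def)
    finally show ?thesis using that by (subst measure_discrete_dist) (auto simp: weights_def)
  qed
  \<comment> \<open>The assumption concerns the level \<alpha> + \<epsilon>, the learner works at
    \<alpha> + \<epsilon> / 2. Two-point distributions carry the assumption over, as their level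
    classes agree at all levels in [0, 1/2).\<close>
  have max_av: "has_maximal_element M (avoiding H c1 c2)"
    if c: "c1 \<in> space M" "c2 \<in> space M" "avoiding H c1 c2 \<noteq> {}" for c1 c2
  proof -
    let ?D = "two_point_dist M c1 c2"
    have D: "?D \<in> distributions M" by (rule two_point_dist_in_distributions[OF c(1,2)])
    have "finite_support ?D"
    proof (rule fs[OF D])
      show "measure ?D ((\<lambda>b::bool. if b then c1 else c2) ` UNIV) = 1"
        unfolding two_point_dist_def by (rule meas1) (use c weights_half in auto)
    qed (use c in auto)
    moreover have "level_class H (\<alpha> + \<epsilon>) ?D = avoiding H c1 c2"
      using \<alpha> by (intro level_class_two_point_dist[OF hc c(1,2)]) auto
    ultimately show ?thesis using max D c(3) by metis
  qed
  have ex: "\<exists>h\<in>emp_class H a n0 S. \<forall>h'\<in>emp_class H a n0 S. sub_on M h' h"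
    if S: "S \<in> space (iid n0 M)" and ne: "emp_class H a n0 S \<noteq> {}" for S
  proof -
    let ?D = "discrete_dist M {..<n0} (\<lambda>_. 1 / real n0) S"
    have w: "weights {..<n0} (\<lambda>_. 1 / real n0)" using n0 by (auto simp: weights_def)
    have SM: "S \<in> {..<n0} \<rightarrow> space M" using S by (auto simp: space_PiM)
    have D: "?D \<in> distributions M" by (rule discrete_dist_in_distributions[OF w SM])
    have "risk0 ?D h = emp_risk0 n0 S h" if h: "h \<in> H" for h
    proof -
      have "{x\<in>space M. h x} \<in> sets M" using hypothesis_sets[OF hc h D] by simp
      then have "risk0 ?D h = (\<Sum>i<n0. 1 / real n0 * of_bool (S i \<in> {x\<in>space M. h x}))"
        unfolding risk0_def space_discrete_dist using SM by (subst measure_discrete_dist) auto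
      also have "\<dots> = (\<Sum>i<n0. of_bool (h (S i)) / real n0)"
        using SM by (intro sum.cong refl) (auto simp: Pi_iff)
      finally show ?thesis unfolding emp_risk0_def sum_divide_distrib .
    qed
    then have lev: "level_class H a ?D = emp_class H a n0 S" by (auto simp: level_class_def emp_class_def)
    have fD: "finite_support ?D"
      by (rule fs[OF D _ _ meas1[OF w SM]]) (use SM in auto)
    have "has_maximal_element M (level_class H a ?D)"
    proof (rule ccontr)
      assume "\<not> has_maximal_element M (level_class H a ?D)"
      then obtain c1 c2 where "c1 \<in> space M" "c2 \<in> space M" "avoiding H c1 c2 \<noteq> {}"
        "\<not> has_maximal_element M (avoiding H c1 c2)"
        using no_maximal_element_avoiding[OF ns hc D fD a(2)] ne lev by metis
      then show False using max_av by blast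
    qed
    then show ?thesis unfolding lev has_maximal_element_iff .
  qed
  define Q where "Q S0 h \<longleftrightarrow> (if emp_class H a n0 S0 = {} then h \<in> H
     else h \<in> emp_class H a n0 S0 \<and> (\<forall>h'\<in>emp_class H a n0 S0. sub_on M h' h))" for S0 h
  define L where "L = (\<lambda>(S0, S1 :: nat \<Rightarrow> 'a). SOME h. Q S0 h)"
  have L: "Q S0 (L (S0, S1))" if S: "S0 \<in> space (iid n0 M)" for S0 S1
  proof -
    have "\<exists>h. Q S0 h" unfolding Q_def using ex[OF S] H by (cases "emp_class H a n0 S0 = {}") auto
    then show ?thesis unfolding L_def prod.case by (rule someI_ex)
  qed
  have QH: "h \<in> H" if "Q S0 h" for S0 h
    using that by (auto simp: Q_def emp_class_def split: if_splits)
  have Qe: "h \<in> emp_class H a n0 S0 \<and> (\<forall>h'\<in>emp_class H a n0 S0. sub_on M h' h)"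
    if "Q S0 h" "emp_class H a n0 S0 \<noteq> {}" for S0 h
    using that by (simp add: Q_def)
  have sel: "emp_selector M H a n0 n L"
    unfolding emp_selector_def
  proof (intro ballI conjI impI)
    fix S0 S1 assume S0: "S0 \<in> space (iid n0 M)"
    show "L (S0, S1) \<in> H" by (rule QH[OF L[OF S0]])
    show "L (S0, S1) \<in> emp_class H a n0 S0" if "emp_class H a n0 S0 \<noteq> {}"
      using Qe[OF L[OF S0] that] by simp
  qed
  have "L \<in> approx_learners M H \<alpha> \<epsilon> \<delta> n0 n"
    by (rule emp_selector_approx_learner[OF uc \<delta> sel[unfolded a_def]])
  moreover have "inner_prob (sample_pair n0 n \<mu>0 \<mu>1) (\<lambda>S. truncated_excess H \<alpha> \<epsilon> \<mu>0 \<mu>1 (L S) = 0) \<ge> ennreal (1 - \<delta>)"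
    if adm: "(\<mu>0, \<mu>1) \<in> admissible_pairs M H \<alpha>" for \<mu>0 \<mu>1
  proof -
    note \<mu> = admissible_pairsD[OF adm]
    obtain A where A: "A\<in>sets (iid n0 \<mu>0)" "emeasure (iid n0 \<mu>0) A \<le> ennreal \<delta>"
      "\<And>S. S\<in>space (iid n0 \<mu>0) - A \<Longrightarrow> \<forall>h\<in>H. risk_deviation n0 \<mu>0 S h \<le> \<epsilon> / 2"
      using uc \<mu>(1) unfolding uniformly_close_def by blast
    show ?thesis
    proof (rule inner_prob_fst_ge[OF \<mu>(1,2) \<delta> A(1,2)])
      fix S0 S1 assume S: "S0 \<in> space (iid n0 \<mu>0) - A" "S1 \<in> space (iid n \<mu>1)"
      have sub: "level_class H \<alpha> \<mu>0 \<subseteq> emp_class H a n0 S0"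
        unfolding a_def by (rule emp_class_sandwich(1)[OF A(3)[OF S(1)]])
      have S0: "S0 \<in> space (iid n0 M)" using S(1) space_iid_distributions[OF \<mu>(1)] by auto
      have Lmax: "sub_on M h' (L (S0, S1))" if "h' \<in> level_class H \<alpha> \<mu>0" for h'
      proof -
        have h': "h' \<in> emp_class H a n0 S0" using sub that by (rule subsetD)
        then have "emp_class H a n0 S0 \<noteq> {}" by blast
        from Qe[OF L[OF S0] this] show ?thesis using h' by simp
      qed
      have "excess_risk H \<alpha> \<mu>0 \<mu>1 (L (S0, S1)) \<le> 0"
      proof (rule excess_risk_le[OF \<mu>(3)])
        fix h' assume h': "h' \<in> level_class H \<alpha> \<mu>0"
        have LH: "L (S0, S1) \<in> H" by (rule QH[OF L[OF S0]])
        interpret prob_space \<mu>1 using distributionsD[OF \<mu>(2)] by simp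
        have "risk0 \<mu>1 h' \<le> risk0 \<mu>1 (L (S0, S1))"
          unfolding risk0_def using Lmax[OF h'] hypothesis_sets[OF hc LH \<mu>(2)] distributionsD(3)[OF \<mu>(2)]
          by (intro finite_measure_mono) (auto simp: sub_on_def)
        then show "risk1 \<mu>1 (L (S0, S1)) \<le> risk1 \<mu>1 h' + 0"
          using h' LH by (simp add: risk1_eq[OF hc _ \<mu>(2)] level_class_def)
      qed simp
      then show "truncated_excess H \<alpha> \<epsilon> \<mu>0 \<mu>1 (L (S0, S1)) = 0"
        using truncated_excess_bounds(1,2)[OF adm, of \<epsilon> "L (S0, S1)"] by linarith
    qed
  qed
  ultimately show ?thesis by (intro bexI[of _ L]) auto
qed

section \<open>Lower bound from an undetected atom\<close>

lemma minimax_risk_ge: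
  assumes "\<And>L. L \<in> approx_learners M H \<alpha> \<epsilon> \<delta> n0 n \<Longrightarrow> \<exists>\<mu>0 \<mu>1. (\<mu>0, \<mu>1) \<in> admissible_pairs M H \<alpha> \<and>
      B \<le> outer_expectation (sample_pair n0 n \<mu>0 \<mu>1) (\<lambda>S. truncated_excess H \<alpha> \<epsilon> \<mu>0 \<mu>1 (L S))"
  shows "B \<le> minimax_risk M H \<alpha> \<epsilon> \<delta> n0 n"
  unfolding minimax_risk_def
proof (rule INF_greatest)
  fix L assume "L \<in> approx_learners M H \<alpha> \<epsilon> \<delta> n0 n"
  then obtain \<mu>0 \<mu>1 where "(\<mu>0, \<mu>1) \<in> admissible_pairs M H \<alpha>"
    "B \<le> outer_expectation (sample_pair n0 n \<mu>0 \<mu>1) (\<lambda>S. truncated_excess H \<alpha> \<epsilon> \<mu>0 \<mu>1 (L S))"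
    using assms by blast
  then show "B \<le> (SUP (\<mu>0, \<mu>1)\<in>admissible_pairs M H \<alpha>.
      outer_expectation (sample_pair n0 n \<mu>0 \<mu>1) (\<lambda>S. truncated_excess H \<alpha> \<epsilon> \<mu>0 \<mu>1 (L S)))"
    by (intro SUP_upper2[of "(\<mu>0, \<mu>1)"]) auto
qed

lemma learner_prob_ge:
  assumes L: "L \<in> approx_learners M H \<alpha> \<epsilon> \<delta> n0 n" and \<delta>: "\<delta> < 1/2"
    and w: "weights I0 w0" "y0 \<in> I0 \<rightarrow> space M" "weights I1 w1" "y1 \<in> I1 \<rightarrow> space M"
    and adm: "level_class H \<alpha> (discrete_dist M I0 w0 y0) \<noteq> {}"
  shows "1 - \<delta> \<le> (\<Sum>s\<in>pair_index n0 n I0 I1. pair_weight n0 n w0 w1 s *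
     of_bool (L (pair_point n0 n y0 y1 s) \<in> level_class H (\<alpha> + \<epsilon>) (discrete_dist M I0 w0 y0)))"
proof -
  let ?D0 = "discrete_dist M I0 w0 y0" and ?D1 = "discrete_dist M I1 w1 y1"
  have "(?D0, ?D1) \<in> admissible_pairs M H \<alpha>"
    using adm discrete_dist_in_distributions[OF w(1,2)] discrete_dist_in_distributions[OF w(3,4)]
    by (simp add: admissible_pairs_def)
  then have "ennreal (1 - \<delta>) \<le> inner_prob (sample_pair n0 n ?D0 ?D1) (\<lambda>S. L S \<in> level_class H (\<alpha> + \<epsilon>) ?D0)"
    using L by (auto simp: approx_learners_def)
  also have "\<dots> \<le> ennreal (\<Sum>s\<in>pair_index n0 n I0 I1. pair_weight n0 n w0 w1 s *
     of_bool (L (pair_point n0 n y0 y1 s) \<in> level_class H (\<alpha> + \<epsilon>) ?D0))"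
    by (rule inner_prob_discrete_le[OF w])
  finally show ?thesis using \<delta>
    by (subst (asm) ennreal_le_iff2) auto
qed

text \<open>The upper bound is sought in K and not in Z, so that Z may be empty.\<close>

lemma finite_chain_upper:
  assumes "finite Z" "Z \<subseteq> K" "K \<noteq> {}"
    and chain: "\<And>h h'. h \<in> K \<Longrightarrow> h' \<in> K \<Longrightarrow> sub_on M h h' \<or> sub_on M h' h"
  obtains u where "u \<in> K" "\<forall>h\<in>Z. sub_on M h u"
proof -
  have "\<exists>u\<in>K. \<forall>h\<in>Z. sub_on M h u" using assms(1,2)
  proof (induction Z rule: finite_induct)
    case empty
    then show ?case using assms(3) by auto
  next
    case (insert z Z)
    then obtain u where u: "u \<in> K" "\<forall>h\<in>Z. sub_on M h u" by auto
    have z: "z \<in> K" using insert.prems by simp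
    consider "sub_on M z u" | "sub_on M u z" using chain[OF z u(1)] by blast
    then show ?case
    proof cases
      case 1 then show ?thesis using u by auto
    next
      case 2
      then have "\<forall>h\<in>insert z Z. sub_on M h z" using u sub_on_trans by (auto simp: sub_on_def)
      then show ?thesis using z by blast
    qed
  qed
  then show ?thesis using that by blast
qed

text \<open>A finite part of a chain lies below one member u, and some member exceeds u because u is
  not maximal.\<close>

lemma chain_no_max_escape:
  assumes fin: "finite Z" "Z \<subseteq> K" and K: "K \<noteq> {}" "\<not> has_maximal_element M K"
    and chain: "\<And>h h'. h \<in> K \<Longrightarrow> h' \<in> K \<Longrightarrow> sub_on M h h' \<or> sub_on M h' h"
  obtains g x where "g \<in> K" "x \<in> space M" "g x" "\<forall>h\<in>Z. \<not> h x"
proof -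
  obtain u where u: "u \<in> K" "\<forall>h\<in>Z. sub_on M h u"
    by (rule finite_chain_upper[OF fin K(1) chain]) blast
  then obtain g where g: "g \<in> K" "\<not> sub_on M g u" using K(2) by (auto simp: has_maximal_element_iff)
  then obtain x where "x \<in> space M" "g x" "\<not> u x" by (auto simp: sub_on_def)
  then show ?thesis using that g(1) u(2) by (auto simp: sub_on_def)
qed

text \<open>The adversary moves after the learner. While the second sample shows \<open>c1\<close>
  only, the two-point \<mu>0 leaves finitely many outputs, and the atom goes to a point x that the
  admissible ones among them all miss. Admissible hypotheses vanish at \<open>c1\<close>, so under
  \<mu>1 only their value at x counts.\<close>

lemma minimax_risk_ge_fast_rate:
  assumes ns: "\<not> separates_three_points M H" and hc: "hypothesis_class M H"
    and c: "c1 \<in> space M" "c2 \<in> space M" "avoiding H c1 c2 \<noteq> {}" "\<not> has_maximal_element M (avoiding H c1 c2)"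
    and \<alpha>: "0 \<le> \<alpha>" "0 \<le> \<epsilon>" "\<alpha> + \<epsilon> < 1/2" and \<delta>: "\<delta> < 1/2" and n: "1 \<le> n"
  shows "ennreal (1 / (16 * real n)) \<le> minimax_risk M H \<alpha> \<epsilon> \<delta> n0 n"
proof (rule minimax_risk_ge)
  fix L assume L: "L \<in> approx_learners M H \<alpha> \<epsilon> \<delta> n0 n"
  let ?K = "avoiding H c1 c2"
  define y0 where "y0 = (\<lambda>b. if b then c1 else c2)"
  let ?w0 = "\<lambda>b::bool. 1 / 2 :: real"
  let ?D0 = "discrete_dist M UNIV ?w0 y0"
  have D0: "?D0 = two_point_dist M c1 c2" by (simp add: two_point_dist_def y0_def)
  have lev: "level_class H \<alpha> ?D0 = ?K" "level_class H (\<alpha> + \<epsilon>) ?D0 = ?K"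
    unfolding D0 using \<alpha> by (auto simp: level_class_two_point_dist[OF hc c(1,2)])
  have chain: "sub_on M h h' \<or> sub_on M h' h" if "h \<in> ?K" "h' \<in> ?K" for h h'
    using that nested_if_common_zero[OF ns _ _ c(1)] by (auto simp: avoiding_def)
  define t1 where "t1 = (\<lambda>j\<in>{..<n}. c1)"
  define Z where "Z = (\<lambda>s0. L ((\<lambda>j\<in>{..<n0}. y0 (s0 j)), t1)) ` seqs n0 UNIV \<inter> ?K"
  have "finite Z" unfolding Z_def by (intro finite_Int disjI1 finite_imageI finite_PiE) auto
  then obtain g x where g: "g \<in> ?K" "x \<in> space M" "g x" "\<forall>h\<in>Z. \<not> h x"
    using chain_no_max_escape[of Z ?K M] c(3,4) chain unfolding Z_def by (metis inf_le2)
  \<comment> \<open>As n q = 1/4, Bernoulli's inequality leaves the atom unseen with probability at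
    least 3/4. The learner succeeds with probability at least 1/2, so both happen with probability
    at least 1/4, at a loss of q: in total 1 / (16 n).\<close>
  define q where "q = 1 / (4 * real n)"
  have q: "0 < q" "q \<le> 1/4" "real n * q = 1/4" using n by (auto simp: q_def field_simps)
  define w1 where "w1 = (\<lambda>b. if b then q else 1 - q)"
  define y1 where "y1 = (\<lambda>b. if b then x else c1)"
  let ?D1 = "discrete_dist M UNIV w1 y1"
  let ?t = "truncated_excess H \<alpha> \<epsilon> ?D0 ?D1"
  have w: "weights UNIV ?w0" "y0 \<in> UNIV \<rightarrow> space M" "weights UNIV w1" "y1 \<in> UNIV \<rightarrow> space M"
    using weights_half c g(2) q by (auto simp: y0_def y1_def w1_def weights_def UNIV_bool)
  have D1: "?D1 \<in> distributions M" "?D0 \<in> distributions M"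
    using w by (auto intro: discrete_dist_in_distributions)
  have adm: "(?D0, ?D1) \<in> admissible_pairs M H \<alpha>"
    using D1 lev c(3) by (auto simp: admissible_pairs_def)
  have r1: "risk1 ?D1 h = 1 - q * of_bool (h x)" if "h \<in> ?K" for h
  proof -
    have h: "h \<in> H" "\<not> h c1" using that by (auto simp: avoiding_def)
    have "{x\<in>space M. h x} \<in> sets M" using hypothesis_sets[OF hc h(1) D1(1)] by simp
    then have "risk0 ?D1 h = q * of_bool (h x)" unfolding risk0_def space_discrete_dist
      using w h g(2) by (subst measure_discrete_dist) (auto simp: UNIV_bool w1_def y1_def weights_def)
    then show ?thesis using risk1_eq[OF hc h(1) D1(1)] by simp
  qed
  have ex: "q \<le> ?t h" if "h \<in> Z" for h
  proof -
    have h: "h \<in> ?K" "\<not> h x" using that g(4) by (auto simp: Z_def)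
    have "(INF h'\<in>level_class H \<alpha> ?D0. risk1 ?D1 h') \<le> risk1 ?D1 g"
      by (rule INF_risk1_le[OF D1(1)]) (use g lev in auto)
    then have "q \<le> excess_risk H \<alpha> ?D0 ?D1 h"
      using r1[OF h(1)] r1[OF g(1)] h g(3) by (simp add: excess_risk_def)
    then show ?thesis using h lev by (simp add: truncated_excess_def)
  qed
  let ?\<Omega> = "pair_index n0 n (UNIV::bool set) (UNIV::bool set)"
  let ?W = "pair_weight n0 n ?w0 w1"
  let ?X = "pair_point n0 n y0 y1"
  define k where "k = (\<lambda>j\<in>{..<n}. False)"
  have W: "weights ?\<Omega> ?W" by (rule weights_pair_index) (use w in auto)
  have p1: "1/2 \<le> (\<Sum>s\<in>?\<Omega>. ?W s * of_bool (L (?X s) \<in> ?K))"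
    using learner_prob_ge[OF L \<delta> w] lev c(3) \<delta> by simp
  have p2: "3/4 \<le> (\<Sum>s\<in>?\<Omega>. ?W s * of_bool (snd s = k))"
  proof -
    \<comment> \<open>The indicator of an unseen atom is absorbed into the weights, which lowers
      their total to (1 - q)^n.\<close>
    have "?W s * of_bool (snd s = k) = pair_weight n0 n ?w0 (\<lambda>b. (1 - q) * of_bool (\<not> b)) s" if s: "s \<in> ?\<Omega>" for s
    proof (cases "snd s = k")
      case False
      have "\<exists>j<n. snd s j"
      proof (rule ccontr)
        assume "\<not> ?thesis"
        then have "snd s = k"
          using s by (intro extensionalityI[of _ "{..<n}"]) (auto simp: pair_index_def PiE_iff k_def)
        then show False using False by contradiction
      qed
      then obtain j where "j < n" "snd s j" by blast
      then show ?thesis using False by (auto simp: pair_weight_def)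
    qed (simp add: pair_weight_def w1_def k_def)
    then have "(\<Sum>s\<in>?\<Omega>. ?W s * of_bool (snd s = k)) = (\<Sum>s\<in>?\<Omega>. pair_weight n0 n ?w0 (\<lambda>b. (1 - q) * of_bool (\<not> b)) s)"
      by (rule sum.cong[OF refl])
    also have "\<dots> = (1 - q) ^ n" by (simp add: sum_pair_weight UNIV_bool)
    also have "\<dots> \<ge> 1 + real n * (- q)" using Bernoulli_inequality[of "- q" n] q by simp
    ultimately show ?thesis using q(3) by linarith
  qed
  have "q / 4 \<le> q * ((\<Sum>s\<in>?\<Omega>. ?W s * of_bool (L (?X s) \<in> ?K)) + (\<Sum>s\<in>?\<Omega>. ?W s * of_bool (snd s = k)) - (\<Sum>s\<in>?\<Omega>. ?W s))"
    using p1 p2 W q mult_left_mono[of "1/4" _ q] by (simp add: weights_def)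
  also have "\<dots> = (\<Sum>s\<in>?\<Omega>. ?W s * (q * (of_bool (L (?X s) \<in> ?K) + of_bool (snd s = k) - 1)))"
    by (simp add: sum_distrib_left sum.distrib[symmetric] sum_subtractf[symmetric] algebra_simps)
  also have "\<dots> \<le> (\<Sum>s\<in>?\<Omega>. ?W s * ?t (L (?X s)))"
  proof (intro sum_mono mult_left_mono)
    fix s assume s: "s \<in> ?\<Omega>"
    show "0 \<le> ?W s" using W s by (auto simp: weights_def)
    show "q * (of_bool (L (?X s) \<in> ?K) + of_bool (snd s = k) - 1) \<le> ?t (L (?X s))"
    proof (cases "L (?X s) \<in> ?K \<and> snd s = k")
      case True
      then have "?X s = ((\<lambda>j\<in>{..<n0}. y0 (fst s j)), t1)"
        by (auto simp: pair_point_def t1_def k_def y1_def)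
      then have "L (?X s) \<in> Z" using True s by (auto simp: Z_def pair_index_def)
      then show ?thesis using ex True by simp
    next
      case False
      then have "q * (of_bool (L (?X s) \<in> ?K) + of_bool (snd s = k) - 1) \<le> 0"
        using q by (auto simp: of_bool_def)
      then show ?thesis using truncated_excess_bounds(1)[OF adm] by (rule order_trans)
    qed
  qed
  finally have "1 / (16 * real n) \<le> (\<Sum>s\<in>?\<Omega>. ?W s * ?t (L (?X s)))"
    by (simp add: q_def)
  then have "ennreal (1 / (16 * real n)) \<le> ennreal (\<Sum>s\<in>?\<Omega>. ?W s * ?t (L (?X s)))"
    by (rule ennreal_leI)
  also have "\<dots> \<le> outer_expectation (sample_pair n0 n ?D0 ?D1) (\<lambda>S. ?t (L S))"
    by (rule outer_expectation_discrete_ge[OF w]) (use truncated_excess_bounds(1)[OF adm] in blast)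
  finally show "\<exists>\<mu>0 \<mu>1. (\<mu>0, \<mu>1) \<in> admissible_pairs M H \<alpha> \<and> ennreal (1 / (16 * real n))
      \<le> outer_expectation (sample_pair n0 n \<mu>0 \<mu>1) (\<lambda>S. truncated_excess H \<alpha> \<epsilon> \<mu>0 \<mu>1 (L S))"
    using adm by blast
qed

section \<open>Outer measure along chains\<close>

text \<open>B may be non-measurable. If A contains the power of B with m + 1 factors, then for x in
  the power with m factors the section of A contains B and has measure 1. The set of all x with full
  section is measurable and contains the smaller power, so Fubini closes the induction.\<close>

lemma emeasure_PiM_full_outer:
  assumes "prob_space \<mu>" and B: "B \<subseteq> space \<mu>"
    and full: "\<And>A. A \<in> sets \<mu> \<Longrightarrow> B \<subseteq> A \<Longrightarrow> emeasure \<mu> A = 1"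
    and "A \<in> sets (iid m \<mu>)" "PiE {..<m} (\<lambda>_. B) \<subseteq> A"
  shows "emeasure (iid m \<mu>) A = 1"
  using assms(4,5)
proof (induction m arbitrary: A)
  case 0
  interpret P: prob_space "iid 0 \<mu>" by (intro prob_space_PiM assms(1))
  have "space (iid 0 \<mu>) \<subseteq> A" using "0.prems"(2) by (simp add: space_PiM)
  then have "A = space (iid 0 \<mu>)" using sets.sets_into_space[OF "0.prems"(1)] by blast
  then show ?case by (simp add: P.emeasure_space_1 del: lessThan_0)
next
  case (Suc m)
  interpret prob_space \<mu> by fact
  interpret product_sigma_finite "\<lambda>_. \<mu>" by unfold_locales
  interpret P: prob_space "iid m \<mu>" by (intro prob_space_PiM prob_space_axioms)
  interpret P': prob_space "iid (Suc m) \<mu>" by (intro prob_space_PiM prob_space_axioms)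
  let ?f = "\<lambda>x. \<integral>\<^sup>+y. indicator A (x(m := y)) \<partial>\<mu>"
  have A: "A \<in> sets (PiM (insert m {..<m}) (\<lambda>_. \<mu>))" using Suc.prems(1) by (simp add: lessThan_Suc)
  have upd: "(\<lambda>(x, y). x(m := y)) \<in> measurable (iid m \<mu> \<Otimes>\<^sub>M \<mu>) (PiM (insert m {..<m}) (\<lambda>_. \<mu>))"
    by (rule measurable_add_dim)
  have "(\<lambda>p. indicator A (case p of (x, y) \<Rightarrow> x(m := y)) :: ennreal) \<in> borel_measurable (iid m \<mu> \<Otimes>\<^sub>M \<mu>)"
    using A by (intro measurable_compose[OF upd]) simp
  then have f: "?f \<in> borel_measurable (iid m \<mu>)"
    using borel_measurable_nn_integral_fst[of "\<lambda>p. indicator A (case p of (x, y) \<Rightarrow> x(m := y))" "iid m \<mu>"] by simp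
  have "emeasure (iid (Suc m) \<mu>) A = (\<integral>\<^sup>+x. indicator A x \<partial>PiM (insert m {..<m}) (\<lambda>_. \<mu>))"
    using A by (simp add: lessThan_Suc)
  also have "\<dots> = (\<integral>\<^sup>+x. ?f x \<partial>iid m \<mu>)"
    using A by (intro product_nn_integral_insert) auto
  finally have eq: "emeasure (iid (Suc m) \<mu>) A = (\<integral>\<^sup>+x. ?f x \<partial>iid m \<mu>)" .
  let ?E = "{x\<in>space (iid m \<mu>). 1 \<le> ?f x}"
  have E: "?E \<in> sets (iid m \<mu>)" using f by measurable
  have "PiE {..<m} (\<lambda>_. B) \<subseteq> ?E"
  proof
    fix x assume x: "x \<in> PiE {..<m} (\<lambda>_. B)"
    then have xs: "x \<in> space (iid m \<mu>)" using B by (auto simp: space_PiM PiE_iff)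
    let ?A = "{y\<in>space \<mu>. x(m := y) \<in> A}"
    have "(\<lambda>y. x(m := y)) \<in> measurable \<mu> (PiM (insert m {..<m}) (\<lambda>_. \<mu>))"
      using measurable_Pair2[OF upd xs] by simp
    then have "(\<lambda>y. x(m := y)) -` A \<inter> space \<mu> \<in> sets \<mu>" using A by (rule measurable_sets)
    moreover have "(\<lambda>y. x(m := y)) -` A \<inter> space \<mu> = ?A" by auto
    ultimately have As: "?A \<in> sets \<mu>" by simp
    have "B \<subseteq> ?A"
    proof
      fix y assume y: "y \<in> B"
      then have "x(m := y) \<in> PiE {..<Suc m} (\<lambda>_. B)"
        using x by (auto simp: PiE_iff extensional_def less_Suc_eq)
      then show "y \<in> ?A" using Suc.prems(2) B y by auto
    qed
    then have "emeasure \<mu> ?A = 1" by (rule full[OF As])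
    moreover have "?f x = (\<integral>\<^sup>+y. indicator ?A y \<partial>\<mu>)"
      by (intro nn_integral_cong) (auto simp: indicator_def)
    ultimately show "x \<in> ?E" using xs As by simp
  qed
  then have "emeasure (iid m \<mu>) ?E = 1" by (rule Suc.IH[OF E])
  then have "1 = (\<integral>\<^sup>+x. indicator ?E x \<partial>iid m \<mu>)" using E by simp
  also have "\<dots> \<le> (\<integral>\<^sup>+x. ?f x \<partial>iid m \<mu>)"
    by (intro nn_integral_mono) (auto simp: indicator_def)
  finally have "1 \<le> emeasure (iid (Suc m) \<mu>) A" by (simp add: eq)
  then show ?case using P'.measure_le_1[of A] by (rule antisym[rotated])
qed

text \<open>Uniform convergence makes outer measure continuous along chains of hypotheses.  If it failed,
  the part of the union outside of a hypothesis of maximal risk would support a distribution under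
  which every sample lies in a hypothesis of risk 0.\<close>

lemma chain_union_measure:
  assumes hc: "hypothesis_class M H" and uc: "uniformly_close M H \<epsilon> \<delta> m" "\<epsilon> < 1" "\<delta> < 1"
    and \<mu>: "\<mu> \<in> distributions M" and C: "C \<subseteq> H" "C \<noteq> {}"
    and chain: "\<And>h h'. h \<in> C \<Longrightarrow> h' \<in> C \<Longrightarrow> sub_on M h h' \<or> sub_on M h' h"
    and s: "\<And>h. h \<in> C \<Longrightarrow> risk0 \<mu> h \<le> s"
  obtains V where "V \<in> sets \<mu>" "\<forall>h\<in>C. {x\<in>space \<mu>. h x} \<subseteq> V" "measure \<mu> V \<le> s"
proof -
  interpret prob_space \<mu> using distributionsD[OF \<mu>] by simp
  have sp: "space \<mu> = space M" by (rule distributionsD(3)[OF \<mu>])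
  define R where "R h = {x\<in>space \<mu>. h x}" for h
  have R: "R h \<in> sets \<mu>" if "h \<in> C" for h
    unfolding R_def using hypothesis_sets[OF hc _ \<mu>] that C(1) by blast
  have mR: "prob (R h) = risk0 \<mu> h" for h by (simp add: R_def risk0_def)
  have sub: "sub_on M h h' \<longleftrightarrow> R h \<subseteq> R h'" for h h' by (auto simp: R_def sub_on_def sp)
  have mono: "risk0 \<mu> h \<le> risk0 \<mu> h'" if "sub_on M h h'" "h' \<in> C" for h h'
    using finite_measure_mono[of "R h" "R h'"] that R sub mR by simp
  show ?thesis
  proof (cases "\<exists>h0\<in>C. \<forall>h\<in>C. risk0 \<mu> h \<le> risk0 \<mu> h0")
    case False
    \<comment> \<open>Without a member of largest risk, a sequence whose risks approach the supremum
      is cofinal in the chain, so a countable union suffices.\<close>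
    define r where "r = (SUP h\<in>C. risk0 \<mu> h)"
    have bdd: "bdd_above (risk0 \<mu> ` C)" using s by (auto intro!: bdd_aboveI2)
    have le_r: "risk0 \<mu> h \<le> r" if "h \<in> C" for h
      unfolding r_def using that bdd by (rule cSUP_upper)
    have "\<exists>h\<in>C. r - 1 / real (Suc i) < risk0 \<mu> h" for i
      using less_cSUP_iff[OF C(2) bdd, of "r - 1 / real (Suc i)"] by (simp add: r_def)
    then obtain g where g: "\<And>i. g i \<in> C" "\<And>i. r - 1 / real (Suc i) < risk0 \<mu> (g i)" by metis
    define V where "V = (\<Union>i. R (g i))"
    have V: "V \<in> sets \<mu>" using R g(1) by (auto simp: V_def)
    have "R h \<subseteq> V" if h: "h \<in> C" for h
    proof -
      obtain h' where h': "h' \<in> C" "risk0 \<mu> h < risk0 \<mu> h'" using False h by (meson not_le)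
      then have "risk0 \<mu> h < r" using le_r[of h'] by linarith
      then obtain i where "1 / real (Suc i) < r - risk0 \<mu> h" using nat_approx_posE[of "r - risk0 \<mu> h"] by auto
      then have "risk0 \<mu> h < risk0 \<mu> (g i)" using g(2)[of i] by linarith
      then have "\<not> sub_on M (g i) h" using mono h by (meson not_le)
      then have "R h \<subseteq> R (g i)" using chain[OF h g(1)] sub by blast
      then show ?thesis by (auto simp: V_def)
    qed
    moreover have "prob V \<le> s"
    proof -
      define W where "W i = (\<Union>j\<in>{..i}. R (g j))" for i
      have "W i \<in> sets \<mu>" for i unfolding W_def using R g(1) by (intro sets.finite_UN) auto
      moreover have "incseq W" unfolding incseq_def W_def by (intro allI impI UN_mono) auto
      ultimately have "(\<lambda>i. prob (W i)) \<longlonglongrightarrow> prob (\<Union>i. W i)"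
        by (intro finite_Lim_measure_incseq) auto
      moreover have "(\<Union>i. W i) = V" by (auto simp: W_def V_def)
      moreover have "prob (W i) \<le> s" for i
      proof -
        have "finite (g ` {..i})" "g ` {..i} \<subseteq> C" using g(1) by auto
        then obtain h where h: "h \<in> C" "\<forall>f\<in>g ` {..i}. sub_on M f h"
          by (rule finite_chain_upper[OF _ _ C(2) chain]) blast
        then have "W i \<subseteq> R h" using sub by (auto simp: W_def)
        then have "prob (W i) \<le> prob (R h)" using R h(1) by (intro finite_measure_mono) auto
        then show ?thesis using s[OF h(1)] mR by simp
      qed
      ultimately show ?thesis by (intro LIMSEQ_le_const2[of "\<lambda>i. prob (W i)" "prob V" s]) auto
    qed
    ultimately show ?thesis using that V by (auto simp: R_def)
  next
    case True
    then obtain h0 where h0: "h0 \<in> C" "\<And>h. h \<in> C \<Longrightarrow> risk0 \<mu> h \<le> risk0 \<mu> h0" by blast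
    \<comment> \<open>The points beyond \<open>h0\<close>. Each single member of C adds only a null
      set to \<open>h0\<close>, but together they might have positive outer measure.\<close>
    define B where "B = (\<Union>h\<in>C. R h) - R h0"
    have Bs: "B \<subseteq> space \<mu>" by (auto simp: B_def R_def)
    obtain E0 where E0: "E0 \<in> sets \<mu>" "B \<subseteq> E0" "outer_measure_of \<mu> B = emeasure \<mu> E0"
      using outer_measure_of_attain[OF Bs] by blast
    define E where "E = E0 - R h0"
    have E: "E \<in> sets \<mu>" "B \<subseteq> E" using E0 R[OF h0(1)] by (auto simp: E_def B_def)
    have least: "emeasure \<mu> E \<le> emeasure \<mu> A" if "A \<in> sets \<mu>" "B \<subseteq> A" for A
    proof -
      have "emeasure \<mu> E \<le> emeasure \<mu> E0" using E0(1) by (intro emeasure_mono) (auto simp: E_def)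
      also have "\<dots> \<le> outer_measure_of \<mu> A" unfolding E0(3)[symmetric] by (rule outer_measure_of_mono[OF that(2)])
      also have "\<dots> = emeasure \<mu> A" using that(1) by simp
      finally show ?thesis .
    qed
    have "emeasure \<mu> E = 0"
    proof (rule ccontr)
      assume nz: "emeasure \<mu> E \<noteq> 0"
      \<comment> \<open>\<open>E\<close> is a measurable cover of \<open>B\<close>, so under the
        uniform distribution on \<open>E\<close> the set \<open>B\<close> has outer measure
        1.\<close>
      define \<nu> where "\<nu> = uniform_measure \<mu> E"
      have \<nu>p: "prob_space \<nu>" unfolding \<nu>_def by (rule prob_space_uniform_measure) (use nz in auto)
      have \<nu>: "\<nu> \<in> distributions M" using \<nu>p distributionsD(2)[OF \<mu>] by (simp add: distributions_def \<nu>_def)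
      have full: "emeasure \<nu> A = 1" if A: "A \<in> sets \<nu>" "B \<subseteq> A" for A
      proof -
        have "A \<in> sets \<mu>" using A by (simp add: \<nu>_def)
        then have "emeasure \<mu> E = emeasure \<mu> (E \<inter> A)"
          using least[of "E \<inter> A"] A(2) E emeasure_mono[of "E \<inter> A" E \<mu>] by (intro antisym) auto
        then show ?thesis using \<open>A \<in> sets \<mu>\<close> E nz by (simp add: \<nu>_def ennreal_divide_self less_top[symmetric])
      qed
      obtain A where A: "A \<in> sets (iid m \<nu>)" "emeasure (iid m \<nu>) A \<le> ennreal \<delta>"
        "\<And>S. S\<in>space (iid m \<nu>) - A \<Longrightarrow> \<forall>h\<in>H. risk_deviation m \<nu> S h \<le> \<epsilon>"
        using uc(1) \<nu> unfolding uniformly_close_def by blast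
      have m: "1 \<le> m" using uc(1) by (simp add: uniformly_close_def)
      \<comment> \<open>An event of probability at most \<delta> < 1 cannot contain all samples from
        \<open>B\<close>. For a sample outside of it, the m points lie in one member of the chain,
        whose empirical risk is 1 and whose risk is 0; this contradicts \<epsilon> < 1.\<close>
      have "\<not> PiE {..<m} (\<lambda>_. B) \<subseteq> A"
      proof
        assume "PiE {..<m} (\<lambda>_. B) \<subseteq> A"
        moreover have "B \<subseteq> space \<nu>" using Bs by (simp add: \<nu>_def)
        ultimately have "emeasure (iid m \<nu>) A = 1" using emeasure_PiM_full_outer[OF \<nu>p _ full A(1)] by blast
        then show False using A(2) uc(3) by (simp add: ennreal_1[symmetric] ennreal_le_iff2 del: ennreal_1)
      qed
      then obtain S where S: "S \<in> PiE {..<m} (\<lambda>_. B)" "S \<notin> A" by blast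
      then have Ssp: "S \<in> space (iid m \<nu>) - A" using Bs by (auto simp: space_PiM PiE_iff \<nu>_def)
      have SB: "S i \<in> B" if "i < m" for i using S(1) that by (auto simp: PiE_iff)
      have "\<forall>i\<in>{..<m}. \<exists>h\<in>C. S i \<in> R h" using SB by (auto simp: B_def)
      then obtain f where f: "\<And>i. i < m \<Longrightarrow> f i \<in> C" "\<And>i. i < m \<Longrightarrow> S i \<in> R (f i)"
        by (metis lessThan_iff)
      have "finite (f ` {..<m})" "f ` {..<m} \<subseteq> C" using f(1) by auto
      then obtain h where h: "h \<in> C" "\<forall>g\<in>f ` {..<m}. sub_on M g h"
        by (rule finite_chain_upper[OF _ _ C(2) chain]) blast
      have hS: "S i \<in> R h" if "i < m" for i using f(2)[OF that] h(2) sub that by auto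
      have "S 0 \<notin> R h0" using SB[of 0] m by (auto simp: B_def)
      then have "\<not> R h \<subseteq> R h0" using hS[of 0] m by auto
      then have h0h: "R h0 \<subseteq> R h" using chain[OF h(1) h0(1)] sub by blast
      have "prob (R h - R h0) = prob (R h) - prob (R h0)"
        using h0h R h(1) h0(1) by (intro finite_measure_Diff) auto
      then have "prob (R h - R h0) = 0" using h0(2)[OF h(1)] mR measure_nonneg[of \<mu> "R h - R h0"] by simp
      moreover have "prob (E \<inter> R h) \<le> prob (R h - R h0)"
        using R h(1) h0(1) by (intro finite_measure_mono) (auto simp: E_def)
      ultimately have 0: "prob (E \<inter> R h) = 0" using measure_nonneg[of \<mu> "E \<inter> R h"] by linarith
      have "risk0 \<nu> h = measure \<nu> (R h)" by (simp add: risk0_def R_def \<nu>_def)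
      also have "\<dots> = prob (E \<inter> R h) / prob E"
        unfolding \<nu>_def by (rule measure_uniform_measure) (use nz R h(1) in auto)
      finally have "risk0 \<nu> h = 0" using 0 by simp
      moreover have "emp_risk0 m S h = 1"
      proof -
        have "(\<Sum>i<m. of_bool (h (S i)) :: real) = (\<Sum>i<m. 1)" using hS by (intro sum.cong) (auto simp: R_def)
        then show ?thesis using m by (simp add: emp_risk0_def)
      qed
      ultimately show False using A(3)[OF Ssp] h(1) C(1) uc(2) by force
    qed
    then have E0': "prob E = 0" by (simp add: measure_def)
    have "R h0 \<union> E \<in> sets \<mu>" using R[OF h0(1)] E by auto
    moreover have "R h \<subseteq> R h0 \<union> E" if "h \<in> C" for h using that E(2) by (auto simp: B_def)
    moreover have "prob (R h0 \<union> E) \<le> s"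
      using measure_Un_le[OF R[OF h0(1)] E(1)] E0' mR s[OF h0(1)] by simp
    ultimately show ?thesis using that by (auto simp: R_def)
  qed
qed

text \<open>One event serves the whole chain: V from \<open>chain_union_measure\<close> covers all
  members, yet the part of g outside V has mass at least t. A single sample point in that part
  refutes all of C at once, in place of a union bound.\<close>

lemma chain_undetected:
  assumes hc: "hypothesis_class M H" and uc: "uniformly_close M H \<epsilon> \<delta> m" "\<epsilon> < 1" "\<delta> < 1"
    and \<mu>: "\<mu> \<in> distributions M" and g: "g \<in> H" and t: "0 \<le> t"
    and C: "C \<subseteq> H" and chain: "\<And>h h'. h \<in> C \<Longrightarrow> h' \<in> C \<Longrightarrow> sub_on M h h' \<or> sub_on M h' h"
    and C_risk: "\<And>h. h \<in> C \<Longrightarrow> risk0 \<mu> h \<le> risk0 \<mu> g - t"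
  obtains E where "E \<in> sets (iid n \<mu>)" "emeasure (iid n \<mu>) E \<le> ennreal (exp (- real n * t))"
    "\<forall>S\<in>space (iid n \<mu>) - E. \<forall>h\<in>C. \<exists>i<n. g (S i) \<and> \<not> h (S i)"
proof (cases "C = {}")
  case True
  then show ?thesis using that[of "{}"] by simp
next
  case False
  interpret prob_space \<mu> using distributionsD[OF \<mu>] by simp
  interpret product_sigma_finite "\<lambda>_. \<mu>" by unfold_locales
  obtain V where V: "V \<in> sets \<mu>" "\<forall>h\<in>C. {x\<in>space \<mu>. h x} \<subseteq> V" "prob V \<le> risk0 \<mu> g - t"
    by (rule chain_union_measure[OF hc uc \<mu> C False chain C_risk]) blast
  let ?g = "{x\<in>space \<mu>. g x}"
  have gs: "?g \<in> sets \<mu>" by (rule hypothesis_sets[OF hc g \<mu>])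
  define D where "D = space \<mu> - (?g - V)"
  have D: "D \<in> sets \<mu>" using gs V by (auto simp: D_def)
  have "risk0 \<mu> g \<le> prob (?g - V) + prob V"
  proof -
    have "prob ?g \<le> prob ((?g - V) \<union> V)" using gs V by (intro finite_measure_mono) auto
    also have "\<dots> \<le> prob (?g - V) + prob V" using gs V by (intro measure_Un_le) auto
    finally show ?thesis by (simp add: risk0_def)
  qed
  then have "prob D \<le> 1 - t" using V gs by (simp add: D_def prob_compl)
  also have "\<dots> \<le> exp (- t)" using exp_ge_add_one_self[of "- t"] by simp
  finally have pD: "prob D \<le> exp (- t)" .
  let ?E = "PiE {..<n} (\<lambda>_. D)"
  have "?E \<in> sets (iid n \<mu>)" using D by (intro sets_PiM_I_finite) auto
  moreover have "emeasure (iid n \<mu>) ?E \<le> ennreal (exp (- real n * t))"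
  proof -
    have "emeasure (iid n \<mu>) ?E = (\<Prod>i<n. emeasure \<mu> D)" using D by (intro emeasure_PiM) auto
    also have "\<dots> = ennreal (prob D ^ n)" by (simp add: emeasure_eq_measure ennreal_power)
    also have "\<dots> \<le> ennreal (exp (- t) ^ n)" using pD by (intro ennreal_leI power_mono) auto
    also have "exp (- t) ^ n = exp (- real n * t)" by (simp add: exp_of_nat_mult[symmetric])
    finally show ?thesis .
  qed
  moreover have "\<exists>i<n. g (S i) \<and> \<not> h (S i)" if S: "S \<in> space (iid n \<mu>) - ?E" and h: "h \<in> C" for S h
  proof -
    obtain i where i: "i < n" "S i \<in> space \<mu>" "S i \<notin> D" using S by (auto simp: space_PiM PiE_iff)
    then have "g (S i)" "S i \<notin> V" by (auto simp: D_def)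
    then show ?thesis using bspec[OF V(2) h] i by blast
  qed
  then have "\<forall>S\<in>space (iid n \<mu>) - ?E. \<forall>h\<in>C. \<exists>i<n. g (S i) \<and> \<not> h (S i)" by blast
  ultimately show ?thesis by (rule that)
qed

text \<open>Compare the output with a nearly optimal g. By nestedness it either contains g, and then
  is no worse, or lies below g; if it missed mass t there, a sample point would show it and the
  empirical maximizer would not have been chosen.\<close>

lemma minimax_risk_le_fast_rate:
  assumes ns: "\<not> separates_three_points M H" and hc: "hypothesis_class M H" and H: "H \<noteq> {}"
    and uc: "uniformly_close M H (\<epsilon> / 2) \<delta> n0" and \<delta>: "0 \<le> \<delta>" "\<delta> < 1"
    and \<alpha>: "0 \<le> \<alpha>" "0 \<le> \<epsilon>" "\<alpha> + \<epsilon> < 1/2" and n: "2 \<le> n"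
  shows "minimax_risk M H \<alpha> \<epsilon> \<delta> n0 n \<le> ennreal ((ln (real n) + 2) / real n + \<delta>)"
proof -
  let ?L = "erm H (\<alpha> + \<epsilon> / 2) n0 n"
  note sel = erm_props(1)[OF H, of M "\<alpha> + \<epsilon> / 2" n0 n]
  have \<epsilon>: "\<epsilon> / 2 < 1" using \<alpha> by simp
  \<comment> \<open>This t makes the failure probability exp (- n t) equal to 1 / n. Another 1 / n
    is paid for g, because the infimum need not be attained.\<close>
  define t where "t = ln (real n) / real n"
  have t: "0 \<le> t" using n by (simp add: t_def)
  show ?thesis
  proof (rule minimax_risk_le[OF emp_selector_approx_learner[OF uc \<delta>(1) sel]])
    fix \<mu>0 \<mu>1 assume adm: "(\<mu>0, \<mu>1) \<in> admissible_pairs M H \<alpha>"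
    note \<mu> = admissible_pairsD[OF adm]
    let ?t = "truncated_excess H \<alpha> \<epsilon> \<mu>0 \<mu>1"
    interpret \<mu>0: prob_space \<mu>0 using distributionsD[OF \<mu>(1)] by simp
    interpret \<mu>1: prob_space \<mu>1 using distributionsD[OF \<mu>(2)] by simp
    interpret P1: prob_space "iid n \<mu>1" by (rule prob_space_iid[OF \<mu>(2)])
    obtain A where A: "A\<in>sets (iid n0 \<mu>0)" "emeasure (iid n0 \<mu>0) A \<le> ennreal \<delta>"
      "\<And>S. S\<in>space (iid n0 \<mu>0) - A \<Longrightarrow> \<forall>h\<in>H. risk_deviation n0 \<mu>0 S h \<le> \<epsilon> / 2"
      using uc \<mu>(1) unfolding uniformly_close_def by blast
    let ?I = "INF h'\<in>level_class H \<alpha> \<mu>0. risk1 \<mu>1 h'"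
    have bdd: "bdd_below (risk1 \<mu>1 ` level_class H \<alpha> \<mu>0)"
      using risk1_bounds(1)[OF \<mu>(2)] by (auto intro!: bdd_belowI2)
    have "\<exists>g\<in>level_class H \<alpha> \<mu>0. risk1 \<mu>1 g < ?I + 1 / real n"
      using cINF_less_iff[OF \<mu>(3) bdd, of "?I + 1 / real n"] n by simp
    then obtain g where g: "g \<in> level_class H \<alpha> \<mu>0" "risk1 \<mu>1 g < ?I + 1 / real n" by blast
    have gH: "g \<in> H" "risk0 \<mu>0 g \<le> \<alpha>" using g(1) by (auto simp: level_class_def)
    \<comment> \<open>A zero of g is a zero of every hypothesis below g, which makes
      \<open>C\<close> a chain although its members are drawn from all of H.\<close>
    obtain x0 where x0: "x0 \<in> space M" "\<not> g x0"
    proof (rule ccontr)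
      assume "\<not> thesis"
      then have "\<forall>x\<in>space M. g x" using that by blast
      then have "{x\<in>space \<mu>0. g x} = space \<mu>0" using distributionsD(3)[OF \<mu>(1)] by auto
      then have "risk0 \<mu>0 g = 1" by (simp add: risk0_def \<mu>0.prob_space)
      then show False using gH(2) \<alpha> by simp
    qed
    define C where "C = {h\<in>H. sub_on M h g \<and> risk0 \<mu>1 h \<le> risk0 \<mu>1 g - t}"
    have C: "C \<subseteq> H" "\<And>h. h \<in> C \<Longrightarrow> risk0 \<mu>1 h \<le> risk0 \<mu>1 g - t" by (auto simp: C_def)
    have chain: "sub_on M h h' \<or> sub_on M h' h" if "h \<in> C" "h' \<in> C" for h h'
      using that x0 by (intro nested_if_common_zero[OF ns _ _ x0(1)]) (auto simp: C_def sub_on_def)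
    obtain E where E: "E \<in> sets (iid n \<mu>1)" "emeasure (iid n \<mu>1) E \<le> ennreal (exp (- real n * t))"
      "\<forall>S\<in>space (iid n \<mu>1) - E. \<forall>h\<in>C. \<exists>i<n. g (S i) \<and> \<not> h (S i)"
      by (rule chain_undetected[OF hc uc \<epsilon> \<delta>(2) \<mu>(2) gH(1) t C(1) chain C(2), where n = n]) blast
    have exp: "exp (- real n * t) = 1 / real n"
      using n by (simp add: t_def exp_minus inverse_eq_divide)
    show "outer_expectation (sample_pair n0 n \<mu>0 \<mu>1) (\<lambda>S. ?t (?L S))
        \<le> ennreal ((ln (real n) + 2) / real n + \<delta>)"
    proof (rule outer_expectation_truncated_le[OF adm A(1,2) \<delta>(1)])
      let ?G = "\<lambda>S. ennreal (t + 1 / real n) + indicator E S"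
      show "?G \<in> borel_measurable (iid n \<mu>1)" using E(1) by measurable
      show "0 \<le> (ln (real n) + 2) / real n" using n by simp
      have "(\<integral>\<^sup>+S. ?G S \<partial>iid n \<mu>1) = ennreal (t + 1 / real n) + emeasure (iid n \<mu>1) E"
        using E(1) by (subst nn_integral_add) (auto simp: P1.emeasure_space_1)
      also have "\<dots> \<le> ennreal (t + 1 / real n) + ennreal (1 / real n)"
        using E(2) unfolding exp by (rule add_left_mono)
      also have "\<dots> = ennreal ((ln (real n) + 2) / real n)"
        using t n by (subst ennreal_plus[symmetric]) (auto simp: t_def add_divide_distrib)
      finally show "(\<integral>\<^sup>+S. ?G S \<partial>iid n \<mu>1) \<le> ennreal ((ln (real n) + 2) / real n)" .
      fix S0 S1 assume S: "S0 \<in> space (iid n0 \<mu>0) - A" "S1 \<in> space (iid n \<mu>1)"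
      let ?h = "?L (S0, S1)"
      have SM: "S0 \<in> space (iid n0 M)" "S1 \<in> space (iid n M)"
        using S space_iid_distributions[OF \<mu>(1)] space_iid_distributions[OF \<mu>(2)] by auto
      note sw = emp_class_sandwich[OF A(3)[OF S(1)], of \<alpha>]
      have ge: "g \<in> emp_class H (\<alpha> + \<epsilon> / 2) n0 S0" using sw(1) g(1) by blast
      then have he: "?h \<in> emp_class H (\<alpha> + \<epsilon> / 2) n0 S0" using sel SM unfolding emp_selector_def by blast
      then have hH: "?h \<in> H" by (simp add: emp_class_def)
      show "ennreal (?t ?h) \<le> ?G S1"
      proof (cases "S1 \<in> E")
        case True
        have "ennreal (?t ?h) \<le> 1"
          using truncated_excess_bounds(3)[OF adm] by (simp add: ennreal_le_1)
        then show ?thesis using True by (simp add: add_increasing)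
      next
        case False
        have "risk1 \<mu>1 ?h \<le> risk1 \<mu>1 g + t"
        proof -
          have nest: "sub_on M g ?h \<or> sub_on M ?h g"
            using level_class_nested[OF ns hc \<mu>(1) \<alpha>(3)] sw(2) ge he by blast
          show ?thesis
          proof (cases "sub_on M g ?h")
            case True
            then have "risk0 \<mu>1 g \<le> risk0 \<mu>1 ?h"
              unfolding risk0_def using hypothesis_sets[OF hc hH \<mu>(2)] distributionsD(3)[OF \<mu>(2)]
              by (intro \<mu>1.finite_measure_mono) (auto simp: sub_on_def)
            then show ?thesis using t by (simp add: risk1_eq[OF hc _ \<mu>(2)] hH gH)
          next
            case gh: False
            then have hg: "sub_on M ?h g" using nest by blast
            \<comment> \<open>A member of \<open>C\<close> misses a sample point of g and, lying
              below g, gains none elsewhere, against the maximality of its count.\<close>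
            have "?h \<notin> C"
            proof
              assume "?h \<in> C"
              then obtain i where i: "i < n" "g (S1 i)" "\<not> ?h (S1 i)" using E(3) S(2) False by blast
              have "(\<Sum>i<n. of_bool (?h (S1 i)) :: real) < (\<Sum>i<n. of_bool (g (S1 i)))"
              proof (rule sum_strict_mono_ex1)
                show "\<forall>i\<in>{..<n}. (of_bool (?h (S1 i)) :: real) \<le> of_bool (g (S1 i))"
                  using hg SM(2) by (auto simp: sub_on_def space_PiM PiE_iff)
                show "\<exists>i\<in>{..<n}. (of_bool (?h (S1 i)) :: real) < of_bool (g (S1 i))"
                  using i by (intro bexI[of _ i]) auto
              qed simp
              then have "emp_risk0 n S1 ?h < emp_risk0 n S1 g"
                using n by (simp add: emp_risk0_def divide_strict_right_mono)
              moreover have "emp_risk0 n S1 g \<le> emp_risk0 n S1 ?h" by (rule erm_props(2)[OF H ge])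
              ultimately show False by simp
            qed
            then have "risk0 \<mu>1 ?h > risk0 \<mu>1 g - t" using hH hg by (simp add: C_def)
            then show ?thesis by (simp add: risk1_eq[OF hc _ \<mu>(2)] hH gH)
          qed
        qed
        then have "excess_risk H \<alpha> \<mu>0 \<mu>1 ?h \<le> t + 1 / real n"
          using g(2) t by (auto simp: excess_risk_def)
        then have "?t ?h \<le> t + 1 / real n"
          using truncated_excess_bounds(2)[OF adm] by (rule order_trans[rotated])
        then have "ennreal (?t ?h) \<le> ennreal (t + 1 / real n)" by (rule ennreal_leI)
        then show ?thesis using False by simp
      qed
    qed
  qed
qed

section \<open>Assouad's method\<close>

text \<open>The overlap is 1 minus half the L1 distance. Pointwise, the arithmetic-geometric mean
  inequality gives \<bar>P - Q\<bar> \<le> P / 4 + (P - Q)^2 / P, and summing leaves 1/4 plus a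
  chi-square distance of at most 1/4.\<close>

lemma sum_min_ge_chi_square:
  fixes P Q :: "'s \<Rightarrow> real"
  assumes "\<And>s. s \<in> S \<Longrightarrow> 0 < P s" "(\<Sum>s\<in>S. P s) = 1" "(\<Sum>s\<in>S. Q s) = 1"
    and "(\<Sum>s\<in>S. (Q s)\<^sup>2 / P s) \<le> 5 / 4"
  shows "3 / 4 \<le> (\<Sum>s\<in>S. min (P s) (Q s))"
proof -
  have "P s + Q s - (P s / 4 + (P s - 2 * Q s + (Q s)\<^sup>2 / P s)) \<le> 2 * min (P s) (Q s)" if "s \<in> S" for s
  proof -
    have P: "0 < P s" using assms(1) that by simp
    have "\<bar>P s - Q s\<bar> \<le> P s / 4 + (P s - Q s)\<^sup>2 / P s"
    proof -
      have "0 \<le> (P s / 2 - \<bar>P s - Q s\<bar>)\<^sup>2 / P s" using P by simp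
      also have "(P s / 2 - \<bar>P s - Q s\<bar>)\<^sup>2 = (P s)\<^sup>2 / 4 - P s * \<bar>P s - Q s\<bar> + (P s - Q s)\<^sup>2"
        by (simp add: power2_diff power_divide)
      also have "\<dots> / P s = P s / 4 - \<bar>P s - Q s\<bar> + (P s - Q s)\<^sup>2 / P s"
        using P by (simp add: add_divide_distrib diff_divide_distrib power2_eq_square)
      finally show ?thesis by simp
    qed
    also have "(P s - Q s)\<^sup>2 / P s = P s - 2 * Q s + (Q s)\<^sup>2 / P s"
      using P by (simp add: power2_diff add_divide_distrib diff_divide_distrib) (simp add: power2_eq_square)
    finally show ?thesis by (auto simp: min_def abs_if split: if_splits)
  qed
  then have "(\<Sum>s\<in>S. P s + Q s - (P s / 4 + (P s - 2 * Q s + (Q s)\<^sup>2 / P s))) \<le> (\<Sum>s\<in>S. 2 * min (P s) (Q s))"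
    by (rule sum_mono)
  also have "\<dots> = 2 * (\<Sum>s\<in>S. min (P s) (Q s))" by (simp add: sum_distrib_left)
  also have "(\<Sum>s\<in>S. P s + Q s - (P s / 4 + (P s - 2 * Q s + (Q s)\<^sup>2 / P s)))
      = (\<Sum>s\<in>S. P s) + (\<Sum>s\<in>S. Q s) - ((\<Sum>s\<in>S. P s) / 4 + ((\<Sum>s\<in>S. P s) - 2 * (\<Sum>s\<in>S. Q s) + (\<Sum>s\<in>S. (Q s)\<^sup>2 / P s)))"
    by (simp only: sum.distrib sum_subtractf sum_distrib_left[symmetric] sum_divide_distrib[symmetric])
  finally show ?thesis using assms by simp
qed

section \<open>A hypercube of distributions on k pairs of points\<close>

definition flip :: "nat \<Rightarrow> nat set \<Rightarrow> nat set" where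
  "flip i s = (if i \<in> s then s - {i} else insert i s)"

lemma sum_Pow_flip:
  assumes "i < k"
  shows "(\<Sum>s\<in>Pow {..<k}. f (flip i s)) = (\<Sum>s\<in>Pow {..<k}. f s)"
  by (rule sum.reindex_bij_witness[where i = "flip i" and j = "flip i"])
     (use assms in \<open>auto simp: flip_def\<close>)

definition pairs :: "nat \<Rightarrow> (nat \<times> bool) set" where
  "pairs k = {..<k} \<times> UNIV"

lemma finite_pairs [simp]: "finite (pairs k)" by (simp add: pairs_def)

text \<open>The orientation b is free: a constant suits \<mu>0, while membership in the parameter
  set puts the heavier point of \<mu>1 first.\<close>

lemma sum_pairs: "(\<Sum>p\<in>pairs k. f p) = (\<Sum>i<k. f (i, b i) + f (i, \<not> b i))"
proof -
  have "(\<Sum>p\<in>pairs k. f p) = (\<Sum>i<k. \<Sum>c\<in>UNIV. f (i, c))"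
    unfolding pairs_def by (simp add: sum.cartesian_product)
  also have "\<dots> = (\<Sum>i<k. f (i, b i) + f (i, \<not> b i))"
  proof (rule sum.cong[OF refl])
    show "(\<Sum>c\<in>UNIV. f (i, c)) = f (i, b i) + f (i, \<not> b i)" for i
      by (cases "b i") (simp_all add: UNIV_bool add.commute)
  qed
  finally show ?thesis .
qed

text \<open>\<mu>0 of the lower bound. For \<tau> = 0, a hypothesis taking one point of each pair
  and avoiding the reserve point \<open>(k, True)\<close> has risk exactly \<alpha>, and each
  further point costs \<alpha> / k. The perturbation \<tau> makes the \<open>False\<close> points
  dearer.\<close>

definition null_weight :: "nat \<Rightarrow> real \<Rightarrow> real \<Rightarrow> nat \<times> bool \<Rightarrow> real" where
  "null_weight k \<alpha> \<tau> p = (if fst p < k then \<alpha> / k + (if snd p then 0 else \<tau>) else 1 - 2 * \<alpha> - k * \<tau>)"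

text \<open>\<mu>1 of the lower bound. Every pair has mass 1 / k, tilted by e towards the point
  \<open>(i, i \<in> s)\<close>.\<close>

definition alt_weight :: "nat \<Rightarrow> real \<Rightarrow> nat set \<Rightarrow> nat \<times> bool \<Rightarrow> real" where
  "alt_weight k e s p = (if (fst p \<in> s) = snd p then 1 + e else 1 - e) / (2 * k)"

abbreviation "null_index k \<equiv> insert (k, True) (pairs k)"

lemma sum_null_index:
  "(\<Sum>p\<in>null_index k. f p) = f (k, True) + (\<Sum>p\<in>pairs k. f p)"
  by (subst sum.insert) (auto simp: pairs_def)

lemma weights_null:
  fixes \<alpha> \<tau> :: real
  assumes "1 \<le> k" "0 \<le> \<alpha>" "0 \<le> \<tau>" "k * \<tau> \<le> 1 - 2 * \<alpha>"
  shows "weights (null_index k) (null_weight k \<alpha> \<tau>)"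
  unfolding weights_def
proof (intro conjI ballI)
  show "0 \<le> null_weight k \<alpha> \<tau> p" if "p \<in> null_index k" for p
    using assms by (auto simp: null_weight_def)
  have "(\<Sum>p\<in>pairs k. null_weight k \<alpha> \<tau> p) = (\<Sum>i<k. 2 * (\<alpha> / k) + \<tau>)"
    unfolding sum_pairs[where b = "\<lambda>_. True"] by (intro sum.cong) (auto simp: null_weight_def)
  also have "\<dots> = 2 * \<alpha> + k * \<tau>" using assms by (simp add: field_simps)
  finally show "(\<Sum>p\<in>null_index k. null_weight k \<alpha> \<tau> p) = 1"
    unfolding sum_null_index by (simp add: null_weight_def)
qed simp

lemma weights_alt:
  assumes "1 \<le> k" "0 \<le> e" "e \<le> 1"
  shows "weights (pairs k) (alt_weight k e s)"
  unfolding weights_def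
proof (intro conjI ballI)
  show "0 \<le> alt_weight k e s p" for p using assms by (auto simp: alt_weight_def)
  have "(\<Sum>p\<in>pairs k. alt_weight k e s p) = (\<Sum>i<k. 1 / real k)"
    unfolding sum_pairs[where b = "\<lambda>i. i \<in> s"]
    by (intro sum.cong refl) (simp add: alt_weight_def add_divide_distrib[symmetric])
  then show "(\<Sum>p\<in>pairs k. alt_weight k e s p) = 1" using assms by simp
qed simp

text \<open>The sum is 1 plus a chi-square distance. Pairs other than the i-th are unchanged and
  contribute 1 / k each; pair i contributes (1 + 3 e^2) / (1 - e^2) / k, which e^2 \<le> 1/4 bounds
  by (1 + 6 e^2) / k.\<close>

lemma chi_square_flip:
  assumes k: "1 \<le> k" and i: "i < k" and e: "0 \<le> e" "e \<le> 1 / 2"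
  shows "(\<Sum>p\<in>pairs k. (alt_weight k e (flip i s) p)\<^sup>2 / alt_weight k e s p) \<le> 1 + 6 * e\<^sup>2 / k"
proof -
  have e2: "e\<^sup>2 \<le> 1 / 4" using e power_mono[of e "1/2" 2] by (simp add: power2_eq_square)
  let ?f = "\<lambda>p. (alt_weight k e (flip i s) p)\<^sup>2 / alt_weight k e s p"
  have tm: "?f (j, j \<in> s) + ?f (j, j \<notin> s) \<le> 1 / k + (if j = i then 6 * e\<^sup>2 / k else 0)" if "j < k" for j
  proof (cases "j = i")
    case False
    then have "(j \<in> flip i s) = (j \<in> s)" by (auto simp: flip_def)
    then have "alt_weight k e (flip i s) (j, c) = alt_weight k e s (j, c)" for c
      by (simp add: alt_weight_def)
    then have f: "?f (j, c) = alt_weight k e s (j, c)" for c by (simp add: power2_eq_square)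
    have "?f (j, j \<in> s) + ?f (j, j \<notin> s) = (1 + e) / (2 * k) + (1 - e) / (2 * k)"
      unfolding f by (simp add: alt_weight_def)
    then show ?thesis using False by (simp add: add_divide_distrib[symmetric])
  next
    case True
    then have "(j \<in> flip i s) = (j \<notin> s)" by (auto simp: flip_def)
    then have "?f (j, j \<in> s) + ?f (j, j \<notin> s)
        = ((1 - e) / (2 * k))\<^sup>2 / ((1 + e) / (2 * k)) + ((1 + e) / (2 * k))\<^sup>2 / ((1 - e) / (2 * k))"
      by (simp add: alt_weight_def)
    also have "\<dots> = ((1 - e)\<^sup>2 / (1 + e) + (1 + e)\<^sup>2 / (1 - e)) / (2 * k)"
    proof -
      have q: "(x / c)\<^sup>2 / (y / c) = x\<^sup>2 / y / c" if "c \<noteq> 0" for x y c :: real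
        using that by (simp add: power2_eq_square)
      have c: "real (2 * k) \<noteq> 0" using k by simp
      show ?thesis unfolding q[OF c] by (rule add_divide_distrib[symmetric])
    qed
    also have "(1 - e)\<^sup>2 / (1 + e) + (1 + e)\<^sup>2 / (1 - e) = ((1 - e)^3 + (1 + e)^3) / ((1 + e) * (1 - e))"
      using e by (simp add: add_frac_eq power2_eq_square power3_eq_cube mult.commute)
    also have "(1 - e)^3 + (1 + e)^3 = 2 + 6 * e\<^sup>2"
      by (simp add: power2_eq_square power3_eq_cube algebra_simps)
    also have "(1 + e) * (1 - e) = 1 - e\<^sup>2" by (simp add: power2_eq_square algebra_simps)
    also have "(2 + 6 * e\<^sup>2) / (1 - e\<^sup>2) \<le> 2 * (1 + 6 * e\<^sup>2)"
    proof -
      have "e\<^sup>2 * e\<^sup>2 \<le> e\<^sup>2 * (1 / 4)" using e2 by (intro mult_left_mono) auto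
      moreover have "2 + 6 * z \<le> 2 * (1 + 6 * z) * (1 - z)" if "0 \<le> z" "z * z \<le> z * (1 / 4)" for z :: real
        using that by (simp add: algebra_simps)
      ultimately have "2 + 6 * e\<^sup>2 \<le> 2 * (1 + 6 * e\<^sup>2) * (1 - e\<^sup>2)" by simp
      then show ?thesis using e2 by (simp add: pos_divide_le_eq)
    qed
    finally show ?thesis using True k by (simp add: divide_right_mono add_divide_distrib)
  qed
  have "(\<Sum>p\<in>pairs k. ?f p) \<le> (\<Sum>j<k. 1 / real k + (if j = i then 6 * e\<^sup>2 / k else 0))"
    unfolding sum_pairs[where b = "\<lambda>j. j \<in> s"] by (intro sum_mono tm) auto
  also have "\<dots> = 1 + 6 * e\<^sup>2 / k" using k i by (simp add: sum.distrib)
  finally show ?thesis .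
qed

text \<open>One plus chi-square is multiplicative over independent observations, and the first
  sample, with the same law on both sides, contributes the factor 1. The choice of e bounds the
  factor per observation by 1 + 1 / (6 n), so the product is at most exp (1/6) \<le> 5/4.\<close>

lemma sum_min_flip_ge:
  assumes k: "1 \<le> k" "k \<le> n" and i: "i < k" and e: "e = sqrt (real k / real n) / 6"
    and w0: "finite I0" "\<And>p. p \<in> I0 \<Longrightarrow> 0 < w0 p" "(\<Sum>p\<in>I0. w0 p) = 1"
  shows "3 / 4 \<le> (\<Sum>s\<in>pair_index n0 n I0 (pairs k).
     min (pair_weight n0 n w0 (alt_weight k e \<sigma>) s) (pair_weight n0 n w0 (alt_weight k e (flip i \<sigma>)) s))"
proof (rule sum_min_ge_chi_square)
  have "real k / real n \<le> 1" using k by simp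
  then have e1: "0 \<le> e" "e \<le> 1 / 6" by (auto simp: e)
  have e2: "e\<^sup>2 = real k / (36 * real n)" by (simp add: e power_divide)
  have a: "0 < alt_weight k e \<sigma> p" for \<sigma> p using e1 k by (auto simp: alt_weight_def)
  show "0 < pair_weight n0 n w0 (alt_weight k e \<sigma>) s" if "s \<in> pair_index n0 n I0 (pairs k)" for s
    unfolding pair_weight_def
  proof (intro mult_pos_pos prod_pos ballI a)
    show "0 < w0 (fst s j)" if "j \<in> {..<n0}" for j
      using that \<open>s \<in> _\<close> by (intro w0(2)) (auto simp: pair_index_def PiE_iff)
  qed
  have one: "(\<Sum>p\<in>pairs k. alt_weight k e \<sigma> p) = 1" for \<sigma>
    using weights_alt[of k e \<sigma>] k e1 by (simp add: weights_def)
  show "(\<Sum>s\<in>pair_index n0 n I0 (pairs k). pair_weight n0 n w0 (alt_weight k e \<sigma>) s) = 1"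
    "(\<Sum>s\<in>pair_index n0 n I0 (pairs k). pair_weight n0 n w0 (alt_weight k e (flip i \<sigma>)) s) = 1"
    using w0 one by (simp_all add: sum_pair_weight)
  let ?q = "\<lambda>p. (alt_weight k e (flip i \<sigma>) p)\<^sup>2 / alt_weight k e \<sigma> p"
  have "(\<Sum>s\<in>pair_index n0 n I0 (pairs k). (pair_weight n0 n w0 (alt_weight k e (flip i \<sigma>)) s)\<^sup>2 / pair_weight n0 n w0 (alt_weight k e \<sigma>) s)
      = (\<Sum>s\<in>pair_index n0 n I0 (pairs k). pair_weight n0 n w0 ?q s)"
  proof (rule sum.cong[OF refl])
    fix s assume "s \<in> pair_index n0 n I0 (pairs k)"
    then have "0 < (\<Prod>j<n0. w0 (fst s j))" using w0(2) by (auto simp: pair_index_def PiE_iff intro!: prod_pos)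
    then show "(pair_weight n0 n w0 (alt_weight k e (flip i \<sigma>)) s)\<^sup>2 / pair_weight n0 n w0 (alt_weight k e \<sigma>) s
        = pair_weight n0 n w0 ?q s"
      unfolding pair_weight_def prod_dividef prod_power_distrib[symmetric]
      by (simp add: power2_eq_square)
  qed
  also have "\<dots> = (\<Sum>p\<in>pairs k. ?q p) ^ n" using w0 by (simp add: sum_pair_weight)
  also have "\<dots> \<le> (1 + 6 * e\<^sup>2 / k) ^ n"
    using a e1 k i by (intro power_mono chi_square_flip sum_nonneg) (auto intro: divide_nonneg_pos)
  also have "1 + 6 * e\<^sup>2 / k = 1 + 1 / (6 * real n)" using k by (simp add: e2)
  also have "(1 + 1 / (6 * real n)) ^ n \<le> exp (1 / (6 * real n)) ^ n"
    by (intro power_mono exp_ge_add_one_self) auto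
  also have "\<dots> = exp (1 / 6)" using k by (simp add: exp_of_nat_mult[symmetric])
  also have "\<dots> \<le> 5 / 4"
  proof -
    have "exp (1/6 :: real) \<le> 1 + 1/6 + (1/6)\<^sup>2" by (rule exp_bound) auto
    then show ?thesis by (simp add: power2_eq_square)
  qed
  finally show "(\<Sum>s\<in>pair_index n0 n I0 (pairs k). (pair_weight n0 n w0 (alt_weight k e (flip i \<sigma>)) s)\<^sup>2 / pair_weight n0 n w0 (alt_weight k e \<sigma>) s) \<le> 5 / 4" .
qed

text \<open>The success event g does not depend on \<sigma>, so an overlap of 3/4 and a success
  probability of 1/2 leave a common mass of 1/4, on which the losses of two neighbours add up to 2.
  Averaging over the cube gives at least 1/4 per coordinate, so some \<sigma> reaches k / 4.\<close>

lemma assouad: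
  fixes W :: "nat set \<Rightarrow> 's \<Rightarrow> real" and l :: "nat set \<Rightarrow> nat \<Rightarrow> 's \<Rightarrow> real"
  assumes fin: "finite S" and W: "\<And>\<sigma> s. s \<in> S \<Longrightarrow> 0 \<le> W \<sigma> s" "\<And>\<sigma>. (\<Sum>s\<in>S. W \<sigma> s) = 1"
    and l: "\<And>\<sigma> i s. 0 \<le> l \<sigma> i s" "\<And>\<sigma> i s. i < k \<Longrightarrow> l \<sigma> i s + l (flip i \<sigma>) i s = 2"
    and near: "\<And>\<sigma> i. i < k \<Longrightarrow> 3 / 4 \<le> (\<Sum>s\<in>S. min (W \<sigma> s) (W (flip i \<sigma>) s))"
    and good: "\<And>\<sigma>. \<sigma> \<subseteq> {..<k} \<Longrightarrow> 1 / 2 \<le> (\<Sum>s\<in>S. W \<sigma> s * of_bool (g s))"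
  shows "\<exists>\<sigma>\<subseteq>{..<k}. real k / 4 \<le> (\<Sum>s\<in>S. W \<sigma> s * of_bool (g s) * (\<Sum>i<k. l \<sigma> i s))"
proof -
  define a where "a i \<sigma> = (\<Sum>s\<in>S. W \<sigma> s * of_bool (g s) * l \<sigma> i s)" for i \<sigma>
  have 1: "1 / 2 \<le> a i \<sigma> + a i (flip i \<sigma>)" if i: "i < k" and \<sigma>: "\<sigma> \<subseteq> {..<k}" for i \<sigma>
  proof -
    have "1 / 2 \<le> 2 * ((\<Sum>s\<in>S. min (W \<sigma> s) (W (flip i \<sigma>) s)) + (\<Sum>s\<in>S. W \<sigma> s * of_bool (g s)) - (\<Sum>s\<in>S. W \<sigma> s))"
      using near[OF i, of \<sigma>] good[OF \<sigma>] W(2)[of \<sigma>] by simp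
    also have "\<dots> = (\<Sum>s\<in>S. 2 * (min (W \<sigma> s) (W (flip i \<sigma>) s) + W \<sigma> s * of_bool (g s) - W \<sigma> s))"
      by (simp add: sum_distrib_left[symmetric] sum.distrib sum_subtractf)
    also have "\<dots> \<le> (\<Sum>s\<in>S. W \<sigma> s * of_bool (g s) * l \<sigma> i s + W (flip i \<sigma>) s * of_bool (g s) * l (flip i \<sigma>) i s)"
    proof (rule sum_mono)
      fix s assume s: "s \<in> S"
      let ?m = "min (W \<sigma> s) (W (flip i \<sigma>) s)"
      show "2 * (?m + W \<sigma> s * of_bool (g s) - W \<sigma> s)
          \<le> W \<sigma> s * of_bool (g s) * l \<sigma> i s + W (flip i \<sigma>) s * of_bool (g s) * l (flip i \<sigma>) i s"
      proof (cases "g s")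
        case True
        have "2 * ?m = ?m * l \<sigma> i s + ?m * l (flip i \<sigma>) i s"
          using l(2)[OF i, of \<sigma> s] by (simp add: distrib_left[symmetric])
        also have "\<dots> \<le> W \<sigma> s * l \<sigma> i s + W (flip i \<sigma>) s * l (flip i \<sigma>) i s"
          using l(1) by (intro add_mono mult_right_mono) auto
        finally show ?thesis using True by simp
      qed simp
    qed
    also have "\<dots> = a i \<sigma> + a i (flip i \<sigma>)" by (simp add: a_def sum.distrib)
    finally show ?thesis .
  qed
  have 2: "2 ^ k / 4 \<le> (\<Sum>\<sigma>\<in>Pow {..<k}. a i \<sigma>)" if i: "i < k" for i
  proof -
    have "2 ^ k / 2 = (\<Sum>\<sigma>\<in>Pow {..<k}. 1 / 2 :: real)" by (simp add: card_Pow)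
    also have "\<dots> \<le> (\<Sum>\<sigma>\<in>Pow {..<k}. a i \<sigma> + a i (flip i \<sigma>))" using 1[OF i] by (intro sum_mono) auto
    also have "\<dots> = 2 * (\<Sum>\<sigma>\<in>Pow {..<k}. a i \<sigma>)" by (simp add: sum.distrib sum_Pow_flip[OF i])
    finally show ?thesis by simp
  qed
  have "\<exists>\<sigma>\<in>Pow {..<k}. real k / 4 \<le> (\<Sum>i<k. a i \<sigma>)"
  proof (rule ccontr)
    assume "\<not> ?thesis"
    then have "\<And>\<sigma>. \<sigma> \<in> Pow {..<k} \<Longrightarrow> (\<Sum>i<k. a i \<sigma>) < real k / 4" using not_le by blast
    then have "(\<Sum>\<sigma>\<in>Pow {..<k}. \<Sum>i<k. a i \<sigma>) < (\<Sum>\<sigma>\<in>Pow {..<k}. real k / 4)"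
      by (intro sum_strict_mono) (simp_all only: finite_Pow_iff finite_lessThan Pow_not_empty not_False_eq_True)
    moreover have "(\<Sum>\<sigma>\<in>Pow {..<k}. \<Sum>i<k. a i \<sigma>) = (\<Sum>i<k. \<Sum>\<sigma>\<in>Pow {..<k}. a i \<sigma>)" by (rule sum.swap)
    moreover have "(\<Sum>i<k. \<Sum>\<sigma>\<in>Pow {..<k}. a i \<sigma>) \<ge> (\<Sum>i<k. 2 ^ k / 4)" using 2 by (intro sum_mono) auto
    ultimately show False by (simp add: card_Pow mult.commute)
  qed
  moreover have "(\<Sum>i<k. a i \<sigma>) = (\<Sum>s\<in>S. W \<sigma> s * of_bool (g s) * (\<Sum>i<k. l \<sigma> i s))" for \<sigma>
    unfolding a_def by (subst sum.swap) (simp add: sum_distrib_left)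
  ultimately show ?thesis by auto
qed

section \<open>The slow lower bound and its configuration of points\<close>

lemma risk0_discrete_dist:
  assumes hc: "hypothesis_class M H" and h: "h \<in> H" and w: "weights I w" "y \<in> I \<rightarrow> space M"
  shows "risk0 (discrete_dist M I w y) h = (\<Sum>p\<in>I. w p * of_bool (h (y p)))"
proof -
  have "{x\<in>space M. h x} \<in> sets M"
    using hypothesis_sets[OF hc h discrete_dist_in_distributions[OF w]] by simp
  then have "risk0 (discrete_dist M I w y) h = (\<Sum>p\<in>I. w p * of_bool (y p \<in> {x\<in>space M. h x}))"
    unfolding risk0_def space_discrete_dist using w by (intro measure_discrete_dist) (auto simp: weights_def)
  also have "\<dots> = (\<Sum>p\<in>I. w p * of_bool (h (y p)))" using w(2) by (intro sum.cong refl) (auto simp: Pi_iff)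
  finally show ?thesis .
qed

text \<open>For \<open>k = 1\<close> and \<open>\<epsilon> = \<alpha>\<close> a hypothesis containing both points of the pair still meets the level
  \<open>\<alpha> + \<epsilon>\<close> under \<open>\<mu>0\<close>; it is excluded by letting a perturbation \<open>\<tau>\<close> of \<open>\<mu>0\<close> tend to 0.\<close>

lemma minimax_risk_ge_slow_rate:
  assumes hc: "hypothesis_class M H" and y: "y \<in> null_index k \<rightarrow> space M"
    and lab: "\<And>\<sigma>. \<sigma> \<subseteq> {..<k} \<Longrightarrow> \<exists>h\<in>H. \<not> h (y (k, True)) \<and> (\<forall>i<k. \<forall>c. h (y (i, c)) \<longleftrightarrow> (i \<in> \<sigma>) = c)"
    and k: "1 \<le> k" "k \<le> n" and \<alpha>: "0 < \<alpha>" "\<alpha> < 1/2"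
    and \<epsilon>: "0 < \<epsilon>" "\<epsilon> \<le> \<alpha> / real k" "\<alpha> + 2 * \<epsilon> < 1/2" "k = 1 \<or> \<epsilon> < \<alpha> / real k" and \<delta>: "\<delta> < 1/2"
  shows "ennreal (sqrt (real k / real n) / 48) \<le> minimax_risk M H \<alpha> \<epsilon> \<delta> n0 n"
proof (rule minimax_risk_ge)
  fix L assume L: "L \<in> approx_learners M H \<alpha> \<epsilon> \<delta> n0 n"
  define e where "e = sqrt (real k / real n) / 6"
  have "real k / real n \<le> 1" using k by simp
  then have e: "0 \<le> e" "e \<le> 1 / 6" by (auto simp: e_def)
  define D where "D \<tau> = discrete_dist M (null_index k) (null_weight k \<alpha> \<tau>) y" for \<tau>
  define D1 where "D1 \<sigma> = discrete_dist M (pairs k) (alt_weight k e \<sigma>) y" for \<sigma>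
  define N where "N h = (\<Sum>p\<in>pairs k. of_bool (h (y p)) :: nat)" for h
  let ?K = "level_class H (\<alpha> + \<epsilon>) (D 0)"
  define S where "S = pair_index n0 n (null_index k) (pairs k)"
  define X where "X = pair_point n0 n y y"
  \<comment> \<open>Success is read off from D 0 and the count of chosen points, so it depends
    neither on \<sigma>, as Assouad's method requires, nor on \<tau>.\<close>
  define gd where "gd s \<longleftrightarrow> L (X s) \<in> ?K \<and> N (L (X s)) \<le> k" for s
  define W where "W \<tau> \<sigma> = pair_weight n0 n (null_weight k \<alpha> \<tau>) (alt_weight k e \<sigma>)" for \<tau> \<sigma>
  have y1: "y \<in> pairs k \<rightarrow> space M" using y by auto
  have w1: "weights (pairs k) (alt_weight k e \<sigma>)" for \<sigma> using weights_alt k e by simp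
  have w0: "weights (null_index k) (null_weight k \<alpha> \<tau>)" if "0 \<le> \<tau>" "real k * \<tau> \<le> 1 - 2 * \<alpha>" for \<tau>
    using weights_null k \<alpha> that by simp
  have w00: "weights (null_index k) (null_weight k \<alpha> 0)" using \<alpha> by (intro w0) auto
  have riskD: "risk0 (D \<tau>) h = (1 - 2 * \<alpha> - real k * \<tau>) * of_bool (h (y (k, True)))
      + (\<Sum>i<k. \<alpha> / k * of_bool (h (y (i, True))) + (\<alpha> / k + \<tau>) * of_bool (h (y (i, False))))"
    if "h \<in> H" "0 \<le> \<tau>" "real k * \<tau> \<le> 1 - 2 * \<alpha>" for h \<tau>
    unfolding D_def risk0_discrete_dist[OF hc that(1) w0[OF that(2,3)] y] sum_null_index
      sum_pairs[where b = "\<lambda>_. True"]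
    by (intro arg_cong2[where f = "(+)"] sum.cong refl) (auto simp: null_weight_def)
  have N_eq: "real (N h) = (\<Sum>i<k. of_bool (h (y (i, b i))) + of_bool (h (y (i, \<not> b i))))" for h b
    unfolding N_def of_nat_sum sum_pairs[where b = b] by simp
  have riskD0: "risk0 (D 0) h = (1 - 2 * \<alpha>) * of_bool (h (y (k, True))) + \<alpha> / k * real (N h)" if "h \<in> H" for h
    using riskD[OF that, of 0] \<alpha> by (simp add: N_eq[of h "\<lambda>_. True"] sum_distrib_left distrib_left)
  have lev_ne: "level_class H \<alpha> (D \<tau>) \<noteq> {}" if "0 \<le> \<tau>" "real k * \<tau> \<le> 1 - 2 * \<alpha>" for \<tau>
  proof -
    obtain h where h: "h\<in>H" "\<not> h (y (k, True))" "\<forall>i<k. \<forall>c. h (y (i, c)) \<longleftrightarrow> (i \<in> {..<k}) = c"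
      using lab[of "{..<k}"] by blast
    have "risk0 (D \<tau>) h = (\<Sum>i<k. \<alpha> / k)" unfolding riskD[OF h(1) that] using h(2,3) by simp
    then have "h \<in> level_class H \<alpha> (D \<tau>)" using h(1) k by (simp add: level_class_def)
    then show ?thesis by blast
  qed
  have prob: "1 - \<delta> \<le> (\<Sum>s\<in>S. W \<tau> \<sigma> s * of_bool (L (X s) \<in> level_class H (\<alpha> + \<epsilon>) (D \<tau>)))"
    if "0 \<le> \<tau>" "real k * \<tau> \<le> 1 - 2 * \<alpha>" for \<tau> \<sigma>
    unfolding S_def W_def X_def D_def
    by (rule learner_prob_ge[OF L \<delta> w0[OF that] y w1 y1 lev_ne[OF that, unfolded D_def]])
  have Wnn: "0 \<le> W \<tau> \<sigma> s" if "0 \<le> \<tau>" "real k * \<tau> \<le> 1 - 2 * \<alpha>" "s \<in> S" for \<tau> \<sigma> s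
    using weights_pair_index[OF w0[OF that(1,2)] w1, of n0 n \<sigma>] that(3) by (auto simp: weights_def S_def W_def)
  have good: "1 / 2 \<le> (\<Sum>s\<in>S. W 0 \<sigma> s * of_bool (gd s))" for \<sigma>
  proof (cases "\<epsilon> < \<alpha> / real k")
    case True
    \<comment> \<open>Taking k + 1 points would cost \<alpha> + \<alpha> / k, which exceeds \<alpha>
      + \<epsilon>.\<close>
    have "N h \<le> k" if h: "h \<in> ?K" for h
    proof (rule ccontr)
      assume "\<not> N h \<le> k"
      then have "real k + 1 \<le> real (N h)" by linarith
      then have "\<alpha> / k * (real k + 1) \<le> \<alpha> / k * real (N h)" using \<alpha> by (intro mult_left_mono) auto
      moreover have "0 \<le> (1 - 2 * \<alpha>) * of_bool (h (y (k, True)))" using \<alpha> by simp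
      moreover have "risk0 (D 0) h \<le> \<alpha> + \<epsilon>" "h \<in> H" using h by (auto simp: level_class_def)
      moreover have "\<alpha> / k * (real k + 1) = \<alpha> + \<alpha> / k" using k by (simp add: distrib_left)
      ultimately show False using True riskD0[of h] by linarith
    qed
    then have "gd s \<longleftrightarrow> L (X s) \<in> ?K" for s by (auto simp: gd_def)
    then show ?thesis using prob[of 0 \<sigma>] \<alpha> \<delta> by simp
  next
    case False
    then have k1: "k = 1" and ea: "\<epsilon> = \<alpha>" using \<epsilon> by auto
    \<comment> \<open>Here \<alpha> + 2 \<epsilon> is 3 \<alpha>. For 0 < \<tau> < 1/3 the reserve
      mass 1 - 2 \<alpha> - \<tau> then exceeds the level 2 \<alpha>, and so does the mass 2
      \<alpha> + \<tau> of the whole pair.\<close>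
    have a6: "\<alpha> < 1 / 6" using \<epsilon>(3) ea by simp
    have "1 - \<delta> \<le> (\<Sum>s\<in>S. W \<tau> \<sigma> s * of_bool (gd s))" if \<tau>: "0 < \<tau>" "\<tau> < 1 / 3" for \<tau>
    proof -
      have t: "0 \<le> \<tau>" "real k * \<tau> \<le> 1 - 2 * \<alpha>" using \<tau> a6 k1 by auto
      have sub: "h \<in> ?K \<and> N h \<le> k" if h: "h \<in> level_class H (\<alpha> + \<epsilon>) (D \<tau>)" for h
      proof -
        have hH: "h \<in> H" and r: "risk0 (D \<tau>) h \<le> 2 * \<alpha>" using h ea by (auto simp: level_class_def)
        have Nh: "N h = of_bool (h (y (0, True))) + of_bool (h (y (0, False)))"
        proof (rule of_nat_eq_iff[where 'a = real, THEN iffD1])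
          show "real (N h) = real (of_bool (h (y (0, True))) + of_bool (h (y (0, False))))"
            using N_eq[of h "\<lambda>_. True"] k1 by simp
        qed
        have rt: "risk0 (D \<tau>) h = (1 - 2 * \<alpha> - \<tau>) * of_bool (h (y (1, True)))
            + \<alpha> * of_bool (h (y (0, True))) + (\<alpha> + \<tau>) * of_bool (h (y (0, False)))"
          using riskD[OF hH t] k1 by simp
        have 1: "\<not> h (y (1, True))"
        proof
          assume "h (y (1, True))"
          moreover have "0 \<le> \<alpha> * of_bool (h (y (0, True)))" "0 \<le> (\<alpha> + \<tau>) * of_bool (h (y (0, False)))"
            using \<alpha> \<tau> by auto
          ultimately show False using rt r a6 \<tau> by simp
        qed
        then have 2: "\<not> (h (y (0, True)) \<and> h (y (0, False)))" using rt r \<tau> by auto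
        then have "N h \<le> 1" using Nh by auto
        moreover have "risk0 (D 0) h \<le> 2 * \<alpha>"
          using riskD0[OF hH] 1 k1 \<open>N h \<le> 1\<close> \<alpha> mult_left_mono[of "real (N h)" 1 \<alpha>] by simp
        ultimately show ?thesis using hH k1 ea by (simp add: level_class_def)
      qed
      have "1 - \<delta> \<le> (\<Sum>s\<in>S. W \<tau> \<sigma> s * of_bool (L (X s) \<in> level_class H (\<alpha> + \<epsilon>) (D \<tau>)))" by (rule prob[OF t])
      also have "\<dots> \<le> (\<Sum>s\<in>S. W \<tau> \<sigma> s * of_bool (gd s))"
      proof (intro sum_mono mult_left_mono Wnn[OF t])
        show "(of_bool (L (X s) \<in> level_class H (\<alpha> + \<epsilon>) (D \<tau>)) :: real) \<le> of_bool (gd s)" for s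
          using sub[of "L (X s)"] by (auto simp: gd_def)
      qed
      finally show ?thesis .
    qed
    then have ev: "\<forall>\<^sub>F \<tau> in at_right 0. 1 - \<delta> \<le> (\<Sum>s\<in>S. W \<tau> \<sigma> s * of_bool (gd s))"
      using eventually_at_right_real[of 0 "1/3::real"] by (auto elim!: eventually_mono)
    \<comment> \<open>The learner is fixed and the weights of its success event are polynomials in
      \<tau>, so the bound survives the limit.\<close>
    have "((\<lambda>\<tau>. null_weight k \<alpha> \<tau> p) \<longlongrightarrow> null_weight k \<alpha> 0 p) (at_right 0)" for p
      by (cases "fst p < k"; cases "snd p") (auto simp: null_weight_def intro!: tendsto_eq_intros)
    then have "((\<lambda>\<tau>. \<Sum>s\<in>S. W \<tau> \<sigma> s * of_bool (gd s)) \<longlongrightarrow> (\<Sum>s\<in>S. W 0 \<sigma> s * of_bool (gd s))) (at_right 0)"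
      unfolding W_def pair_weight_def by (intro tendsto_sum tendsto_mult tendsto_prod tendsto_const)
    then have "1 - \<delta> \<le> (\<Sum>s\<in>S. W 0 \<sigma> s * of_bool (gd s))"
      by (rule tendsto_lowerbound[OF _ ev]) simp
    then show ?thesis using \<delta> by linarith
  qed
  \<comment> \<open>Loss on pair i: 0 if only the heavier point is taken, 2 if only the lighter one,
    1 otherwise. Flipping bit i exchanges the two roles.\<close>
  define l where "l \<sigma> i s = (1 - of_bool (L (X s) (y (i, i \<in> \<sigma>))) + of_bool (L (X s) (y (i, i \<notin> \<sigma>))) :: real)" for \<sigma> i s
  have risk1D: "risk0 (D1 \<sigma>) h = (\<Sum>i<k. (1 + e) / (2 * k) * of_bool (h (y (i, i \<in> \<sigma>)))
      + (1 - e) / (2 * k) * of_bool (h (y (i, i \<notin> \<sigma>))))" if "h \<in> H" for h \<sigma>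
    unfolding D1_def risk0_discrete_dist[OF hc that w1 y1] sum_pairs[where b = "\<lambda>i. i \<in> \<sigma>"]
    by (intro sum.cong refl) (simp add: alt_weight_def)
  have Dd: "D 0 \<in> distributions M" "D1 \<sigma> \<in> distributions M" for \<sigma>
    unfolding D_def D1_def by (intro discrete_dist_in_distributions w00 w1 y y1)+
  have adm: "(D 0, D1 \<sigma>) \<in> admissible_pairs M H \<alpha>" for \<sigma>
    using Dd lev_ne[of 0] \<alpha> by (simp add: admissible_pairs_def)
  define trunc where "trunc \<sigma> = truncated_excess H \<alpha> \<epsilon> (D 0) (D1 \<sigma>)" for \<sigma>
  have trunc_nonneg: "0 \<le> trunc \<sigma> h" for \<sigma> h
    using truncated_excess_bounds(1)[OF adm] by (simp add: trunc_def)
  have excess: "e / (2 * k) * (\<Sum>i<k. l \<sigma> i s) \<le> trunc \<sigma> (L (X s))"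
    if \<sigma>: "\<sigma> \<subseteq> {..<k}" and s: "gd s" for \<sigma> s
  proof -
    let ?h = "L (X s)"
    have h: "?h \<in> ?K" "N ?h \<le> k" "?h \<in> H" using s by (auto simp: gd_def level_class_def)
    obtain g where g: "g\<in>H" "\<not> g (y (k, True))" "\<forall>i<k. \<forall>c. g (y (i, c)) \<longleftrightarrow> (i \<in> \<sigma>) = c"
      using lab[OF \<sigma>] by blast
    have "real (N g) = real k" unfolding N_eq[of g "\<lambda>i. i \<in> \<sigma>"] using g(3) by simp
    then have "g \<in> level_class H \<alpha> (D 0)" using riskD0[OF g(1)] g(1,2) k by (simp add: level_class_def)
    then have "(INF h'\<in>level_class H \<alpha> (D 0). risk1 (D1 \<sigma>) h') \<le> risk1 (D1 \<sigma>) g"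
      by (rule INF_risk1_le[OF Dd(2)])
    then have ex: "risk0 (D1 \<sigma>) g - risk0 (D1 \<sigma>) ?h \<le> excess_risk H \<alpha> (D 0) (D1 \<sigma>) ?h"
      by (simp add: excess_risk_def risk1_eq[OF hc _ Dd(2)] g(1) h(3))
    have "risk0 (D1 \<sigma>) g = (\<Sum>i<k. (1 + e) / (2 * k))" unfolding risk1D[OF g(1)] using g(3) by simp
    then have gr: "risk0 (D1 \<sigma>) g = (1 + e) / (2 * k) * k" by simp
    let ?F = "\<Sum>i<k. of_bool (?h (y (i, i \<in> \<sigma>))) :: real" and ?U = "\<Sum>i<k. of_bool (?h (y (i, i \<notin> \<sigma>))) :: real"
    have hr: "risk0 (D1 \<sigma>) ?h = (1 + e) / (2 * k) * ?F + (1 - e) / (2 * k) * ?U"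
      unfolding risk1D[OF h(3)] by (simp only: sum.distrib sum_distrib_left)
    have "real (N ?h) = ?F + ?U" unfolding N_eq[of ?h "\<lambda>i. i \<in> \<sigma>"] by (simp add: sum.distrib)
    then have FU: "?F + ?U \<le> k" using h(2) by simp
    have ls: "(\<Sum>i<k. l \<sigma> i s) = k - ?F + ?U" by (simp add: l_def sum.distrib sum_subtractf)
    have "e / (2 * k) * (\<Sum>i<k. l \<sigma> i s) \<le> (e * (k - ?F + ?U) + (k - (?F + ?U))) / (2 * k)"
      unfolding ls using FU by (simp add: divide_right_mono)
    also have "\<dots> = risk0 (D1 \<sigma>) g - risk0 (D1 \<sigma>) ?h"
    proof -
      have "(e * (k - F + U) + (k - (F + U))) / c = (1 + e) / c * k - ((1 + e) / c * F + (1 - e) / c * U)" for F U c :: real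
        by (simp add: algebra_simps add_divide_distrib diff_divide_distrib)
      then show ?thesis unfolding gr hr .
    qed
    finally show ?thesis using ex h(1) by (simp add: trunc_def truncated_excess_def)
  qed
  have Wone: "(\<Sum>s\<in>S. W 0 \<sigma> s) = 1" for \<sigma>
    using weights_pair_index[OF w00 w1, of n0 n \<sigma>] by (simp add: weights_def S_def W_def)
  have fS: "finite S" using weights_pair_index[OF w00 w1, of n0 n] by (simp add: weights_def S_def)
  have "\<exists>\<sigma>\<subseteq>{..<k}. real k / 4 \<le> (\<Sum>s\<in>S. W 0 \<sigma> s * of_bool (gd s) * (\<Sum>i<k. l \<sigma> i s))"
  proof (rule assouad[OF fS])
    show "0 \<le> W 0 \<sigma> s" if "s \<in> S" for \<sigma> s using Wnn[of 0 s \<sigma>] that \<alpha> by simp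
    show "0 \<le> l \<sigma> i s" for \<sigma> i s by (simp add: l_def)
    show "l \<sigma> i s + l (flip i \<sigma>) i s = 2" for \<sigma> i s
      by (cases "i \<in> \<sigma>") (simp_all add: l_def flip_def)
    show "3 / 4 \<le> (\<Sum>s\<in>S. min (W 0 \<sigma> s) (W 0 (flip i \<sigma>) s))" if "i < k" for \<sigma> i
      unfolding S_def W_def
    proof (rule sum_min_flip_ge[OF k that e_def])
      show "0 < null_weight k \<alpha> 0 p" for p using \<alpha> k by (simp add: null_weight_def)
      show "(\<Sum>p\<in>null_index k. null_weight k \<alpha> 0 p) = 1" using w00 by (simp add: weights_def)
    qed simp
  qed (use Wone good in auto)
  then obtain \<sigma> where \<sigma>: "\<sigma> \<subseteq> {..<k}"
    "real k / 4 \<le> (\<Sum>s\<in>S. W 0 \<sigma> s * of_bool (gd s) * (\<Sum>i<k. l \<sigma> i s))" by blast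
  \<comment> \<open>The factor e / (2 k) times k / 4 is e / 8, and e itself is a sixth of the square
    root.\<close>
  have "sqrt (real k / real n) / 48 = e / (2 * k) * (k / 4)" using k by (simp add: e_def)
  also have "\<dots> \<le> e / (2 * k) * (\<Sum>s\<in>S. W 0 \<sigma> s * of_bool (gd s) * (\<Sum>i<k. l \<sigma> i s))"
    using \<sigma>(2) e by (intro mult_left_mono) auto
  also have "\<dots> = (\<Sum>s\<in>S. W 0 \<sigma> s * (of_bool (gd s) * (e / (2 * k) * (\<Sum>i<k. l \<sigma> i s))))"
    unfolding sum_distrib_left[of "e / (2 * k)" _ S] by (intro sum.cong refl) (simp only: mult_ac)
  also have "\<dots> \<le> (\<Sum>s\<in>S. W 0 \<sigma> s * trunc \<sigma> (L (X s)))"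
  proof (intro sum_mono mult_left_mono)
    fix s assume s: "s \<in> S"
    show "0 \<le> W 0 \<sigma> s" using Wnn[of 0 s \<sigma>] s \<alpha> by simp
    show "of_bool (gd s) * (e / (2 * k) * (\<Sum>i<k. l \<sigma> i s)) \<le> trunc \<sigma> (L (X s))"
      using excess[OF \<sigma>(1), of s] trunc_nonneg by (cases "gd s") simp_all
  qed
  finally have "ennreal (sqrt (real k / real n) / 48)
      \<le> ennreal (\<Sum>s\<in>S. W 0 \<sigma> s * trunc \<sigma> (L (X s)))" by (rule ennreal_leI)
  also have "\<dots> \<le> outer_expectation (sample_pair n0 n (D 0) (D1 \<sigma>)) (\<lambda>S. trunc \<sigma> (L S))"
    unfolding S_def W_def X_def unfolding D_def D1_def
    by (rule outer_expectation_discrete_ge[OF w00 y w1 y1 trunc_nonneg])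
  finally show "\<exists>\<mu>0 \<mu>1. (\<mu>0, \<mu>1) \<in> admissible_pairs M H \<alpha> \<and> ennreal (sqrt (real k / real n) / 48)
      \<le> outer_expectation (sample_pair n0 n \<mu>0 \<mu>1) (\<lambda>S. truncated_excess H \<alpha> \<epsilon> \<mu>0 \<mu>1 (L S))"
    using adm unfolding trunc_def by blast
qed

text \<open>For d \<le> 2 the three separated points form one pair and its reserve point. Otherwise
  2 k + 1 points of a largest shattered set serve, with k about d / 2: this gives k < d, hence the
  strict bound on \<epsilon>0, and still d \<le> 4 k.\<close>

lemma separating_pairs:
  assumes vc: "has_vc_dim M H d" and sep: "separates_three_points M H"
  obtains k y where "1 \<le> k" "k \<le> d" "d \<le> 4 * k" "k = 1 \<or> k < d" "y \<in> null_index k \<rightarrow> space M"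
    "\<forall>\<sigma>\<subseteq>{..<k}. \<exists>h\<in>H. \<not> h (y (k, True)) \<and> (\<forall>i<k. \<forall>c. h (y (i, c)) \<longleftrightarrow> (i \<in> \<sigma>) = c)"
proof (cases "d \<le> 2")
  case True
  obtain h1 h2 x0 x1 x2 where x: "h1 \<in> H" "h2 \<in> H" "x0 \<in> space M" "x1 \<in> space M" "x2 \<in> space M"
    "\<not> h1 x0" "\<not> h2 x0" "h1 x1" "h2 x2" "\<not> h1 x2" "\<not> h2 x1"
    using sep unfolding separates_three_points_def by blast
  have "shatters H {x1}"
    unfolding shatters_def
  proof
    fix l :: "'a \<Rightarrow> bool"
    show "\<exists>h\<in>H. \<forall>x\<in>{x1}. h x = l x"
      using x(1,2,8,11) by (cases "l x1") auto
  qed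
  moreover have "{x1} \<subseteq> space M" "finite {x1}" using x(4) by auto
  ultimately have "card {x1} \<le> d" using vc unfolding has_vc_dim_def by blast
  then have d: "1 \<le> d" by simp
  define y where "y p = (if fst p = (0::nat) then (if snd p then x1 else x2) else x0)" for p
  have "\<exists>h\<in>H. \<not> h (y (1, True)) \<and> (\<forall>i<1. \<forall>c. h (y (i, c)) \<longleftrightarrow> (i \<in> \<sigma>) = c)" for \<sigma>
  proof (cases "0 \<in> \<sigma>")
    case True
    then show ?thesis using x by (intro bexI[of _ h1]) (auto simp: y_def)
  next
    case False
    then show ?thesis using x by (intro bexI[of _ h2]) (auto simp: y_def)
  qed
  moreover have "y \<in> null_index 1 \<rightarrow> space M" using x by (auto simp: y_def)
  ultimately show ?thesis using that[of 1 y] d True by auto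
next
  case False
  obtain A where A: "A \<subseteq> space M" "finite A" "card A = d" "shatters H A"
    using vc unfolding has_vc_dim_def by blast
  obtain f where f: "bij_betw f {..<d} A"
    using A by (metis bij_betw_from_nat_into_finite)
  define k where "k = (d - 1) div 2"
  have k: "1 \<le> k" "2 * k < d" "d \<le> 4 * k" using False unfolding k_def by presburger+
  \<comment> \<open>Pair i occupies the positions 2 i and 2 i + 1, and the reserve point the
    position 2 k.\<close>
  define j where "j p = (if fst p < k then 2 * fst p + of_bool (snd p) else 2 * k)" for p :: "nat \<times> bool"
  define y where "y p = f (j p)" for p
  have jd: "j p < d" for p using k by (cases "snd p") (auto simp: j_def)
  then have yA: "y p \<in> A" for p using bij_betw_apply[OF f, of "j p"] by (simp add: y_def)
  have inj: "inj_on f {..<d}" using f by (simp add: bij_betw_def)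
  have "\<exists>h\<in>H. \<not> h (y (k, True)) \<and> (\<forall>i<k. \<forall>c. h (y (i, c)) \<longleftrightarrow> (i \<in> \<sigma>) = c)" for \<sigma>
  proof -
    let ?l = "\<lambda>x. \<exists>i<k. x = y (i, i \<in> \<sigma>)"
    obtain h where h: "h \<in> H" "\<forall>x\<in>A. h x = ?l x" using A(4)[unfolded shatters_def, rule_format, of ?l] by blast
    have yy: "y p = y q \<longleftrightarrow> j p = j q" for p q
      using inj_onD[OF inj, of "j p" "j q"] jd by (auto simp: y_def)
    have l0: "?l (y (k, True)) = False" unfolding yy by (auto simp: j_def of_bool_def split: if_splits)
    have l1: "?l (y (i, c)) = ((i \<in> \<sigma>) = c)" if "i < k" for i c
    proof -
      have ji: "j (i, c) = 2 * i + of_bool c" if "i < k" for i c using that by (simp add: j_def)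
      have "j (i, c) = j (i', c') \<longleftrightarrow> i = i' \<and> c = c'" if "i' < k" for i' c'
        unfolding ji[OF \<open>i < k\<close>] ji[OF that] by (cases c; cases c'; simp; presburger)
      then have "?l (y (i, c)) \<longleftrightarrow> (\<exists>i'<k. i = i' \<and> c = (i' \<in> \<sigma>))" unfolding yy by (metis (full_types))
      then show ?thesis using that by blast
    qed
    have hy: "h (y p) = ?l (y p)" for p by (rule bspec[OF h(2) yA])
    have "\<not> h (y (k, True))" unfolding hy l0 by simp
    moreover have "h (y (i, c)) \<longleftrightarrow> (i \<in> \<sigma>) = c" if "i < k" for i c
      unfolding hy l1[OF that] by (rule refl)
    ultimately have "\<not> h (y (k, True)) \<and> (\<forall>i<k. \<forall>c. h (y (i, c)) \<longleftrightarrow> (i \<in> \<sigma>) = c)" by simp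
    then show ?thesis using h(1) by blast
  qed
  moreover have "y \<in> null_index k \<rightarrow> space M" using yA A(1) by auto
  ultimately show ?thesis using that[of k y] k by auto
qed

text \<open>A point at which some g exceeds u is labelled in both ways. This allows the upper bound
  of order 1 / n to be written with d / n.\<close>

lemma vc_dim_pos_if_no_maximal:
  assumes vc: "has_vc_dim M H d" and K: "K \<subseteq> H" "K \<noteq> {}" "\<not> has_maximal_element M K"
  shows "1 \<le> d"
proof -
  obtain u where u: "u \<in> K" using K(2) by blast
  then obtain g where g: "g \<in> K" "\<not> sub_on M g u" using K(3) by (auto simp: has_maximal_element_iff)
  then obtain x where x: "x \<in> space M" "g x" "\<not> u x" by (auto simp: sub_on_def)
  have "shatters H {x}"
    unfolding shatters_def
  proof
    fix l :: "'a \<Rightarrow> bool"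
    show "\<exists>h\<in>H. \<forall>x\<in>{x}. h x = l x"
      using x(2,3) u g(1) K(1) by (cases "l x") auto
  qed
  then have "card {x} \<le> d" using vc x(1) unfolding has_vc_dim_def by blast
  then show ?thesis by simp
qed

text \<open>The hidden logarithms become a power of ln n whose exponent is fixed before all data.
  For d = 0 the restriction on \<epsilon>0 is void, as division by 0 gives 0 and would make it
  unsatisfiable. An empty level class lacks a maximal element for a trivial reason, hence the demand
  for nonempty ones. In the last part one learner serves all pairs.\<close>

theorem theorem2:
  shows "\<exists>c>0. \<exists>C>0. \<exists>k::nat.
    \<forall>(M :: 'a measure) (H :: ('a \<Rightarrow> bool) set) (d::nat) (\<alpha>::real) (\<delta>0::real) (\<epsilon>0::real) (n::nat) (n0::nat).
      singletons_measurable M \<longrightarrow> hypothesis_class M H \<longrightarrow> has_vc_dim M H d \<longrightarrow>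
      0 < \<alpha> \<longrightarrow> \<alpha> < 1/2 \<longrightarrow> 0 < \<delta>0 \<longrightarrow> \<delta>0 < 1/2 \<longrightarrow>
      0 < \<epsilon>0 \<longrightarrow> (d > 0 \<longrightarrow> \<epsilon>0 \<le> \<alpha> / real d) \<longrightarrow> \<alpha> + 2 * \<epsilon>0 < 1/2 \<longrightarrow>
      n0 = sample_size M H (\<epsilon>0 / 2) \<delta>0 \<longrightarrow>
      0 < n \<longrightarrow> real d / real n \<le> 1/2 \<longrightarrow>
      (separates_three_points M H \<longrightarrow>
         ennreal (c * sqrt (real d / real n)) \<le> minimax_risk M H \<alpha> \<epsilon>0 \<delta>0 n0 n \<and>
         (vc_measurable M H \<longrightarrow>
            minimax_risk M H \<alpha> \<epsilon>0 \<delta>0 n0 n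
              \<le> ennreal (C * ln (real n) ^ k * sqrt (real d / real n) + \<delta>0))) \<and>
      (\<not> separates_three_points M H \<longrightarrow>
         ((\<exists>\<mu>0\<in>distributions M. finite_support \<mu>0 \<and> level_class H (\<alpha> + \<epsilon>0) \<mu>0 \<noteq> {} \<and>
              \<not> has_maximal_element M (level_class H (\<alpha> + \<epsilon>0) \<mu>0)) \<longrightarrow>
            ennreal (c * (real d / real n)) \<le> minimax_risk M H \<alpha> \<epsilon>0 \<delta>0 n0 n \<and>
            (vc_measurable M H \<longrightarrow>
               minimax_risk M H \<alpha> \<epsilon>0 \<delta>0 n0 n
                 \<le> ennreal (C * ln (real n) ^ k * (real d / real n) + \<delta>0))) \<and>
         ((\<forall>\<mu>0\<in>distributions M. finite_support \<mu>0 \<longrightarrow> level_class H (\<alpha> + \<epsilon>0) \<mu>0 \<noteq> {} \<longrightarrow>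
              has_maximal_element M (level_class H (\<alpha> + \<epsilon>0) \<mu>0)) \<longrightarrow>
            vc_measurable M H \<longrightarrow>
            (\<exists>L\<in>approx_learners M H \<alpha> \<epsilon>0 \<delta>0 n0 n. \<forall>(\<mu>0, \<mu>1)\<in>admissible_pairs M H \<alpha>.
               inner_prob (sample_pair n0 n \<mu>0 \<mu>1)
                 (\<lambda>S. truncated_excess H \<alpha> \<epsilon>0 \<mu>0 \<mu>1 (L S) = 0) \<ge> ennreal (1 - \<delta>0))))"
proof (rule exI[of _ "1/96"], rule conjI, simp, rule exI[of _ 16], rule conjI, simp, rule exI[of _ 1], intro allI impI, goal_cases)
  case (1 M H d \<alpha> \<delta>0 \<epsilon>0 n n0)
  note sm = 1(1) and hc = 1(2) and vc = 1(3) and \<alpha> = 1(4,5) and \<delta> = 1(6,7) and \<epsilon> = 1(8-10)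
    and n0 = 1(11) and n = 1(12,13)
  note H = has_vc_dim_nonempty[OF vc]
  have uc: "uniformly_close M H (\<epsilon>0 / 2) \<delta>0 n0" if "vc_measurable M H"
    unfolding n0 using \<epsilon>(1) \<delta>(1) by (intro uniformly_close_sample_size[OF hc vc that]) auto
  have dn: "2 * d \<le> n"
  proof -
    have "real d \<le> real n / 2" using n by (simp add: pos_divide_le_eq)
    then show ?thesis by linarith
  qed
  have \<alpha>\<epsilon>: "0 \<le> \<alpha>" "0 \<le> \<epsilon>0" "\<alpha> + \<epsilon>0 < 1/2" and \<delta>': "0 \<le> \<delta>0" "\<delta>0 < 1" using \<alpha> \<epsilon> \<delta> by auto
  have fast: "\<exists>c1\<in>space M. \<exists>c2\<in>space M. avoiding H c1 c2 \<noteq> {} \<and> \<not> has_maximal_element M (avoiding H c1 c2)"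
    if "\<not> separates_three_points M H" "\<exists>\<mu>0\<in>distributions M. finite_support \<mu>0 \<and>
      level_class H (\<alpha> + \<epsilon>0) \<mu>0 \<noteq> {} \<and> \<not> has_maximal_element M (level_class H (\<alpha> + \<epsilon>0) \<mu>0)"
    using that no_maximal_element_avoiding[OF that(1) hc _ _ \<alpha>\<epsilon>(3)] by metis
  show ?case
  proof (intro conjI impI, goal_cases)
    case 1
    obtain k y where k: "1 \<le> k" "k \<le> d" "d \<le> 4 * k" "k = 1 \<or> k < d" and y: "y \<in> null_index k \<rightarrow> space M"
      and lab: "\<forall>\<sigma>\<subseteq>{..<k}. \<exists>h\<in>H. \<not> h (y (k, True)) \<and> (\<forall>i<k. \<forall>c. h (y (i, c)) \<longleftrightarrow> (i \<in> \<sigma>) = c)"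
      by (rule separating_pairs[OF vc 1]) blast
    have \<epsilon>d: "\<epsilon>0 \<le> \<alpha> / real d" using \<epsilon>(2) k by simp
    also have "\<alpha> / real d \<le> \<alpha> / real k" using k \<alpha> by (intro divide_left_mono) auto
    finally have \<epsilon>k: "\<epsilon>0 \<le> \<alpha> / real k" .
    have "\<alpha> / real d < \<alpha> / real k" if "k < d" using that k \<alpha> by (intro divide_strict_left_mono) auto
    then have \<epsilon>k': "k = 1 \<or> \<epsilon>0 < \<alpha> / real k" using k(4) \<epsilon>d by auto
    \<comment> \<open>By d \<le> 4 k the square root loses a factor 2, which turns 1/48 into
      1/96.\<close>
    have "sqrt (real d / real n) \<le> sqrt (2\<^sup>2 * (real k / real n))"
      using k(3) by (intro real_sqrt_le_mono) (simp add: divide_right_mono)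
    also have "\<dots> = 2 * sqrt (real k / real n)" by (simp only: real_sqrt_mult real_sqrt_abs)
    finally have "ennreal (1/96 * sqrt (real d / real n)) \<le> ennreal (sqrt (real k / real n) / 48)"
      by (intro ennreal_leI) simp
    also have "\<dots> \<le> minimax_risk M H \<alpha> \<epsilon>0 \<delta>0 n0 n"
      using lab k dn by (intro minimax_risk_ge_slow_rate[OF hc y _ _ _ \<alpha> \<epsilon>(1) \<epsilon>k \<epsilon>(3) \<epsilon>k' \<delta>(2)]) auto
    finally show ?case .
  next
    case 2
    have "1 \<le> d" by (rule separating_pairs[OF vc 2(1)]) simp
    then show ?case using minimax_risk_le_sqrt_rate[OF hc vc 2(2) uc[OF 2(2)] \<delta>'(1), of n \<alpha>] dn by simp
  next
    case 3
    then obtain c1 c2 where c: "c1 \<in> space M" "c2 \<in> space M" "avoiding H c1 c2 \<noteq> {}"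
      "\<not> has_maximal_element M (avoiding H c1 c2)" using fast by blast
    have "d \<le> 2"
    proof (rule ccontr)
      assume "\<not> d \<le> 2"
      moreover obtain A where "A \<subseteq> space M" "card A = d" "shatters H A" using vc unfolding has_vc_dim_def by blast
      ultimately have "separates_three_points M H" by (intro shatters_three_separates[of H A]) auto
      then show False using 3(1) by contradiction
    qed
    then have "ennreal (1/96 * (real d / real n)) \<le> ennreal (1 / (16 * real n))"
      using n(1) by (intro ennreal_leI) (simp add: field_simps)
    also have "\<dots> \<le> minimax_risk M H \<alpha> \<epsilon>0 \<delta>0 n0 n"
      using n(1) by (intro minimax_risk_ge_fast_rate[OF 3(1) hc c \<alpha>\<epsilon> \<delta>(2)]) simp
    finally show ?case .
  next
    case 4
    then obtain c1 c2 where c: "avoiding H c1 c2 \<noteq> {}" "\<not> has_maximal_element M (avoiding H c1 c2)"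
      using fast by blast
    have d1: "1 \<le> d" by (rule vc_dim_pos_if_no_maximal[OF vc _ c]) (auto simp: avoiding_def)
    then have n2: "2 \<le> n" using dn by simp
    note l = ln_nat_ge_half[OF n2]
    have "minimax_risk M H \<alpha> \<epsilon>0 \<delta>0 n0 n \<le> ennreal ((ln (real n) + 2) / real n + \<delta>0)"
      by (rule minimax_risk_le_fast_rate[OF 4(1) hc H uc[OF 4(3)] \<delta>' \<alpha>\<epsilon> n2])
    also have "\<dots> \<le> ennreal (16 * ln (real n) ^ 1 * (real d / real n) + \<delta>0)"
    proof (intro ennreal_leI add_right_mono)
      \<comment> \<open>The additive 2 is at most 4 ln n because ln n \<ge> 1/2.\<close>
      have "ln (real n) + 2 \<le> 16 * ln (real n) * 1" using l by simp
      also have "\<dots> \<le> 16 * ln (real n) * real d" using l d1 by (intro mult_left_mono) auto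
      finally show "(ln (real n) + 2) / real n \<le> 16 * ln (real n) ^ 1 * (real d / real n)"
        using n(1) by (simp add: divide_right_mono)
    qed
    finally show ?case .
  next
    case 5
    then show ?case by (intro maximal_element_learner[OF _ hc sm H uc \<delta>'(1) \<alpha>\<epsilon>])
  qed
qed

end
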